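(* The following results hold for any mixing density $h$ on $\mathbb{R}_+$. (i) Suppose there exist constants $0 \le \psi_1 < 1$ and $L_1 \in \mathbb{R}$, which do not depend on $\beta$ or $\sigma^2$, such that $$\frac{\sum_{i=1}^m E[z_i \mid \beta,\sigma^2,y]\,(y_i - x_i^T\beta)^2}{m+2\alpha-2} \le \psi_1\left[\sum_{i=1}^m (y_i - x_i^T\beta)^2 + \beta^T\Sigma^{-1}\beta + \sigma^2 + \frac{1}{\sigma^2}\right] + L_1$$ for every $\beta\in\mathbb{R}^p$, $\sigma^2\in\mathbb{R}_+$. Then the (marginal) systematic scan Gibbs Markov chain $\hat\Phi = \{(\hat\beta_n,\hat\sigma_n^2)\}_{n=0}^\infty$ is geometrically ergodic. (ii) Suppose there exist constants $\psi_2 \in \mathbb{R}_+$, $0 \le \psi_3 < 1$, and $L_2\in\mathbb{R}$, which do not depend on $\beta$ or $\sigma^2$, such that $$\frac{\sum_{i=1}^m E[z_i \mid \beta,\sigma^2,y]\,(y_i - x_i^T\beta)^2}{m+2\alpha-2} \le \psi_2\left[\sum_{i=1}^m (y_i - x_i^T\beta)^2 + \beta^T\Sigma^{-1}\beta\right] + \psi_3\left(\sigma^2 + \frac{1}{\sigma^2}\right) + L_2$$ for every $\beta\in\mathbb{R}^p$, $\sigma^2\in\mathbb{R}_+$. Then the hybrid scan Gibbs Markov chain $\Phi = \{(\beta_n,\sigma_n^2)\}_{n=0}^\infty$ with selection probability $r$ is geometrically ergodic for all $r\in(0,1)$.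
   Context: Notation: $\mathbb{R}_+ = (0,\infty)$. Let $m,p$ be positive integers with $m\ge\max\{2,p\}$. The data are $y=(y_1,\dots,y_m)\in\mathbb{R}^m$ (fixed), with known covariates $x_1,\dots,x_m\in\mathbb{R}^p$; $X$ is the $m\times p$ matrix whose $i$th row is $x_i^T$. The mixing density $h$ is a probability density with respect to Lebesgue measure on $\mathbb{R}_+$. The model is $Y_i = x_i^T\beta+\sigma\epsilon_i$, with $\epsilon_1,\dots,\epsilon_m$ iid with density $f_H(\epsilon) = \int_0^\infty \frac{\sqrt z}{\sqrt{2\pi}} e^{-z\epsilon^2/2} h(z)\,dz$. The prior takes $\beta$ and $\sigma^2$ independent with $\beta\sim N_p(\mu,\Sigma)$ ($\mu\in\mathbb{R}^p$, $\Sigma$ a $p\times p$ positive definite matrix) and $\sigma^2\sim \mathrm{IG}(\alpha,\gamma)$ ($\alpha,\gamma>0$), where $\mathrm{IG}(a,b)$ has density proportional to $v^{-a-1}e^{-b/v}$ on $\mathbb{R}_+$. The complete data posterior density of $(\beta,\sigma^2,z)\in\mathbb{R}^p\times\mathbb{R}_+\times\mathbb{R}_+^m$, $z=(z_1,\dots,z_m)$, satisfies $$\pi(\beta,\sigma^2,z\mid y)\propto\left[\prod_{i=1}^m \frac{\sqrt{z_i}}{\sqrt{2\pi\sigma^2}}\exp\left\{-\frac{z_i}{2}\frac{(y_i-x_i^T\beta)^2}{\sigma^2}\right\}h(z_i)\right](\sigma^2)^{-\alpha-1}e^{-\gamma/\sigma^2}\exp\left\{-\frac{(\beta-\mu)^T\Sigma^{-1}(\beta-\mu)}{2}\right\}.$$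 Its full conditionals are as follows. 1. Given $(\beta,\sigma^2,y)$, the $z_1,\dots,z_m$ are independent, $z_i$ having density proportional to $z_i^{1/2}\exp\{-\frac{z_i}{2}\frac{(y_i-x_i^T\beta)^2}{\sigma^2}\}h(z_i)$ on $\mathbb{R}_+$. $E[z_i\mid\beta,\sigma^2,y]$ denotes the mean of this density. 2. With $Q$ the $m\times m$ diagonal matrix with $i$th diagonal entry $z_i^{-1}$, $\sigma^2\mid\beta,z,y\sim \mathrm{IG}\left(\frac m2+\alpha,\ \frac{(y-X\beta)^TQ^{-1}(y-X\beta)+2\gamma}{2}\right)$. 3. $\beta\mid\sigma^2,z,y\sim N_p(\mu',\sigma^2\Sigma')$, where $\Sigma'=(X^TQ^{-1}X+\sigma^2\Sigma^{-1})^{-1}$ and $\mu'=\Sigma'(X^TQ^{-1}y+\sigma^2\Sigma^{-1}\mu)$. The conditional densities are written $\pi(z\mid\beta,\sigma^2,y)$, $\pi(\sigma^2\mid\beta,z,y)$, $\pi(\beta\mid\sigma^2,z,y)$. Hybrid scan chain $\Phi$ on $\mathbb{R}^p\times\mathbb{R}_+$ with selection probability $r\in(0,1)$: from $(\beta_n,\sigma^2_n)=(\beta,\sigma^2)$, draw $z\sim\pi(\cdot\mid\beta,\sigma^2,y)$ and, independently, $W\sim\mathrm{Uniform}(0,1)$. If $W\le r$, draw $\sigma^{*2}\sim\pi(\cdot\mid\beta,z,y)$ and set $(\beta_{n+1},\sigma_{n+1}^2)=(\beta,\sigma^{*2})$; otherwise draw $\beta^*\sim\pi(\cdot\mid\sigma^2,z,y)$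 and set $(\beta_{n+1},\sigma_{n+1}^2)=(\beta^*,\sigma^2)$. Systematic scan chain $\hat\Phi$ on $\mathbb{R}^p\times\mathbb{R}_+$: the Markov chain with transition density $$k_{\mathrm G}(\beta,\sigma^2\mid\hat\beta,\hat\sigma^2)=\int_{\mathbb{R}_+^m}\pi(\beta\mid\sigma^2,z,y)\,\pi(\sigma^2\mid\hat\beta,z,y)\,\pi(z\mid\hat\beta,\hat\sigma^2,y)\,dz.$$
   Formalization: It is additionally assumed that the full conditional density of each z_i exists (has finite normalizing constant) at every (β,σ²); this can fail only where y_i = x_i^Tβ and ∫√z h(z)dz = ∞, in which case the conditional, its mean and the chains are undefined there. *)

theory Defs
  imports "HOL-Probability.Probability"
begin

section \<open>Geometric ergodicity of Markov chains\<close>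

definition tv_distance :: "'a measure \<Rightarrow> 'a measure \<Rightarrow> 'a measure \<Rightarrow> real" where
  "tv_distance S P R = (SUP A\<in>sets S. \<bar>measure P A - measure R A\<bar>)"

primrec kernel_power :: "'a measure \<Rightarrow> ('a \<Rightarrow> 'a measure) \<Rightarrow> nat \<Rightarrow> 'a \<Rightarrow> 'a measure" where
  "kernel_power S K 0 x = return S x"
| "kernel_power S K (Suc n) x = kernel_power S K n x \<bind> K"

text \<open>The chain with Markov kernel \<open>K\<close> on \<open>S\<close> has invariant distribution \<open>P\<close>, and converges to it
  geometrically in total variation from every starting point. Only the measurable structure of
  \<open>S\<close> matters.\<close>

definition geometrically_ergodic ::
  "'a measure \<Rightarrow> ('a \<Rightarrow> 'a measure) \<Rightarrow> 'a measure \<Rightarrow> bool" where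
  "geometrically_ergodic S K P \<longleftrightarrow>
     K \<in> measurable S (prob_algebra S) \<and>
     prob_space P \<and> sets P = sets S \<and> P \<bind> K = P \<and>
     (\<exists>(M :: 'a \<Rightarrow> real) (\<rho> :: real).
        (\<forall>x\<in>space S. 0 \<le> M x) \<and> 0 \<le> \<rho> \<and> \<rho> < 1 \<and>
        (\<forall>x\<in>space S. \<forall>n. tv_distance S (kernel_power S K n x) P \<le> M x * \<rho> ^ n))"


section \<open>Spaces and standard distributions\<close>

abbreviation pos_reals :: "real measure" where
  "pos_reals \<equiv> restrict_space lborel {0<..}"

abbreviation pos_vectors :: "(real ^ 'm) measure" where
  "pos_vectors \<equiv> restrict_space lborel {z. \<forall>i. 0 < z $ i}"

text \<open>States are pairs \<open>(\<beta>, s)\<close>; throughout, \<open>s\<close> stands for the variance \<open>\<sigma>\<^sup>2\<close> itself.\<close>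

abbreviation state_space :: "((real ^ 'p) \<times> real) measure" where
  "state_space \<equiv> restrict_space lborel (UNIV \<times> {0<..})"

definition mixing_density :: "(real \<Rightarrow> real) \<Rightarrow> bool" where
  "mixing_density h \<longleftrightarrow>
     h \<in> borel_measurable pos_reals \<and> (\<forall>z>0. 0 \<le> h z) \<and> (\<integral>\<^sup>+z. ennreal (h z) \<partial>pos_reals) = 1"

definition pos_def_matrix :: "real ^ 'n ^ 'n \<Rightarrow> bool" where
  "pos_def_matrix A \<longleftrightarrow> transpose A = A \<and> (\<forall>v. v \<noteq> 0 \<longrightarrow> 0 < v \<bullet> (A *v v))"

definition normalized_measure :: "'a measure \<Rightarrow> ('a \<Rightarrow> real) \<Rightarrow> 'a measure" where
  "normalized_measure N f = density N (\<lambda>x. ennreal (f x) / (\<integral>\<^sup>+x. ennreal (f x) \<partial>N))"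

definition inv_gamma_density :: "real \<Rightarrow> real \<Rightarrow> real \<Rightarrow> real" where
  "inv_gamma_density a b v = b powr a / Gamma a * v powr (- a - 1) * exp (- b / v)"

definition mvn_density :: "real ^ 'p \<Rightarrow> real ^ 'p ^ 'p \<Rightarrow> real ^ 'p \<Rightarrow> real" where
  "mvn_density \<nu> V b =
     exp (- ((b - \<nu>) \<bullet> (matrix_inv V *v (b - \<nu>))) / 2) / sqrt ((2 * pi) ^ CARD('p) * det V)"


section \<open>Posterior distribution\<close>

text \<open>\<open>X\<close> is the \<open>m \<times> p\<close> matrix with rows \<open>x\<^sub>i = X $ i\<close>.\<close>

definition joint_posterior_kernel ::
  "real ^ 'm \<Rightarrow> real ^ 'p ^ 'm \<Rightarrow> (real \<Rightarrow> real) \<Rightarrow> real \<Rightarrow> real \<Rightarrow> real ^ 'p \<Rightarrow> real ^ 'p ^ 'p \<Rightarrow>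
    ((real ^ 'p) \<times> real) \<times> (real ^ 'm) \<Rightarrow> real" where
  "joint_posterior_kernel y X h \<alpha> \<gamma> \<mu> \<Sigma> = (\<lambda>((\<beta>, s), z).
     (\<Prod>i\<in>UNIV. sqrt (z $ i) / sqrt (2 * pi * s)
        * exp (- (z $ i / 2) * ((y $ i - X $ i \<bullet> \<beta>)\<^sup>2 / s)) * h (z $ i))
     * s powr (- \<alpha> - 1) * exp (- \<gamma> / s)
     * exp (- ((\<beta> - \<mu>) \<bullet> (matrix_inv \<Sigma> *v (\<beta> - \<mu>))) / 2))"

definition joint_posterior ::
  "real ^ 'm \<Rightarrow> real ^ 'p ^ 'm \<Rightarrow> (real \<Rightarrow> real) \<Rightarrow> real \<Rightarrow> real \<Rightarrow> real ^ 'p \<Rightarrow> real ^ 'p ^ 'p \<Rightarrow>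
    (((real ^ 'p) \<times> real) \<times> (real ^ 'm)) measure" where
  "joint_posterior y X h \<alpha> \<gamma> \<mu> \<Sigma> =
     normalized_measure (state_space \<Otimes>\<^sub>M pos_vectors) (joint_posterior_kernel y X h \<alpha> \<gamma> \<mu> \<Sigma>)"

definition marginal_posterior ::
  "real ^ 'm \<Rightarrow> real ^ 'p ^ 'm \<Rightarrow> (real \<Rightarrow> real) \<Rightarrow> real \<Rightarrow> real \<Rightarrow> real ^ 'p \<Rightarrow> real ^ 'p ^ 'p \<Rightarrow>
    ((real ^ 'p) \<times> real) measure" where
  "marginal_posterior y X h \<alpha> \<gamma> \<mu> \<Sigma> = distr (joint_posterior y X h \<alpha> \<gamma> \<mu> \<Sigma>) state_space fst"


section \<open>Full conditional densities\<close>

definition z_kernel ::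
  "real ^ 'm \<Rightarrow> real ^ 'p ^ 'm \<Rightarrow> (real \<Rightarrow> real) \<Rightarrow> 'm \<Rightarrow> real ^ 'p \<Rightarrow> real \<Rightarrow> real \<Rightarrow> real" where
  "z_kernel y X h i \<beta> s u =
     sqrt u * exp (- (u / 2) * ((y $ i - X $ i \<bullet> \<beta>)\<^sup>2 / s)) * h u"

text \<open>The conditional density of each latent variable exists at every state. This can only fail where
  a residual \<open>y\<^sub>i - x\<^sub>i\<^sup>T \<beta>\<close> vanishes.\<close>

definition z_conditionals_exist :: "real ^ 'm \<Rightarrow> real ^ 'p ^ 'm \<Rightarrow> (real \<Rightarrow> real) \<Rightarrow> bool" where
  "z_conditionals_exist y X h \<longleftrightarrow> (\<forall>i \<beta> s. 0 < s \<longrightarrow> integrable pos_reals (z_kernel y X h i \<beta> s))"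

definition z_component_density ::
  "real ^ 'm \<Rightarrow> real ^ 'p ^ 'm \<Rightarrow> (real \<Rightarrow> real) \<Rightarrow> 'm \<Rightarrow> real ^ 'p \<Rightarrow> real \<Rightarrow> real \<Rightarrow> real" where
  "z_component_density y X h i \<beta> s u =
     z_kernel y X h i \<beta> s u / (\<integral>v. z_kernel y X h i \<beta> s v \<partial>pos_reals)"

text \<open>\<open>E[z\<^sub>i | \<beta>, \<sigma>\<^sup>2, y]\<close>. It is finite unless the residual \<open>y\<^sub>i - x\<^sub>i\<^sup>T \<beta>\<close> is zero; where it is
  infinite the Bochner integral is 0. This is harmless, since below it is always multiplied by the
  squared residual.\<close>

definition z_mean ::
  "real ^ 'm \<Rightarrow> real ^ 'p ^ 'm \<Rightarrow> (real \<Rightarrow> real) \<Rightarrow> 'm \<Rightarrow> real ^ 'p \<Rightarrow> real \<Rightarrow> real" where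
  "z_mean y X h i \<beta> s = (\<integral>u. u * z_component_density y X h i \<beta> s u \<partial>pos_reals)"

definition z_density ::
  "real ^ 'm \<Rightarrow> real ^ 'p ^ 'm \<Rightarrow> (real \<Rightarrow> real) \<Rightarrow> real ^ 'p \<Rightarrow> real \<Rightarrow> real ^ 'm \<Rightarrow> real" where
  "z_density y X h \<beta> s z = (\<Prod>i\<in>UNIV. z_component_density y X h i \<beta> s (z $ i))"

definition Q_matrix :: "real ^ 'm \<Rightarrow> real ^ 'm ^ 'm" where
  "Q_matrix z = (\<chi> i j. if i = j then inverse (z $ i) else 0)"

definition sigma2_density ::
  "real ^ 'm \<Rightarrow> real ^ 'p ^ 'm \<Rightarrow> real \<Rightarrow> real \<Rightarrow> real ^ 'p \<Rightarrow> real ^ 'm \<Rightarrow> real \<Rightarrow> real" where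
  "sigma2_density y X \<alpha> \<gamma> \<beta> z =
     inv_gamma_density (real CARD('m) / 2 + \<alpha>)
       (((y - X *v \<beta>) \<bullet> (matrix_inv (Q_matrix z) *v (y - X *v \<beta>)) + 2 * \<gamma>) / 2)"

definition beta_cov :: "real ^ 'p ^ 'm \<Rightarrow> real ^ 'p ^ 'p \<Rightarrow> real \<Rightarrow> real ^ 'm \<Rightarrow> real ^ 'p ^ 'p" where
  "beta_cov X \<Sigma> s z =
     matrix_inv (transpose X ** matrix_inv (Q_matrix z) ** X + s *\<^sub>R matrix_inv \<Sigma>)"

definition beta_mean ::
  "real ^ 'm \<Rightarrow> real ^ 'p ^ 'm \<Rightarrow> real ^ 'p \<Rightarrow> real ^ 'p ^ 'p \<Rightarrow> real \<Rightarrow> real ^ 'm \<Rightarrow> real ^ 'p" where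
  "beta_mean y X \<mu> \<Sigma> s z =
     beta_cov X \<Sigma> s z *v
       ((transpose X ** matrix_inv (Q_matrix z)) *v y + s *\<^sub>R (matrix_inv \<Sigma> *v \<mu>))"

definition beta_density ::
  "real ^ 'm \<Rightarrow> real ^ 'p ^ 'm \<Rightarrow> real ^ 'p \<Rightarrow> real ^ 'p ^ 'p \<Rightarrow> real \<Rightarrow> real ^ 'm \<Rightarrow> real ^ 'p \<Rightarrow> real" where
  "beta_density y X \<mu> \<Sigma> s z = mvn_density (beta_mean y X \<mu> \<Sigma> s z) (s *\<^sub>R beta_cov X \<Sigma> s z)"


section \<open>The two Markov chains\<close>

definition systematic_density ::
  "real ^ 'm \<Rightarrow> real ^ 'p ^ 'm \<Rightarrow> (real \<Rightarrow> real) \<Rightarrow> real \<Rightarrow> real \<Rightarrow> real ^ 'p \<Rightarrow> real ^ 'p ^ 'p \<Rightarrow>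
    (real ^ 'p) \<times> real \<Rightarrow> (real ^ 'p) \<times> real \<Rightarrow> ennreal" where
  "systematic_density y X h \<alpha> \<gamma> \<mu> \<Sigma> = (\<lambda>(\<beta>', s') (\<beta>, s).
     \<integral>\<^sup>+z. ennreal (beta_density y X \<mu> \<Sigma> s z \<beta> * sigma2_density y X \<alpha> \<gamma> \<beta>' z s * z_density y X h \<beta>' s' z)
       \<partial>pos_vectors)"

definition systematic_scan_kernel ::
  "real ^ 'm \<Rightarrow> real ^ 'p ^ 'm \<Rightarrow> (real \<Rightarrow> real) \<Rightarrow> real \<Rightarrow> real \<Rightarrow> real ^ 'p \<Rightarrow> real ^ 'p ^ 'p \<Rightarrow>
    (real ^ 'p) \<times> real \<Rightarrow> ((real ^ 'p) \<times> real) measure" where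
  "systematic_scan_kernel y X h \<alpha> \<gamma> \<mu> \<Sigma> x =
     density state_space (systematic_density y X h \<alpha> \<gamma> \<mu> \<Sigma> x)"

definition hybrid_scan_kernel ::
  "real ^ 'm \<Rightarrow> real ^ 'p ^ 'm \<Rightarrow> (real \<Rightarrow> real) \<Rightarrow> real \<Rightarrow> real \<Rightarrow> real ^ 'p \<Rightarrow> real ^ 'p ^ 'p \<Rightarrow> real \<Rightarrow>
    (real ^ 'p) \<times> real \<Rightarrow> ((real ^ 'p) \<times> real) measure" where
  "hybrid_scan_kernel y X h \<alpha> \<gamma> \<mu> \<Sigma> r = (\<lambda>(\<beta>, s).
     (density pos_vectors (\<lambda>z. ennreal (z_density y X h \<beta> s z)) \<Otimes>\<^sub>M uniform_measure lborel {0<..<1})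
     \<bind> (\<lambda>(z, w).
       if w \<le> r
       then distr (density pos_reals (\<lambda>v. ennreal (sigma2_density y X \<alpha> \<gamma> \<beta> z v)))
              state_space (\<lambda>v. (\<beta>, v))
       else distr (density lborel (\<lambda>b. ennreal (beta_density y X \<mu> \<Sigma> s z b)))
              state_space (\<lambda>b. (b, s))))"

end

theory Submission
  imports Defs
begin

text \<open>
  Both chains are handled by Harris' theorem. If a function \<open>V \<ge> 0\<close> satisfies a drift condition
  \<open>K V \<le> g V + L\<close> with \<open>g < 1\<close>, and if on every sublevel set of \<open>V\<close> the two-step transition
  probabilities dominate one common nonzero measure, then the chain converges geometrically in total
  variation to its invariant distribution (\<open>harris_geometric_ergodicity\<close>). The proof is the
  contraction argument of Hairer and Mattingly.

  The drift function is \<open>V(\<beta>, s) = c E(\<beta>) + s + 1 / s\<close>, where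
  \<open>E(\<beta>) = \<Sum>\<^sub>i (y\<^sub>i - x\<^sub>i\<^sup>T \<beta>)\<^sup>2 + \<beta>\<^sup>T \<Sigma>\<^sup>-\<^sup>1 \<beta>\<close>. Two facts make it work. A \<open>\<beta>\<close> update forgets the past:
  the mean of \<open>E\<close> under the conditional of \<open>\<beta>\<close> is bounded by a constant that depends neither on the
  variance nor on the latent variables (\<open>beta_update_bound\<close>). The covariance of that normal law is
  dominated by \<open>\<Sigma>\<close>, and its mean is a weighted ridge estimator, which stays bounded uniformly in the
  weights (\<open>conditional_mean_bounded\<close>). In a \<open>\<sigma>\<^sup>2\<close> update, \<open>1 / \<sigma>\<^sup>2\<close> has bounded mean, while the
  mean of \<open>\<sigma>\<^sup>2\<close>, averaged over the latent variables, is up to a constant the left-hand side of the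
  hypothesis (\<open>sigma2_update_bound\<close>). For the systematic scan the hypothesis thus is, up to
  constants, the drift condition with \<open>c = 1\<close>. The hybrid scan performs each update with positive probability only,
  so \<open>E\<close> is not always refreshed. With probability \<open>1 - r\<close> it is, and this contracts \<open>c E\<close> enough
  to absorb the term \<open>\<psi>\<^sub>2 E\<close> produced by the \<open>\<sigma>\<^sup>2\<close> update, provided that \<open>c\<close> is large
  (\<open>hybrid_drift\<close>).

  On a sublevel set of \<open>V\<close> the residuals, \<open>s\<close> and \<open>1 / s\<close> are bounded. There the conditional
  densities of \<open>z\<close> and of \<open>\<sigma>\<^sup>2\<close> have positive lower bounds that do not depend on the state, and a
  \<open>\<sigma>\<^sup>2\<close> update followed by a \<open>\<beta>\<close> update yields the minorizing measure.

  Invariance of the marginal posterior holds because the joint posterior density is proportional to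
  each full conditional, separately in each block (\<open>joint_z\<close>, \<open>joint_s\<close>, \<open>joint_b\<close>). The
  normalizing constants of the normal and inverse gamma conditionals matter here, so that Gaussian
  integrals with a general covariance matrix are computed first, from a linear change of variables.
\<close>

section \<open>Kernels and Lyapunov functions\<close>

lemma prob_kernelD:
  assumes "K \<in> S \<rightarrow>\<^sub>M prob_algebra S" and "x \<in> space S"
  shows "prob_space (K x)" and "sets (K x) = sets S" and "space (K x) = space S"
  using measurable_space[OF assms] by (auto simp: space_prob_algebra dest: sets_eq_imp_space_eq)

lemma integrable_bounded_kernel:
  fixes \<phi> :: "'a \<Rightarrow> real"
  assumes "prob_space N" and "sets N = sets S" and "\<phi> \<in> borel_measurable S"
    and "\<And>x. x \<in> space S \<Longrightarrow> \<bar>\<phi> x\<bar> \<le> B"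
  shows "integrable N \<phi>"
proof -
  interpret prob_space N by fact
  have "\<phi> \<in> borel_measurable N"
    using assms(3) by (simp add: measurable_cong_sets[OF assms(2) refl])
  moreover have "space N = space S" using assms(2) by (rule sets_eq_imp_space_eq)
  ultimately show ?thesis
    using assms(4) by (intro integrable_const_bound[where B = B]) auto
qed

lemma lyapunov_integrable:
  fixes V :: "'a \<Rightarrow> real"
  assumes N: "prob_space N" "sets N = sets S" and V: "V \<in> borel_measurable S"
    and nonneg: "\<And>x. x \<in> space S \<Longrightarrow> 0 \<le> V x"
    and bound: "(\<integral>\<^sup>+z. ennreal (V z) \<partial>N) \<le> ennreal C" and C: "0 \<le> C"
  shows "integrable N V" and "(\<integral>z. V z \<partial>N) \<le> C"
proof -
  have VN: "V \<in> borel_measurable N"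
    using V by (simp add: measurable_cong_sets[OF N(2) refl])
  have sp: "space N = space S" using N(2) by (rule sets_eq_imp_space_eq)
  have ae: "AE x in N. 0 \<le> V x" using nonneg sp by auto
  have fin: "(\<integral>\<^sup>+z. ennreal (V z) \<partial>N) < \<infinity>"
    using bound ennreal_less_top[of C] by (simp add: le_less_trans)
  show int: "integrable N V"
    using VN ae fin by (rule integrableI_nonneg)
  show "(\<integral>z. V z \<partial>N) \<le> C"
    using nn_integral_eq_integral[OF int ae] bound C by (simp add: ennreal_le_iff)
qed

section \<open>Harris' theorem\<close>

text \<open>The constant is the infimum of \<open>\<phi> + u\<close>; the hypothesis says that no value of \<open>\<phi> - u\<close>
  exceeds it.\<close>

lemma centered_at_constant:
  fixes \<phi> u :: "'a \<Rightarrow> real"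
  assumes "A \<noteq> {}" and osc: "\<And>x y. x \<in> A \<Longrightarrow> y \<in> A \<Longrightarrow> \<phi> x - \<phi> y \<le> u x + u y"
  shows "\<exists>k. \<forall>x\<in>A. \<bar>\<phi> x - k\<bar> \<le> u x"
proof -
  define k where "k = (INF y\<in>A. \<phi> y + u y)"
  obtain a where a: "a \<in> A" using assms(1) by auto
  have low: "\<phi> x - u x \<le> \<phi> y + u y" if "x \<in> A" "y \<in> A" for x y
    using osc[OF that] by simp
  have bdd: "bdd_below ((\<lambda>y. \<phi> y + u y) ` A)"
    using low[OF a] by (intro bdd_belowI2[where m = "\<phi> a - u a"]) auto
  show ?thesis
  proof (intro exI ballI)
    fix x assume x: "x \<in> A"
    have "k \<le> \<phi> x + u x" unfolding k_def using bdd x by (rule cINF_lower)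
    moreover have "\<phi> x - u x \<le> k" unfolding k_def using assms(1) low[OF x] by (rule cINF_greatest)
    ultimately show "\<bar>\<phi> x - k\<bar> \<le> u x" by (simp add: abs_le_iff)
  qed
qed

text \<open>A function that is within \<open>c (1 + b V)\<close> of a constant is mapped by the kernel to one that is within
  \<open>\<rho> c (1 + b V)\<close> of some constant. One compares the images at two points \<open>x\<close> and \<open>y\<close>. If
  \<open>V x + V y \<ge> R\<close>, the drift alone shrinks the weight \<open>2 + b (V x + V y)\<close>. Otherwise both points lie
  in the small set, and the mass that both transition laws share with \<open>\<nu>\<close> contributes nothing to the
  difference; a small \<open>b\<close> makes this gain outweigh the additive constant of the drift condition.
  Working with functions that are only centred up to a constant avoids signed measures and weighted
  norms.\<close>

lemma harris_contraction:
  fixes S :: "'a measure" and M :: "'a \<Rightarrow> 'a measure" and V :: "'a \<Rightarrow> real"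
  assumes M: "M \<in> S \<rightarrow>\<^sub>M prob_algebra S" and ne: "space S \<noteq> {}"
    and V[measurable]: "V \<in> borel_measurable S"
    and nonneg: "\<And>x. x \<in> space S \<Longrightarrow> 0 \<le> V x"
    and g: "0 \<le> g" "g < 1" and L: "0 \<le> L"
    and drift: "\<And>x. x \<in> space S \<Longrightarrow> (\<integral>\<^sup>+z. ennreal (V z) \<partial>M x) \<le> ennreal (g * V x + L)"
    and R: "2 * L < (1 - g) * R"
    and \<nu>: "sets \<nu> = sets S" "emeasure \<nu> (space S) \<noteq> 0"
    and minor: "\<And>x f. x \<in> space S \<Longrightarrow> V x \<le> R \<Longrightarrow> f \<in> borel_measurable S \<Longrightarrow>
      (\<integral>\<^sup>+z. f z \<partial>\<nu>) \<le> (\<integral>\<^sup>+z. f z \<partial>M x)"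
  shows "\<exists>\<rho> b. 0 < \<rho> \<and> \<rho> < 1 \<and> 0 < b \<and>
    (\<forall>\<phi>\<in>borel_measurable S. \<forall>k c B. 0 \<le> c \<longrightarrow> (\<forall>x\<in>space S. \<bar>\<phi> x\<bar> \<le> B) \<longrightarrow>
      (\<forall>x\<in>space S. \<bar>\<phi> x - k\<bar> \<le> c * (1 + b * V x)) \<longrightarrow>
      (\<exists>k'. \<forall>x\<in>space S. \<bar>(\<integral>z. \<phi> z \<partial>M x) - k'\<bar> \<le> \<rho> * c * (1 + b * V x)))"
proof -
  obtain \<epsilon> :: real where \<epsilon>: "0 < \<epsilon>" "\<epsilon> \<le> 1" "ennreal \<epsilon> \<le> emeasure \<nu> (space S)"
  proof (cases "emeasure \<nu> (space S)")
    case (real r)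
    then show thesis using \<nu>(2) by (intro that[of "min r 1"]) auto
  next
    case top
    then show thesis by (intro that[of 1]) auto
  qed
  have R0: "0 < R" using R g L by (smt (verit, best) mult_nonneg_nonpos)
  (* small enough that the drift constant 2 L b costs at most half of the gain 2 \<epsilon> *)
  define b where "b = \<epsilon> / (2 * (L + 1))"
  have b: "0 < b" "2 * L * b \<le> \<epsilon>"
    using \<epsilon> L by (auto simp: b_def field_simps)
  (* absorbs the constant 2 L into the linear term as soon as V x + V y \<ge> R *)
  define g0 where "g0 = g + 2 * L / R"
  have g0: "0 \<le> g0" "g0 < 1" using g L R R0 by (auto simp: g0_def field_simps)
  (* (2 + b g0 w) / (2 + b w) decreases in w because g0 < 1, so its largest value on w \<ge> R is at w = R *)
  define \<rho>1 where "\<rho>1 = (2 + b * g0 * R) / (2 + b * R)"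
  have bR: "0 < b * R" using b R0 by simp
  have \<rho>1: "\<rho>1 < 1" "g0 \<le> \<rho>1"
  proof -
    have "b * R * g0 < b * R * 1" using g0 bR by (intro mult_strict_left_mono)
    then show "\<rho>1 < 1" using bR by (simp add: \<rho>1_def divide_less_eq algebra_simps)
    have "g0 * (2 + b * R) \<le> 2 + b * g0 * R" using g0 by (simp add: algebra_simps)
    then show "g0 \<le> \<rho>1" using bR by (simp add: \<rho>1_def le_divide_eq)
  qed
  define \<rho> where "\<rho> = Max {\<rho>1, 1 - \<epsilon> / 2, g}"
  have \<rho>: "0 < \<rho>" "\<rho> < 1" "\<rho>1 \<le> \<rho>" "1 - \<epsilon> / 2 \<le> \<rho>" "g \<le> \<rho>"
    using \<epsilon> \<rho>1 g by (auto simp: \<rho>_def less_max_iff_disj)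
  have far: "2 + b * (g * w + 2 * L) \<le> \<rho> * (2 + b * w)" if "R \<le> w" for w
  proof -
    have "2 * L \<le> 2 * L / R * w" using that R0 L by (simp add: field_simps mult_left_mono)
    then have "g * w + 2 * L \<le> g0 * w" by (simp add: g0_def algebra_simps)
    then have "2 + b * (g * w + 2 * L) \<le> 2 + b * (g0 * w)" using b by (simp add: mult_left_mono)
    also have "\<dots> \<le> \<rho>1 * (2 + b * w)"
    proof -
      have "\<rho>1 * (2 + b * R) = 2 + b * g0 * R" using bR by (simp add: \<rho>1_def)
      moreover have "b * (\<rho>1 - g0) * R \<le> b * (\<rho>1 - g0) * w"
        using that b \<rho>1 by (intro mult_left_mono) auto
      ultimately show ?thesis by (simp add: algebra_simps)
    qed
    also have "\<dots> \<le> \<rho> * (2 + b * w)" using \<rho> b that R0 by (intro mult_right_mono) auto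
    finally show ?thesis .
  qed
  have near: "2 + b * (g * w + 2 * L) - 2 * \<epsilon> \<le> \<rho> * (2 + b * w)" if "0 \<le> w" for w
  proof -
    have "2 + b * (g * w + 2 * L) - 2 * \<epsilon> \<le> (1 - \<epsilon> / 2) * 2 + g * (b * w)"
      using b \<epsilon> by (simp add: algebra_simps)
    also have "\<dots> \<le> \<rho> * 2 + \<rho> * (b * w)"
      using \<rho> b that by (intro add_mono mult_right_mono) auto
    finally show ?thesis by (simp add: algebra_simps)
  qed
  show ?thesis
  proof (rule exI[of _ \<rho>], rule exI[of _ b], intro conjI ballI allI impI \<rho>(1,2) b(1))
    fix \<phi> :: "'a \<Rightarrow> real" and k c B
    assume \<phi>[measurable]: "\<phi> \<in> borel_measurable S" and c: "0 \<le> c"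
      and B': "\<forall>x\<in>space S. \<bar>\<phi> x\<bar> \<le> B"
      and close': "\<forall>x\<in>space S. \<bar>\<phi> x - k\<bar> \<le> c * (1 + b * V x)"
    note B = bspec[OF B'] and close = bspec[OF close']
    let ?up = "\<lambda>z. c * (1 + b * V z) + (\<phi> z - k)" and ?lo = "\<lambda>z. c * (1 + b * V z) - (\<phi> z - k)"
    have pos: "0 \<le> ?up z" "0 \<le> ?lo z" if "z \<in> space S" for z using close[OF that] by auto
    have Dx: "integrable (M x) V" "(\<integral>z. V z \<partial>M x) \<le> g * V x + L" "integrable (M x) \<phi>"
      "(\<integral>z. ?up z \<partial>M x) = c * (1 + b * (\<integral>z. V z \<partial>M x)) + ((\<integral>z. \<phi> z \<partial>M x) - k)"
      "(\<integral>z. ?lo z \<partial>M x) = c * (1 + b * (\<integral>z. V z \<partial>M x)) - ((\<integral>z. \<phi> z \<partial>M x) - k)"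
      "integrable (M x) ?up" "integrable (M x) ?lo" "0 \<le> (\<integral>z. ?up z \<partial>M x)" "0 \<le> (\<integral>z. ?lo z \<partial>M x)"
      if x: "x \<in> space S" for x
    proof -
      note K = prob_kernelD[OF M x]
      interpret prob_space "M x" by (rule K)
      show 1: "integrable (M x) V" "(\<integral>z. V z \<partial>M x) \<le> g * V x + L"
        using lyapunov_integrable[OF K(1,2) V nonneg drift[OF x]] g L nonneg[OF x] by auto
      show 2: "integrable (M x) \<phi>" using K \<phi> B by (intro integrable_bounded_kernel)
      show "(\<integral>z. ?up z \<partial>M x) = c * (1 + b * (\<integral>z. V z \<partial>M x)) + ((\<integral>z. \<phi> z \<partial>M x) - k)"
        "(\<integral>z. ?lo z \<partial>M x) = c * (1 + b * (\<integral>z. V z \<partial>M x)) - ((\<integral>z. \<phi> z \<partial>M x) - k)"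
        using 1 2 by (simp_all add: prob_space)
      show "integrable (M x) ?up" "integrable (M x) ?lo" using 1 2 by auto
      show "0 \<le> (\<integral>z. ?up z \<partial>M x)" "0 \<le> (\<integral>z. ?lo z \<partial>M x)"
        using pos K(3) by (auto intro!: integral_nonneg_AE)
    qed
    have osc: "(\<integral>z. \<phi> z \<partial>M x) - (\<integral>z. \<phi> z \<partial>M y) \<le> \<rho> * c * (1 + b * V x) + \<rho> * c * (1 + b * V y)"
      if x: "x \<in> space S" and y: "y \<in> space S" for x y
    proof -
      let ?w = "V x + V y"
      note Dx = Dx[OF x] and Dy = Dx[OF y]
      have w: "0 \<le> ?w" using nonneg[OF x] nonneg[OF y] by simp
      have "(\<integral>z. V z \<partial>M x) + (\<integral>z. V z \<partial>M y) \<le> g * ?w + 2 * L"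
        using Dx(2) Dy(2) by (simp add: algebra_simps)
      then have "c * (b * ((\<integral>z. V z \<partial>M x) + (\<integral>z. V z \<partial>M y))) \<le> c * (b * (g * ?w + 2 * L))"
        using b c by (intro mult_left_mono) auto
      (* up and lo measure the slack in the two-sided bound on \<phi>; their integrals are the gain *)
      then have tot: "(\<integral>z. \<phi> z \<partial>M x) - (\<integral>z. \<phi> z \<partial>M y)
          \<le> c * (2 + b * (g * ?w + 2 * L)) - ((\<integral>z. ?lo z \<partial>M x) + (\<integral>z. ?up z \<partial>M y))"
        unfolding Dx(5) Dy(4) by (simp add: algebra_simps)
      have "c * (2 + b * (g * ?w + 2 * L)) - ((\<integral>z. ?lo z \<partial>M x) + (\<integral>z. ?up z \<partial>M y))
          \<le> c * (\<rho> * (2 + b * ?w))"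
      proof (cases "R \<le> ?w")
        case True
        then have "c * (2 + b * (g * ?w + 2 * L)) \<le> c * (\<rho> * (2 + b * ?w))"
          using far c by (intro mult_left_mono) auto
        then show ?thesis using Dx(9) Dy(8) by linarith
      next
        case False
        then have VR: "V x \<le> R" "V y \<le> R" using nonneg[OF x] nonneg[OF y] by auto
        have \<nu>sp: "space \<nu> = space S" using \<nu>(1) by (rule sets_eq_imp_space_eq)
        note measurable_cong_sets[OF \<nu>(1) refl, simp]
        (* lo + up \<ge> 2 c pointwise, hence the \<nu>-parts of the two slacks add up to at least 2 c \<epsilon> *)
        have "ennreal (2 * c * \<epsilon>) \<le> ennreal (2 * c) * emeasure \<nu> (space \<nu>)"
          using \<epsilon> c by (simp add: ennreal_mult \<nu>sp mult_left_mono)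
        also have "\<dots> = (\<integral>\<^sup>+z. ennreal (2 * c) \<partial>\<nu>)" by simp
        also have "\<dots> \<le> (\<integral>\<^sup>+z. ennreal (?lo z) + ennreal (?up z) \<partial>\<nu>)"
        proof (rule nn_integral_mono)
          fix z assume "z \<in> space \<nu>"
          then have z: "z \<in> space S" by (simp add: \<nu>sp)
          have "2 * c \<le> ?lo z + ?up z" using c b nonneg[OF z] by (simp add: algebra_simps)
          then show "ennreal (2 * c) \<le> ennreal (?lo z) + ennreal (?up z)"
            using pos[OF z] by (simp flip: ennreal_plus add: ennreal_leI)
        qed
        also have "\<dots> = (\<integral>\<^sup>+z. ennreal (?lo z) \<partial>\<nu>) + (\<integral>\<^sup>+z. ennreal (?up z) \<partial>\<nu>)"
          by (intro nn_integral_add) auto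
        also have "\<dots> \<le> (\<integral>\<^sup>+z. ennreal (?lo z) \<partial>M x) + (\<integral>\<^sup>+z. ennreal (?up z) \<partial>M y)"
          by (intro add_mono minor x y VR) auto
        also have "\<dots> = ennreal (\<integral>z. ?lo z \<partial>M x) + ennreal (\<integral>z. ?up z \<partial>M y)"
          using Dx Dy pos prob_kernelD(3)[OF M x] prob_kernelD(3)[OF M y]
          by (intro arg_cong2[where f = "(+)"] nn_integral_eq_integral AE_I2) auto
        finally have "2 * c * \<epsilon> \<le> (\<integral>z. ?lo z \<partial>M x) + (\<integral>z. ?up z \<partial>M y)"
          using Dx(9) Dy(8) by (simp flip: ennreal_plus add: ennreal_le_iff)
        moreover have "c * (2 + b * (g * ?w + 2 * L) - 2 * \<epsilon>) \<le> c * (\<rho> * (2 + b * ?w))"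
          using near[OF w] c by (intro mult_left_mono)
        ultimately show ?thesis by (simp add: algebra_simps)
      qed
      with tot show ?thesis by (simp add: algebra_simps)
    qed
    show "\<exists>k'. \<forall>x\<in>space S. \<bar>(\<integral>z. \<phi> z \<partial>M x) - k'\<bar> \<le> \<rho> * c * (1 + b * V x)"
      using ne osc by (rule centered_at_constant)
  qed
qed

lemma kernel_integral_bounded:
  fixes \<phi> :: "'a \<Rightarrow> real"
  assumes K: "K \<in> S \<rightarrow>\<^sub>M prob_algebra S" and \<phi>: "\<phi> \<in> borel_measurable S"
    and B: "\<And>x. x \<in> space S \<Longrightarrow> \<bar>\<phi> x\<bar> \<le> B"
  shows "(\<lambda>x. \<integral>z. \<phi> z \<partial>K x) \<in> borel_measurable S"
    and "x \<in> space S \<Longrightarrow> \<bar>\<integral>z. \<phi> z \<partial>K x\<bar> \<le> B"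
    and "prob_space N \<Longrightarrow> sets N = sets S \<Longrightarrow> (\<integral>z. \<phi> z \<partial>(N \<bind> K)) = (\<integral>x. \<integral>z. \<phi> z \<partial>K x \<partial>N)"
proof -
  show "(\<lambda>x. \<integral>z. \<phi> z \<partial>K x) \<in> borel_measurable S"
    using measurable_compose[OF measurable_prob_algebraD[OF K] integral_measurable_subprob_algebra[OF \<phi>]] .
  show "\<bar>\<integral>z. \<phi> z \<partial>K x\<bar> \<le> B" if x: "x \<in> space S"
  proof -
    note Kx = prob_kernelD[OF K x]
    interpret Kx: prob_space "K x" by (rule Kx)
    have "\<bar>\<integral>z. \<phi> z \<partial>K x\<bar> \<le> (\<integral>z. \<bar>\<phi> z\<bar> \<partial>K x)" by (rule integral_abs_bound)
    also have "\<dots> \<le> (\<integral>z. B \<partial>K x)"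
      using B Kx \<phi>
      by (intro integral_mono integrable_abs integrable_bounded_kernel[OF Kx(1,2), of \<phi> B]) auto
    finally show ?thesis by (simp add: Kx.prob_space)
  qed
  show "(\<integral>z. \<phi> z \<partial>(N \<bind> K)) = (\<integral>x. \<integral>z. \<phi> z \<partial>K x \<partial>N)" if N: "prob_space N" "sets N = sets S"
  proof (rule integral_bind[OF \<phi> B, where B' = 1])
    interpret N: prob_space N by fact
    show "finite_measure N" by (rule N.finite_measure_axioms)
    show "K \<in> N \<rightarrow>\<^sub>M subprob_algebra S"
      using measurable_prob_algebraD[OF K] by (simp add: measurable_cong_sets[OF N(2) refl])
    show "AE x in N. emeasure (K x) (space (K x)) \<le> ennreal 1"
      using prob_space.emeasure_space_1[OF prob_kernelD(1)[OF K]] sets_eq_imp_space_eq[OF N(2)] by auto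
  qed
qed

text \<open>Integrating the drift condition would give the bound at once if \<open>V\<close> were known to be integrable.
  Therefore \<open>V\<close> is first truncated at a level \<open>N\<close>: iterating the drift condition \<open>n\<close> times under
  the truncation and letting \<open>n\<close> tend to infinity shows that \<open>min N V\<close> integrates to at most
  \<open>L / (1 - g)\<close>, and then \<open>N\<close> tends to infinity.\<close>

lemma invariant_lyapunov_bound:
  fixes V :: "'a \<Rightarrow> real"
  assumes K: "K \<in> S \<rightarrow>\<^sub>M prob_algebra S"
    and P: "prob_space P" "sets P = sets S" "P \<bind> K = P"
    and V[measurable]: "V \<in> borel_measurable S"
    and nonneg: "\<And>x. x \<in> space S \<Longrightarrow> 0 \<le> V x"
    and g: "0 \<le> g" "g < 1" and L: "0 \<le> L"
    and drift: "\<And>x. x \<in> space S \<Longrightarrow> (\<integral>\<^sup>+z. ennreal (V z) \<partial>K x) \<le> ennreal (g * V x + L)"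
  shows "(\<integral>\<^sup>+x. ennreal (V x) \<partial>P) \<le> ennreal (L / (1 - g))"
proof -
  interpret P: prob_space P by fact
  have sp: "space P = space S" using P(2) by (rule sets_eq_imp_space_eq)
  note [simp] = measurable_cong_sets[OF P(2) refl]
  define b where "b = L / (1 - g)"
  have b: "0 \<le> b" "L = (1 - g) * b" using g L by (auto simp: b_def)
  have bound: "(\<integral>\<^sup>+x. ennreal (min N (V x)) \<partial>P) \<le> ennreal b" if N: "0 \<le> N" for N
  proof -
    (* the n-th iterate of v \<mapsto> g v + L started at V x, written around its fixed point b *)
    define F where "F n x = min N (g ^ n * V x + (1 - g ^ n) * b)" for n x
    have gn: "0 \<le> g ^ n" "g ^ n \<le> 1" for n using g by (auto intro: power_le_one)
    have F0: "0 \<le> g ^ n * V x + (1 - g ^ n) * b" if "x \<in> space S" for n x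
      using nonneg[OF that] gn b by simp
    have Fb: "\<bar>F n x\<bar> \<le> N" if "x \<in> space S" for n x
      using F0[OF that] N by (auto simp: F_def)
    have [measurable]: "F n \<in> borel_measurable S" for n unfolding F_def by measurable
    have step: "(\<integral>z. F n z \<partial>K x) \<le> F (Suc n) x" if x: "x \<in> space S" for n x
    proof -
      note Kx = prob_kernelD[OF K x]
      interpret Kx: prob_space "K x" by (rule Kx)
      have Vx: "integrable (K x) V" "(\<integral>z. V z \<partial>K x) \<le> g * V x + L"
        using lyapunov_integrable[OF Kx(1,2) V nonneg drift[OF x]] g L nonneg[OF x] by auto
      have int: "integrable (K x) (F n)" using Kx Fb by (intro integrable_bounded_kernel) auto
      have "(\<integral>z. F n z \<partial>K x) \<le> (\<integral>z. N \<partial>K x)"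
        using int by (intro integral_mono) (auto simp: F_def[abs_def])
      moreover have "(\<integral>z. F n z \<partial>K x) \<le> (\<integral>z. g ^ n * V z + (1 - g ^ n) * b \<partial>K x)"
        using int Vx by (intro integral_mono) (auto simp: F_def[abs_def])
      moreover have "(\<integral>z. g ^ n * V z + (1 - g ^ n) * b \<partial>K x) = g ^ n * (\<integral>z. V z \<partial>K x) + (1 - g ^ n) * b"
        using Vx by (simp add: Kx.prob_space)
      moreover have "g ^ n * (\<integral>z. V z \<partial>K x) \<le> g ^ n * (g * V x + L)"
        using Vx gn by (intro mult_left_mono)
      ultimately show ?thesis
        by (simp add: F_def Kx.prob_space b(2) algebra_simps)
    qed
    have mono: "(\<integral>x. F 0 x \<partial>P) \<le> (\<integral>x. F n x \<partial>P)" for n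
    proof (induction n)
      case (Suc n)
      note Suc
      also have "(\<integral>x. F n x \<partial>P) = (\<integral>x. F n x \<partial>(P \<bind> K))" by (simp add: P(3))
      also have "\<dots> = (\<integral>x. \<integral>z. F n z \<partial>K x \<partial>P)"
        using K P Fb by (intro kernel_integral_bounded(3)) auto
      also have "\<dots> \<le> (\<integral>x. F (Suc n) x \<partial>P)"
      proof (rule integral_mono)
        show "integrable P (\<lambda>x. \<integral>z. F n z \<partial>K x)"
          using P kernel_integral_bounded(1,2)[OF K _ Fb]
          by (intro integrable_bounded_kernel[where S = S and B = N]) auto
        show "integrable P (F (Suc n))" using P Fb by (intro integrable_bounded_kernel) auto
      qed (simp add: sp step)
      finally show ?case .
    qed simp
    have "(\<lambda>n. \<integral>x. F n x \<partial>P) \<longlonglongrightarrow> (\<integral>x. min N b \<partial>P)"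
    proof (rule integral_dominated_convergence[where w = "\<lambda>x. N"])
      have "(\<lambda>n. F n x) \<longlonglongrightarrow> min N (0 * V x + (1 - 0) * b)" for x
        unfolding F_def using g by (intro tendsto_intros LIMSEQ_power_zero) auto
      then show "AE x in P. (\<lambda>n. F n x) \<longlonglongrightarrow> min N b" by simp
    qed (use Fb sp in auto)
    then have "(\<integral>x. F 0 x \<partial>P) \<le> (\<integral>x. min N b \<partial>P)"
      using mono by (intro LIMSEQ_le_const) auto
    then have "(\<integral>x. F 0 x \<partial>P) \<le> b" by (simp add: P.prob_space)
    moreover have "(\<integral>\<^sup>+x. ennreal (F 0 x) \<partial>P) = ennreal (\<integral>x. F 0 x \<partial>P)"
    proof (rule nn_integral_eq_integral)
      show "integrable P (F 0)" using P Fb by (intro integrable_bounded_kernel) auto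
      show "AE x in P. 0 \<le> F 0 x" using nonneg N by (auto simp: F_def sp)
    qed
    ultimately have "(\<integral>\<^sup>+x. ennreal (F 0 x) \<partial>P) \<le> ennreal b" using b by (simp add: ennreal_leI)
    then show ?thesis by (simp add: F_def)
  qed
  have "(\<integral>\<^sup>+x. ennreal (V x) \<partial>P) = (\<integral>\<^sup>+x. (SUP n. ennreal (min (real n) (V x))) \<partial>P)"
  proof (rule nn_integral_cong)
    fix x
    obtain n where n: "V x \<le> real n" using real_arch_simple by blast
    have "ennreal (V x) = ennreal (min (real n) (V x))" using n by simp
    then show "ennreal (V x) = (SUP n. ennreal (min (real n) (V x)))"
      by (intro antisym SUP_least ennreal_leI) (auto intro: SUP_upper2)
  qed
  also have "\<dots> = (SUP n. \<integral>\<^sup>+x. ennreal (min (real n) (V x)) \<partial>P)"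
    by (intro nn_integral_monotone_convergence_SUP)
       (auto simp: incseq_def le_fun_def intro!: ennreal_leI)
  also have "\<dots> \<le> ennreal b" by (intro SUP_least bound) simp
  finally show ?thesis by (simp add: b_def)
qed

text \<open>Indicators of events are bounded functions, so the contraction applies to them. The minorization is
  asked of two steps, since a scan that updates one block at a time has no minorant in a single step;
  accordingly the contraction is used for the two-step kernel, and a possible odd last step is
  absorbed into the test function. Integrating against the invariant distribution identifies the
  limiting constant.\<close>

theorem harris_geometric_ergodicity:
  fixes V :: "'a \<Rightarrow> real"
  assumes K: "K \<in> S \<rightarrow>\<^sub>M prob_algebra S"
    and P: "prob_space P" "sets P = sets S" "P \<bind> K = P"
    and V[measurable]: "V \<in> borel_measurable S"
    and nonneg: "\<And>x. x \<in> space S \<Longrightarrow> 0 \<le> V x"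
    and g: "0 \<le> g" "g < 1" and L: "0 \<le> L"
    and drift: "\<And>x. x \<in> space S \<Longrightarrow> (\<integral>\<^sup>+z. ennreal (V z) \<partial>K x) \<le> ennreal (g * V x + L)"
    and minor: "\<And>R. \<exists>\<nu>. sets \<nu> = sets S \<and> emeasure \<nu> (space S) \<noteq> 0 \<and>
      (\<forall>x\<in>space S. V x \<le> R \<longrightarrow> (\<forall>f\<in>borel_measurable S.
         (\<integral>\<^sup>+z. f z \<partial>\<nu>) \<le> (\<integral>\<^sup>+w. \<integral>\<^sup>+z. f z \<partial>K w \<partial>K x)))"
  shows "geometrically_ergodic S K P"
proof -
  interpret P: prob_space P by fact
  have sp: "space P = space S" using P(2) by (rule sets_eq_imp_space_eq)
  have ne: "space S \<noteq> {}" using P.not_empty sp by simp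
  define M where "M x = K x \<bind> K" for x
  have M: "M \<in> S \<rightarrow>\<^sub>M prob_algebra S"
    unfolding M_def using K K by (rule measurable_bind_prob_space)
  note Ks = prob_kernelD[OF K]
  have nnM: "(\<integral>\<^sup>+z. f z \<partial>M x) = (\<integral>\<^sup>+w. \<integral>\<^sup>+z. f z \<partial>K w \<partial>K x)"
    if "x \<in> space S" "f \<in> borel_measurable S" for x and f :: "'a \<Rightarrow> ennreal"
    unfolding M_def using measurable_prob_algebraD[OF K]
    by (intro nn_integral_bind[OF that(2)]) (simp add: measurable_cong_sets[OF Ks(2)[OF that(1)] refl])
  have driftM: "(\<integral>\<^sup>+z. ennreal (V z) \<partial>M x) \<le> ennreal (g\<^sup>2 * V x + (g * L + L))" if x: "x \<in> space S" for x
  proof -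
    interpret Kx: prob_space "K x" by (rule Ks[OF x])
    have "(\<integral>\<^sup>+z. ennreal (V z) \<partial>M x) \<le> (\<integral>\<^sup>+w. ennreal (g * V w + L) \<partial>K x)"
      using drift Ks(3)[OF x] by (subst nnM[OF x]) (auto intro!: nn_integral_mono)
    also have "\<dots> = (\<integral>\<^sup>+w. ennreal g * ennreal (V w) + ennreal L \<partial>K x)"
      using nonneg g L Ks(3)[OF x] by (intro nn_integral_cong) (simp add: ennreal_mult)
    also have "\<dots> = ennreal g * (\<integral>\<^sup>+w. ennreal (V w) \<partial>K x) + ennreal L"
      using V by (simp add: nn_integral_add nn_integral_cmult Kx.emeasure_space_1
          measurable_cong_sets[OF Ks(2)[OF x] refl])
    also have "\<dots> \<le> ennreal g * ennreal (g * V x + L) + ennreal L"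
      using drift[OF x] by (intro add_mono mult_left_mono) auto
    also have "\<dots> = ennreal (g\<^sup>2 * V x + (g * L + L))"
      using nonneg[OF x] g L
      by (simp flip: ennreal_mult ennreal_plus add: power2_eq_square algebra_simps)
    finally show ?thesis .
  qed
  have g2: "0 \<le> g\<^sup>2" "g\<^sup>2 < 1" using g by (auto simp: power_less_one_iff abs_square_less_1)
  (* two steps have drift factor g\<^sup>2 and constant g L + L; R is the level that they require *)
  define R where "R = (2 * (g * L + L) + 1) / (1 - g\<^sup>2)"
  have R: "2 * (g * L + L) < (1 - g\<^sup>2) * R" using g2 by (simp add: R_def)
  have L2: "0 \<le> g * L + L" using g L by simp
  obtain \<nu> where \<nu>: "sets \<nu> = sets S" "emeasure \<nu> (space S) \<noteq> 0"
    "\<And>x f. x \<in> space S \<Longrightarrow> V x \<le> R \<Longrightarrow> f \<in> borel_measurable S \<Longrightarrow>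
       (\<integral>\<^sup>+z. f z \<partial>\<nu>) \<le> (\<integral>\<^sup>+w. \<integral>\<^sup>+z. f z \<partial>K w \<partial>K x)"
    using minor[of R] by blast
  have minorM: "(\<integral>\<^sup>+z. f z \<partial>\<nu>) \<le> (\<integral>\<^sup>+z. f z \<partial>M x)"
    if "x \<in> space S" "V x \<le> R" "f \<in> borel_measurable S" for x f
    using \<nu>(3)[OF that] nnM[OF that(1,3)] by simp
  have "\<exists>\<rho> b. 0 < \<rho> \<and> \<rho> < 1 \<and> 0 < b \<and>
    (\<forall>\<phi>\<in>borel_measurable S. \<forall>k c B. 0 \<le> c \<longrightarrow> (\<forall>x\<in>space S. \<bar>\<phi> x\<bar> \<le> B) \<longrightarrow>
      (\<forall>x\<in>space S. \<bar>\<phi> x - k\<bar> \<le> c * (1 + b * V x)) \<longrightarrow>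
      (\<exists>k'. \<forall>x\<in>space S. \<bar>(\<integral>z. \<phi> z \<partial>M x) - k'\<bar> \<le> \<rho> * c * (1 + b * V x)))"
    by (rule harris_contraction[OF M ne V nonneg g2 L2 driftM R \<nu>(1,2) minorM])
  then obtain \<rho> b where \<rho>: "0 < \<rho>" "\<rho> < 1" and b: "0 < b"
    and contr: "\<forall>\<phi>\<in>borel_measurable S. \<forall>k c B. 0 \<le> c \<longrightarrow> (\<forall>x\<in>space S. \<bar>\<phi> x\<bar> \<le> B) \<longrightarrow>
      (\<forall>x\<in>space S. \<bar>\<phi> x - k\<bar> \<le> c * (1 + b * V x)) \<longrightarrow>
      (\<exists>k'. \<forall>x\<in>space S. \<bar>(\<integral>z. \<phi> z \<partial>M x) - k'\<bar> \<le> \<rho> * c * (1 + b * V x))"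
    by blast
  define U where "U \<phi> x = (\<integral>z. \<phi> z \<partial>K x)" for \<phi> :: "'a \<Rightarrow> real" and x
  have U: "U \<phi> \<in> borel_measurable S" "x \<in> space S \<Longrightarrow> \<bar>U \<phi> x\<bar> \<le> 1"
    if "\<phi> \<in> borel_measurable S" "\<And>x. x \<in> space S \<Longrightarrow> \<bar>\<phi> x\<bar> \<le> 1" for \<phi> x
    using kernel_integral_bounded(1,2)[OF K that] by (auto simp: U_def[abs_def])
  have Un: "(U ^^ n) \<phi> \<in> borel_measurable S \<and> (\<forall>x\<in>space S. \<bar>(U ^^ n) \<phi> x\<bar> \<le> 1)"
    if "\<phi> \<in> borel_measurable S" "\<And>x. x \<in> space S \<Longrightarrow> \<bar>\<phi> x\<bar> \<le> 1" for \<phi> n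
    using that by (induction n) (auto simp: U)
  have UU: "U (U \<phi>) x = (\<integral>z. \<phi> z \<partial>M x)"
    if "\<phi> \<in> borel_measurable S" "\<And>x. x \<in> space S \<Longrightarrow> \<bar>\<phi> x\<bar> \<le> 1" "x \<in> space S" for \<phi> x
    unfolding M_def U_def using kernel_integral_bounded(3)[OF K that(1,2)] Ks[OF that(3)] by simp
  have conv: "\<exists>k. \<forall>x\<in>space S. \<bar>((U ^^ 2) ^^ j) \<phi> x - k\<bar> \<le> \<rho> ^ j * (1 + b * V x)"
    if \<phi>: "\<phi> \<in> borel_measurable S" "\<And>x. x \<in> space S \<Longrightarrow> \<bar>\<phi> x\<bar> \<le> 1" for \<phi> j
  proof (induction j)
    case 0
    have "\<bar>\<phi> x - 0\<bar> \<le> 1 + b * V x" if "x \<in> space S" for x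
      using \<phi>(2)[OF that] mult_nonneg_nonneg[OF less_imp_le[OF b] nonneg[OF that]] by simp
    then show ?case by (intro exI[of _ 0]) simp
  next
    case (Suc j)
    let ?\<psi> = "((U ^^ 2) ^^ j) \<phi>"
    have \<psi>: "?\<psi> \<in> borel_measurable S" "\<And>x. x \<in> space S \<Longrightarrow> \<bar>?\<psi> x\<bar> \<le> 1"
      using Un[OF \<phi>] by (auto simp: funpow_mult)
    obtain k where "\<And>x. x \<in> space S \<Longrightarrow> \<bar>?\<psi> x - k\<bar> \<le> \<rho> ^ j * (1 + b * V x)" using Suc by blast
    then have "\<exists>k'. \<forall>x\<in>space S. \<bar>(\<integral>z. ?\<psi> z \<partial>M x) - k'\<bar> \<le> \<rho> * \<rho> ^ j * (1 + b * V x)"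
      using \<rho> \<psi> by (intro contr[rule_format, where B = 1]) auto
    then obtain k' where
      "\<forall>x\<in>space S. \<bar>(\<integral>z. ?\<psi> z \<partial>M x) - k'\<bar> \<le> \<rho> * \<rho> ^ j * (1 + b * V x)" by blast
    moreover have "((U ^^ 2) ^^ Suc j) \<phi> x = (\<integral>z. ?\<psi> z \<partial>M x)" if "x \<in> space S" for x
      using UU[OF \<psi> that] by (simp add: numeral_2_eq_2)
    ultimately show ?case by auto
  qed
  have kp: "kernel_power S K n x \<in> space (prob_algebra S)" if "x \<in> space S" for n x
  proof (induction n)
    case 0
    then show ?case using that by (simp add: space_prob_algebra prob_space_return)
  next
    case (Suc n)
    then show ?case using prob_space_bind'[OF Suc K] sets_bind'[OF Suc K] by (simp add: space_prob_algebra)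
  qed
  have kpU: "(\<integral>z. \<phi> z \<partial>kernel_power S K n x) = (U ^^ n) \<phi> x"
    if "x \<in> space S" "\<phi> \<in> borel_measurable S" "\<And>x. x \<in> space S \<Longrightarrow> \<bar>\<phi> x\<bar> \<le> 1" for n x \<phi>
    using that(2,3)
  proof (induction n arbitrary: \<phi>)
    case 0
    then show ?case using that(1) by (simp add: integral_return)
  next
    case (Suc n)
    have "(\<integral>z. \<phi> z \<partial>kernel_power S K (Suc n) x) = (\<integral>z. U \<phi> z \<partial>kernel_power S K n x)"
      using kernel_integral_bounded(3)[OF K Suc.prems] kp[OF that(1), of n] by (simp add: U_def space_prob_algebra)
    also have "\<dots> = (U ^^ n) (U \<phi>) x" using Suc.prems by (intro Suc.IH U) auto
    finally show ?case by (simp add: funpow_swap1)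
  qed
  have PU: "(\<integral>z. (U ^^ n) \<phi> z \<partial>P) = (\<integral>z. \<phi> z \<partial>P)"
    if "\<phi> \<in> borel_measurable S" "\<And>x. x \<in> space S \<Longrightarrow> \<bar>\<phi> x\<bar> \<le> 1" for n \<phi>
  proof (induction n)
    case (Suc n)
    have "(\<integral>z. (U ^^ n) \<phi> z \<partial>(P \<bind> K)) = (\<integral>x. U ((U ^^ n) \<phi>) x \<partial>P)"
      unfolding U_def[of "(U ^^ n) \<phi>"] using Un[OF that] P by (intro kernel_integral_bounded(3)[OF K]) auto
    then show ?case using Suc by (simp add: P(3))
  qed simp
  have Vint: "(\<integral>\<^sup>+x. ennreal (V x) \<partial>P) \<le> ennreal (L / (1 - g))"
    using K P V nonneg g L drift by (rule invariant_lyapunov_bound)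
  define v where "v = (\<integral>x. V x \<partial>P)"
  have v: "integrable P V" "0 \<le> v"
    using lyapunov_integrable(1)[OF P(1,2) V nonneg Vint] g L nonneg sp
    by (auto simp: v_def intro!: integral_nonneg_AE)
  have tv: "\<bar>measure (kernel_power S K n x) A - measure P A\<bar> \<le> \<rho> ^ (n div 2) * (2 + b * V x + b * v)"
    if x: "x \<in> space S" and A: "A \<in> sets S" for x A n
  proof -
    let ?\<phi> = "indicator A :: 'a \<Rightarrow> real"
    have \<phi>: "?\<phi> \<in> borel_measurable S" "\<And>x. x \<in> space S \<Longrightarrow> \<bar>?\<phi> x\<bar> \<le> 1"
      using A by (auto simp: indicator_def)
    (* the odd step, if any, is applied to the test function first *)
    define \<psi> where "\<psi> = (U ^^ (n mod 2)) ?\<phi>"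
    have \<psi>: "\<psi> \<in> borel_measurable S" "\<And>x. x \<in> space S \<Longrightarrow> \<bar>\<psi> x\<bar> \<le> 1"
      using Un[OF \<phi>] by (auto simp: \<psi>_def)
    have split: "(U ^^ n) ?\<phi> = ((U ^^ 2) ^^ (n div 2)) \<psi>"
    proof -
      have "(U ^^ n) = (U ^^ (2 * (n div 2) + n mod 2))" by simp
      then show ?thesis unfolding \<psi>_def funpow_mult funpow_add by (simp add: mult.commute)
    qed
    obtain k where k: "\<And>x. x \<in> space S \<Longrightarrow> \<bar>(U ^^ n) ?\<phi> x - k\<bar> \<le> \<rho> ^ (n div 2) * (1 + b * V x)"
      using conv[OF \<psi>, of "n div 2"] split by auto
    have intU: "integrable P ((U ^^ n) ?\<phi>)" using Un[OF \<phi>] P by (intro integrable_bounded_kernel) auto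
    have "measure P A - k = (\<integral>z. (U ^^ n) ?\<phi> z - k \<partial>P)"
      using PU[OF \<phi>, of n] intU A P(2) by (simp add: P.prob_space Int_absorb2 sets.sets_into_space)
    also have "\<bar>\<dots>\<bar> \<le> (\<integral>z. \<bar>(U ^^ n) ?\<phi> z - k\<bar> \<partial>P)" by (rule integral_abs_bound)
    also have "\<dots> \<le> (\<integral>z. \<rho> ^ (n div 2) * (1 + b * V z) \<partial>P)"
      using intU v k sp by (intro integral_mono) auto
    also have "\<dots> = \<rho> ^ (n div 2) * (1 + b * v)"
      using v by (simp add: P.prob_space v_def)
    finally have 1: "\<bar>measure P A - k\<bar> \<le> \<rho> ^ (n div 2) * (1 + b * v)" .
    have "measure (kernel_power S K n x) A = (\<integral>z. ?\<phi> z \<partial>kernel_power S K n x)"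
      using kp[OF x, of n] A by (simp add: space_prob_algebra Int_absorb2 sets.sets_into_space)
    also have "\<dots> = (U ^^ n) ?\<phi> x" using x \<phi> by (rule kpU)
    finally have "\<bar>measure (kernel_power S K n x) A - k\<bar> \<le> \<rho> ^ (n div 2) * (1 + b * V x)" using k[OF x] by simp
    moreover have "\<rho> ^ (n div 2) * (2 + b * V x + b * v)
        = \<rho> ^ (n div 2) * (1 + b * V x) + \<rho> ^ (n div 2) * (1 + b * v)"
      by (simp add: algebra_simps)
    ultimately show ?thesis using 1 by linarith
  qed
  define C where "C x = (2 + b * V x + b * v) / sqrt \<rho>" for x
  have C: "0 \<le> C x" if "x \<in> space S" for x
    using nonneg[OF that] b v \<rho> by (simp add: C_def)
  have rate: "\<rho> ^ (n div 2) \<le> sqrt \<rho> ^ n / sqrt \<rho>" for n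
  proof -
    (* n \<le> 2 (n div 2) + 1, so a contraction \<rho> per two steps is a rate sqrt \<rho> per step *)
    have "sqrt \<rho> ^ (2 * (n div 2) + 1) \<le> sqrt \<rho> ^ n"
      using \<rho> by (intro power_decreasing) (presburger, auto)
    then show ?thesis using \<rho> by (simp add: power_mult field_simps)
  qed
  have "tv_distance S (kernel_power S K n x) P \<le> C x * sqrt \<rho> ^ n" if x: "x \<in> space S" for x n
    unfolding tv_distance_def
  proof (rule cSUP_least)
    fix A assume A: "A \<in> sets S"
    have "0 \<le> 2 + b * V x + b * v" using nonneg[OF x] b v by simp
    then have "\<rho> ^ (n div 2) * (2 + b * V x + b * v) \<le> sqrt \<rho> ^ n / sqrt \<rho> * (2 + b * V x + b * v)"
      by (intro mult_right_mono rate)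
    with tv[OF x A, of n] show "\<bar>measure (kernel_power S K n x) A - measure P A\<bar> \<le> C x * sqrt \<rho> ^ n"
      by (simp add: C_def mult.commute)
  qed auto
  then show ?thesis
    unfolding geometrically_ergodic_def using K P C \<rho>
    by (intro conjI exI[of _ C] exI[of _ "sqrt \<rho>"]) auto
qed

text \<open>One further step of the chain carries a one-step minorant to a two-step minorant.\<close>

lemma minorization_two_step:
  assumes K: "K \<in> S \<rightarrow>\<^sub>M prob_algebra S" and \<nu>: "sets \<nu> = sets S" "emeasure \<nu> (space S) \<noteq> 0"
    and minor: "\<And>x f. x \<in> space S \<Longrightarrow> Q x \<Longrightarrow> f \<in> borel_measurable S \<Longrightarrow> (\<integral>\<^sup>+z. f z \<partial>\<nu>) \<le> (\<integral>\<^sup>+z. f z \<partial>K x)"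
  shows "\<exists>\<nu>'. sets \<nu>' = sets S \<and> emeasure \<nu>' (space S) \<noteq> 0 \<and> (\<forall>x\<in>space S. Q x \<longrightarrow>
    (\<forall>f\<in>borel_measurable S. (\<integral>\<^sup>+z. f z \<partial>\<nu>') \<le> (\<integral>\<^sup>+w. \<integral>\<^sup>+z. f z \<partial>K w \<partial>K x)))"
proof (intro exI[of _ "\<nu> \<bind> K"] conjI ballI impI)
  have sp: "space \<nu> = space S" using \<nu>(1) by (rule sets_eq_imp_space_eq)
  have ne: "space \<nu> \<noteq> {}" using \<nu>(2) sp by auto
  have K': "K \<in> \<nu> \<rightarrow>\<^sub>M subprob_algebra S"
    using measurable_prob_algebraD[OF K] by (simp add: measurable_cong_sets[OF \<nu>(1) refl])
  have Kone: "emeasure (K w) (space S) = 1" if "w \<in> space S" for w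
    using prob_space.emeasure_space_1[OF prob_kernelD(1)[OF K that]] prob_kernelD(3)[OF K that] by simp
  show "sets (\<nu> \<bind> K) = sets S"
    using prob_kernelD(2)[OF K] by (intro sets_bind ne) (simp add: sp)
  have "emeasure (\<nu> \<bind> K) (space S) = (\<integral>\<^sup>+w. emeasure (K w) (space S) \<partial>\<nu>)"
    by (rule emeasure_bind[OF ne K']) simp
  also have "\<dots> = (\<integral>\<^sup>+w. 1 \<partial>\<nu>)" by (intro nn_integral_cong) (simp add: Kone sp)
  finally show "emeasure (\<nu> \<bind> K) (space S) \<noteq> 0" using \<nu>(2) sp by simp
  fix x and f :: "'a \<Rightarrow> ennreal" assume x: "x \<in> space S" "Q x" and f: "f \<in> borel_measurable S"
  have "(\<lambda>w. \<integral>\<^sup>+z. f z \<partial>K w) \<in> borel_measurable S"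
    using measurable_compose[OF measurable_prob_algebraD[OF K] nn_integral_measurable_subprob_algebra[OF f]] .
  then show "(\<integral>\<^sup>+z. f z \<partial>(\<nu> \<bind> K)) \<le> (\<integral>\<^sup>+w. \<integral>\<^sup>+z. f z \<partial>K w \<partial>K x)"
    unfolding nn_integral_bind[OF f K'] by (rule minor[OF x])
qed

section \<open>Gibbs samplers with a latent block\<close>

lemma density_prob_kernel:
  assumes N: "sigma_finite_measure N" and p: "(\<lambda>(x, y). p x y) \<in> borel_measurable (M \<Otimes>\<^sub>M N)"
    and one: "\<And>x. x \<in> space M \<Longrightarrow> (\<integral>\<^sup>+y. p x y \<partial>N) = 1"
  shows "(\<lambda>x. density N (p x)) \<in> M \<rightarrow>\<^sub>M prob_algebra N"
proof -
  interpret N: sigma_finite_measure N by fact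
  have px: "p x \<in> borel_measurable N" if "x \<in> space M" for x
    using measurable_compose[OF measurable_Pair1'[OF that] p] by simp
  have prob: "prob_space (density N (p x))" if "x \<in> space M" for x
    using one[OF that] px[OF that] by (intro prob_spaceI) (simp add: emeasure_density)
  show ?thesis
  proof (rule measurable_prob_algebraI[OF prob], assumption, rule measurable_subprob_algebra)
    fix A assume A[measurable]: "A \<in> sets N"
    note p[measurable]
    have "(\<lambda>x. \<integral>\<^sup>+y. p x y * indicator A y \<partial>N) \<in> borel_measurable M" by measurable
    then show "(\<lambda>x. emeasure (density N (p x)) A) \<in> borel_measurable M"
      by (rule measurable_cong[THEN iffD1, rotated]) (simp add: emeasure_density px)
  qed (auto intro: prob_space_imp_subprob_space prob)
qed

text \<open>A state has blocks \<open>b\<close> and \<open>s\<close>, and \<open>z\<close> is a latent block that is redrawn in each step. The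
  functions \<open>pb\<close>, \<open>ps\<close> and \<open>pz\<close> are the conditional densities of one block given the other two.\<close>

locale latent_gibbs =
  MB: sigma_finite_measure MB + MS: sigma_finite_measure MS + MZ: sigma_finite_measure MZ
  for MB :: "'b measure" and MS :: "'s measure" and MZ :: "'z measure" +
  fixes pb :: "'s \<Rightarrow> 'z \<Rightarrow> 'b \<Rightarrow> ennreal"
    and ps :: "'b \<Rightarrow> 'z \<Rightarrow> 's \<Rightarrow> ennreal"
    and pz :: "'b \<Rightarrow> 's \<Rightarrow> 'z \<Rightarrow> ennreal"
  assumes pb_joint: "(\<lambda>(s, z, b). pb s z b) \<in> borel_measurable (MS \<Otimes>\<^sub>M (MZ \<Otimes>\<^sub>M MB))"
    and ps_joint: "(\<lambda>(b, z, s). ps b z s) \<in> borel_measurable (MB \<Otimes>\<^sub>M (MZ \<Otimes>\<^sub>M MS))"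
    and pz_joint: "(\<lambda>(b, s, z). pz b s z) \<in> borel_measurable (MB \<Otimes>\<^sub>M (MS \<Otimes>\<^sub>M MZ))"
    and pb_one: "s \<in> space MS \<Longrightarrow> z \<in> space MZ \<Longrightarrow> (\<integral>\<^sup>+b. pb s z b \<partial>MB) = 1"
    and ps_one: "b \<in> space MB \<Longrightarrow> z \<in> space MZ \<Longrightarrow> (\<integral>\<^sup>+s. ps b z s \<partial>MS) = 1"
    and pz_one: "b \<in> space MB \<Longrightarrow> s \<in> space MS \<Longrightarrow> (\<integral>\<^sup>+z. pz b s z \<partial>MZ) = 1"
begin

sublocale BS: pair_sigma_finite MB MS ..
sublocale BZ: pair_sigma_finite MB MZ ..
sublocale SZ: pair_sigma_finite MS MZ ..

text \<open>These rules let the conditional densities be composed with arbitrary measurable arguments.\<close>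

lemma pb_measurable[measurable (raw)]:
  "f \<in> N \<rightarrow>\<^sub>M MS \<Longrightarrow> g \<in> N \<rightarrow>\<^sub>M MZ \<Longrightarrow> k \<in> N \<rightarrow>\<^sub>M MB \<Longrightarrow> (\<lambda>x. pb (f x) (g x) (k x)) \<in> borel_measurable N"
  using measurable_compose[OF _ pb_joint, of "\<lambda>x. (f x, g x, k x)" N] by simp

lemma ps_measurable[measurable (raw)]:
  "f \<in> N \<rightarrow>\<^sub>M MB \<Longrightarrow> g \<in> N \<rightarrow>\<^sub>M MZ \<Longrightarrow> k \<in> N \<rightarrow>\<^sub>M MS \<Longrightarrow> (\<lambda>x. ps (f x) (g x) (k x)) \<in> borel_measurable N"
  using measurable_compose[OF _ ps_joint, of "\<lambda>x. (f x, g x, k x)" N] by simp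

lemma pz_measurable[measurable (raw)]:
  "f \<in> N \<rightarrow>\<^sub>M MB \<Longrightarrow> g \<in> N \<rightarrow>\<^sub>M MS \<Longrightarrow> k \<in> N \<rightarrow>\<^sub>M MZ \<Longrightarrow> (\<lambda>x. pz (f x) (g x) (k x)) \<in> borel_measurable N"
  using measurable_compose[OF _ pz_joint, of "\<lambda>x. (f x, g x, k x)" N] by simp

definition systematic :: "'b \<times> 's \<Rightarrow> ('b \<times> 's) measure" where
  "systematic = (\<lambda>(b', s'). density (MB \<Otimes>\<^sub>M MS)
     (\<lambda>(b, s). \<integral>\<^sup>+z. pb s z b * ps b' z s * pz b' s' z \<partial>MZ))"

definition hybrid :: "real \<Rightarrow> 'b \<times> 's \<Rightarrow> ('b \<times> 's) measure" where
  "hybrid r = (\<lambda>(b, s).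
     (density MZ (pz b s) \<Otimes>\<^sub>M uniform_measure lborel {0<..<1}) \<bind> (\<lambda>(z, w).
       if w \<le> r then distr (density MS (ps b z)) (MB \<Otimes>\<^sub>M MS) (\<lambda>v. (b, v))
       else distr (density MB (pb s z)) (MB \<Otimes>\<^sub>M MS) (\<lambda>v. (v, s))))"

text \<open>Tonelli's theorem turns the transition density into the sequence of draws \<open>z\<close>, \<open>s\<close>, \<open>b\<close>.\<close>

lemma nn_integral_systematic:
  assumes f[measurable]: "f \<in> borel_measurable (MB \<Otimes>\<^sub>M MS)"
    and [measurable]: "b' \<in> space MB" "s' \<in> space MS"
  shows "(\<integral>\<^sup>+x. f x \<partial>systematic (b', s')) =
    (\<integral>\<^sup>+z. pz b' s' z * (\<integral>\<^sup>+s. ps b' z s * (\<integral>\<^sup>+b. pb s z b * f (b, s) \<partial>MB) \<partial>MS) \<partial>MZ)"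
proof -
  let ?G = "\<lambda>b s z. pb s z b * ps b' z s * pz b' s' z * f (b, s)"
  have "(\<integral>\<^sup>+x. f x \<partial>systematic (b', s')) =
      (\<integral>\<^sup>+x. (\<integral>\<^sup>+z. pb (snd x) z (fst x) * ps b' z (snd x) * pz b' s' z \<partial>MZ) * f x \<partial>(MB \<Otimes>\<^sub>M MS))"
    unfolding systematic_def by (simp add: case_prod_beta' nn_integral_density)
  also have "\<dots> = (\<integral>\<^sup>+b. \<integral>\<^sup>+s. \<integral>\<^sup>+z. ?G b s z \<partial>MZ \<partial>MS \<partial>MB)"
    by (simp add: MS.nn_integral_fst[symmetric], intro nn_integral_cong, simp add: nn_integral_multc)
  also have "\<dots> = (\<integral>\<^sup>+s. \<integral>\<^sup>+b. \<integral>\<^sup>+z. ?G b s z \<partial>MZ \<partial>MB \<partial>MS)"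
    by (intro BS.Fubini'[symmetric]) measurable
  also have "\<dots> = (\<integral>\<^sup>+s. \<integral>\<^sup>+z. \<integral>\<^sup>+b. ?G b s z \<partial>MB \<partial>MZ \<partial>MS)"
    by (intro nn_integral_cong BZ.Fubini'[symmetric]) measurable
  also have "\<dots> = (\<integral>\<^sup>+z. \<integral>\<^sup>+s. \<integral>\<^sup>+b. ?G b s z \<partial>MB \<partial>MS \<partial>MZ)"
    by (intro SZ.Fubini'[symmetric]) measurable
  also have "\<dots> = (\<integral>\<^sup>+z. \<integral>\<^sup>+s. \<integral>\<^sup>+b. pz b' s' z * (ps b' z s * (pb s z b * f (b, s))) \<partial>MB \<partial>MS \<partial>MZ)"
    by (simp add: mult_ac)
  also have "\<dots> = (\<integral>\<^sup>+z. pz b' s' z * (\<integral>\<^sup>+s. ps b' z s * (\<integral>\<^sup>+b. pb s z b * f (b, s) \<partial>MB) \<partial>MS) \<partial>MZ)"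
    by (simp add: nn_integral_cmult cong: nn_integral_cong)
  finally show ?thesis .
qed

lemma sets_systematic: "sets (systematic x) = sets (MB \<Otimes>\<^sub>M MS)"
  by (simp add: systematic_def case_prod_beta)

lemma systematic_kernel: "systematic \<in> (MB \<Otimes>\<^sub>M MS) \<rightarrow>\<^sub>M prob_algebra (MB \<Otimes>\<^sub>M MS)"
proof -
  have prob: "prob_space (systematic x)" if x: "x \<in> space (MB \<Otimes>\<^sub>M MS)" for x
  proof (rule prob_spaceI)
    obtain b s where x: "x = (b, s)" "b \<in> space MB" "s \<in> space MS"
      using x unfolding space_pair_measure by blast
    have "emeasure (systematic x) (space (systematic x)) = (\<integral>\<^sup>+y. 1 \<partial>systematic x)" by simp
    also have "\<dots> = 1"
      unfolding x(1) using x by (subst nn_integral_systematic)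
        (simp_all add: pb_one ps_one pz_one cong: nn_integral_cong)
    finally show "emeasure (systematic x) (space (systematic x)) = 1" .
  qed
  show ?thesis
  proof (rule measurable_prob_algebraI[OF prob], assumption, rule measurable_subprob_algebra)
    fix A assume A[measurable]: "A \<in> sets (MB \<Otimes>\<^sub>M MS)"
    have "(\<lambda>x. \<integral>\<^sup>+z. pz (fst x) (snd x) z * (\<integral>\<^sup>+s. ps (fst x) z s *
        (\<integral>\<^sup>+b. pb s z b * indicator A (b, s) \<partial>MB) \<partial>MS) \<partial>MZ) \<in> borel_measurable (MB \<Otimes>\<^sub>M MS)"
      by measurable
    then show "(\<lambda>x. emeasure (systematic x) A) \<in> borel_measurable (MB \<Otimes>\<^sub>M MS)"
    proof (rule measurable_cong[THEN iffD1, rotated])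
      fix x assume "x \<in> space (MB \<Otimes>\<^sub>M MS)"
      then have "fst x \<in> space MB" "snd x \<in> space MS" by (auto simp: space_pair_measure)
      from nn_integral_systematic[OF borel_measurable_indicator[OF A] this]
      show "(\<integral>\<^sup>+z. pz (fst x) (snd x) z * (\<integral>\<^sup>+s. ps (fst x) z s *
        (\<integral>\<^sup>+b. pb s z b * indicator A (b, s) \<partial>MB) \<partial>MS) \<partial>MZ) = emeasure (systematic x) A"
        using A sets_systematic by simp
    qed
  qed (auto simp: sets_systematic intro: prob_space_imp_subprob_space prob)
qed

lemma nn_integral_hybrid:
  assumes f[measurable]: "f \<in> borel_measurable (MB \<Otimes>\<^sub>M MS)"
    and b[measurable]: "b \<in> space MB" and s[measurable]: "s \<in> space MS" and r: "0 < r" "r < 1"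
  shows "(\<integral>\<^sup>+x. f x \<partial>hybrid r (b, s)) =
    ennreal r * (\<integral>\<^sup>+z. pz b s z * (\<integral>\<^sup>+v. ps b z v * f (b, v) \<partial>MS) \<partial>MZ) +
    ennreal (1 - r) * (\<integral>\<^sup>+z. pz b s z * (\<integral>\<^sup>+v. pb s z v * f (v, s) \<partial>MB) \<partial>MZ)"
    (is "_ = ?rhs")
proof -
  let ?U = "uniform_measure lborel {0<..<1::real}"
  let ?D = "density MZ (pz b s)"
  let ?K = "\<lambda>(z, w). if w \<le> r then distr (density MS (ps b z)) (MB \<Otimes>\<^sub>M MS) (\<lambda>v. (b, v))
       else distr (density MB (pb s z)) (MB \<Otimes>\<^sub>M MS) (\<lambda>v. (v, s))"
  interpret U: prob_space ?U by (intro prob_space_uniform_measure) auto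
  have sets: "sets (?D \<Otimes>\<^sub>M ?U) = sets (MZ \<Otimes>\<^sub>M borel)" by (intro sets_pair_measure_cong) auto
  have [measurable]: "(\<lambda>z. density MS (ps b z)) \<in> MZ \<rightarrow>\<^sub>M prob_algebra MS"
    using b ps_one by (intro density_prob_kernel MS.sigma_finite_measure_axioms) measurable
  have [measurable]: "(\<lambda>z. density MB (pb s z)) \<in> MZ \<rightarrow>\<^sub>M prob_algebra MB"
    using s pb_one by (intro density_prob_kernel MB.sigma_finite_measure_axioms) measurable
  have K: "?K \<in> (MZ \<Otimes>\<^sub>M borel) \<rightarrow>\<^sub>M prob_algebra (MB \<Otimes>\<^sub>M MS)"
    by measurable
  then have K': "?K \<in> (?D \<Otimes>\<^sub>M ?U) \<rightarrow>\<^sub>M subprob_algebra (MB \<Otimes>\<^sub>M MS)"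
    by (intro measurable_prob_algebraD) (simp add: measurable_cong_sets[OF sets refl])
  define a where "a z = (\<integral>\<^sup>+v. ps b z v * f (b, v) \<partial>MS)" for z
  define c where "c z = (\<integral>\<^sup>+v. pb s z v * f (v, s) \<partial>MB)" for z
  have [measurable]: "a \<in> borel_measurable MZ" "c \<in> borel_measurable MZ"
    unfolding a_def c_def by measurable
  (* the uniform variable selects the block: s with probability r, b with probability 1 - r *)
  have uni: "(\<integral>\<^sup>+w. (if w \<le> r then p else q) \<partial>?U) = ennreal r * p + ennreal (1 - r) * q" for p q
  proof -
    have "(\<integral>\<^sup>+w. (if w \<le> r then p else q) \<partial>?U)
        = (\<integral>\<^sup>+w. p * indicator {0<..r} w + q * indicator {r<..<1} w \<partial>lborel)"
      using r by (subst nn_integral_uniform_measure)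
        (auto simp: divide_ennreal_def intro!: nn_integral_cong split: split_indicator)
    also have "\<dots> = p * ennreal r + q * ennreal (1 - r)"
      using r by (subst nn_integral_add) (auto simp: nn_integral_cmult)
    finally show ?thesis by (simp add: mult.commute)
  qed
  have "(\<integral>\<^sup>+x. f x \<partial>hybrid r (b, s)) = (\<integral>\<^sup>+y. \<integral>\<^sup>+x. f x \<partial>?K y \<partial>(?D \<Otimes>\<^sub>M ?U))"
    unfolding hybrid_def prod.case using f K' by (rule nn_integral_bind)
  also have "\<dots> = (\<integral>\<^sup>+y. (if snd y \<le> r then a (fst y) else c (fst y)) \<partial>(?D \<Otimes>\<^sub>M ?U))"
  proof (rule nn_integral_cong)
    fix y assume "y \<in> space (?D \<Otimes>\<^sub>M ?U)"
    then have "fst y \<in> space MZ" by (auto simp: space_pair_measure)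
    then show "(\<integral>\<^sup>+x. f x \<partial>?K y) = (if snd y \<le> r then a (fst y) else c (fst y))"
      by (cases y) (auto simp: a_def c_def nn_integral_distr nn_integral_density)
  qed
  also have "\<dots> = (\<integral>\<^sup>+z. \<integral>\<^sup>+w. (if w \<le> r then a z else c z) \<partial>?U \<partial>?D)"
    by (subst U.nn_integral_fst[symmetric]) (auto simp: measurable_cong_sets[OF sets refl] cong: if_cong)
  also have "\<dots> = (\<integral>\<^sup>+z. pz b s z * (ennreal r * a z + ennreal (1 - r) * c z) \<partial>MZ)"
    unfolding uni by (rule nn_integral_density) measurable
  also have "\<dots> = (\<integral>\<^sup>+z. ennreal r * (pz b s z * a z) + ennreal (1 - r) * (pz b s z * c z) \<partial>MZ)"
    by (simp add: distrib_left mult_ac)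
  also have "\<dots> = ?rhs"
    unfolding a_def[symmetric] c_def[symmetric] by (simp add: nn_integral_add nn_integral_cmult)
  finally show ?thesis .
qed

lemma hybrid_kernel:
  assumes r: "0 < r" "r < 1"
  shows "hybrid r \<in> (MB \<Otimes>\<^sub>M MS) \<rightarrow>\<^sub>M prob_algebra (MB \<Otimes>\<^sub>M MS)"
proof -
  have [measurable]: "(\<lambda>x. density MZ (pz (fst x) (snd x))) \<in> MB \<Otimes>\<^sub>M MS \<rightarrow>\<^sub>M prob_algebra MZ"
    using pz_one by (intro density_prob_kernel MZ.sigma_finite_measure_axioms) (auto simp: space_pair_measure)
  have [measurable]: "(\<lambda>y. density MS (ps (fst (fst y)) (fst (snd y)))) \<in>
      (MB \<Otimes>\<^sub>M MS) \<Otimes>\<^sub>M (MZ \<Otimes>\<^sub>M borel) \<rightarrow>\<^sub>M prob_algebra MS"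
    using ps_one by (intro density_prob_kernel MS.sigma_finite_measure_axioms) (auto simp: space_pair_measure)
  have [measurable]: "(\<lambda>y. density MB (pb (snd (fst y)) (fst (snd y)))) \<in>
      (MB \<Otimes>\<^sub>M MS) \<Otimes>\<^sub>M (MZ \<Otimes>\<^sub>M borel) \<rightarrow>\<^sub>M prob_algebra MB"
    using pb_one by (intro density_prob_kernel MB.sigma_finite_measure_axioms) (auto simp: space_pair_measure)
  let ?U = "uniform_measure lborel {0<..<1::real}"
  have [measurable]: "(\<lambda>x. ?U) \<in> MB \<Otimes>\<^sub>M MS \<rightarrow>\<^sub>M prob_algebra borel"
    by (intro measurable_const) (auto simp: space_prob_algebra intro!: prob_space_uniform_measure)
  have "(\<lambda>x. (density MZ (pz (fst x) (snd x)) \<Otimes>\<^sub>M ?U) \<bind>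
      (\<lambda>y. if snd y \<le> r then distr (density MS (ps (fst x) (fst y))) (MB \<Otimes>\<^sub>M MS) (\<lambda>v. (fst x, v))
        else distr (density MB (pb (snd x) (fst y))) (MB \<Otimes>\<^sub>M MS) (\<lambda>v. (v, snd x))))
      \<in> (MB \<Otimes>\<^sub>M MS) \<rightarrow>\<^sub>M prob_algebra (MB \<Otimes>\<^sub>M MS)"
    by (rule measurable_bind_prob_space2[where N = "MZ \<Otimes>\<^sub>M borel"]) measurable
  then show ?thesis by (simp add: hybrid_def case_prod_beta')
qed

text \<open>
  In the following \<open>A\<close> is a density of the pair \<open>(b, s)\<close>. The hypotheses say that the joint density
  \<open>A pz\<close> is proportional to \<open>ps\<close> as a function of \<open>s\<close>, and to \<open>pb\<close> as a function of \<open>b\<close>. The factors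
  are then integrals of the joint density over one block, hence measurable in the other two.
\<close>

context
  fixes A :: "'b \<times> 's \<Rightarrow> ennreal"
  assumes A_measurable[measurable]: "A \<in> borel_measurable (MB \<Otimes>\<^sub>M MS)"
    and s_conditional: "b \<in> space MB \<Longrightarrow> z \<in> space MZ \<Longrightarrow>
      \<exists>c. \<forall>s\<in>space MS. A (b, s) * pz b s z = c * ps b z s"
    and b_conditional: "s \<in> space MS \<Longrightarrow> z \<in> space MZ \<Longrightarrow>
      \<exists>d. \<forall>b\<in>space MB. A (b, s) * pz b s z = d * pb s z b"
begin

text \<open>Integrating the proportionality over \<open>s\<close> identifies the factor as the marginal density of the other
  two blocks. A fresh draw of \<open>s\<close> from its conditional then restores the joint density.\<close>

lemma s_update_invariant:
  assumes F[measurable]: "F \<in> borel_measurable (MB \<Otimes>\<^sub>M (MZ \<Otimes>\<^sub>M MS))"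
  shows "(\<integral>\<^sup>+b. \<integral>\<^sup>+s. A (b, s) * (\<integral>\<^sup>+z. pz b s z * (\<integral>\<^sup>+v. ps b z v * F (b, z, v) \<partial>MS) \<partial>MZ) \<partial>MS \<partial>MB) =
    (\<integral>\<^sup>+b. \<integral>\<^sup>+s. A (b, s) * (\<integral>\<^sup>+z. pz b s z * F (b, z, s) \<partial>MZ) \<partial>MS \<partial>MB)"
proof (rule nn_integral_cong)
  fix b assume b[measurable]: "b \<in> space MB"
  have key: "(\<integral>\<^sup>+s. A (b, s) * pz b s z \<partial>MS) * ps b z v = A (b, v) * pz b v z"
    if z: "z \<in> space MZ" and v: "v \<in> space MS" for z v
  proof -
    obtain c where c: "\<And>s. s \<in> space MS \<Longrightarrow> A (b, s) * pz b s z = c * ps b z s"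
      using s_conditional[OF b z] by blast
    have "(\<integral>\<^sup>+s. A (b, s) * pz b s z \<partial>MS) = c"
      using ps_one[OF b z] z by (simp add: c nn_integral_cmult cong: nn_integral_cong)
    then show ?thesis using c[OF v] by simp
  qed
  have "(\<integral>\<^sup>+s. A (b, s) * (\<integral>\<^sup>+z. pz b s z * (\<integral>\<^sup>+v. ps b z v * F (b, z, v) \<partial>MS) \<partial>MZ) \<partial>MS)
      = (\<integral>\<^sup>+s. \<integral>\<^sup>+z. (A (b, s) * pz b s z) * (\<integral>\<^sup>+v. ps b z v * F (b, z, v) \<partial>MS) \<partial>MZ \<partial>MS)"
    by (simp add: nn_integral_cmult mult.assoc cong: nn_integral_cong)
  also have "\<dots> = (\<integral>\<^sup>+z. \<integral>\<^sup>+s. (A (b, s) * pz b s z) * (\<integral>\<^sup>+v. ps b z v * F (b, z, v) \<partial>MS) \<partial>MS \<partial>MZ)"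
    by (intro SZ.Fubini'[symmetric]) measurable
  also have "\<dots> = (\<integral>\<^sup>+z. \<integral>\<^sup>+v. (\<integral>\<^sup>+s. A (b, s) * pz b s z \<partial>MS) * (ps b z v * F (b, z, v)) \<partial>MS \<partial>MZ)"
    by (rule nn_integral_cong) (simp add: nn_integral_cmult nn_integral_multc)
  also have "\<dots> = (\<integral>\<^sup>+z. \<integral>\<^sup>+v. A (b, v) * (pz b v z * F (b, z, v)) \<partial>MS \<partial>MZ)"
    by (simp add: key mult.assoc[symmetric] cong: nn_integral_cong)
  also have "\<dots> = (\<integral>\<^sup>+v. \<integral>\<^sup>+z. A (b, v) * (pz b v z * F (b, z, v)) \<partial>MZ \<partial>MS)"
    by (intro SZ.Fubini') measurable
  also have "\<dots> = (\<integral>\<^sup>+s. A (b, s) * (\<integral>\<^sup>+z. pz b s z * F (b, z, s) \<partial>MZ) \<partial>MS)"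
    by (simp add: nn_integral_cmult cong: nn_integral_cong)
  finally show "(\<integral>\<^sup>+s. A (b, s) * (\<integral>\<^sup>+z. pz b s z * (\<integral>\<^sup>+v. ps b z v * F (b, z, v) \<partial>MS) \<partial>MZ) \<partial>MS) =
    (\<integral>\<^sup>+s. A (b, s) * (\<integral>\<^sup>+z. pz b s z * F (b, z, s) \<partial>MZ) \<partial>MS)" .
qed

text \<open>The same computation for the block \<open>b\<close>, with the integrals over \<open>b\<close> and \<open>s\<close> exchanged.\<close>

lemma b_update_invariant:
  assumes F[measurable]: "F \<in> borel_measurable (MB \<Otimes>\<^sub>M (MS \<Otimes>\<^sub>M MZ))"
  shows "(\<integral>\<^sup>+b. \<integral>\<^sup>+s. A (b, s) * (\<integral>\<^sup>+z. pz b s z * (\<integral>\<^sup>+v. pb s z v * F (v, s, z) \<partial>MB) \<partial>MZ) \<partial>MS \<partial>MB) =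
    (\<integral>\<^sup>+b. \<integral>\<^sup>+s. A (b, s) * (\<integral>\<^sup>+z. pz b s z * F (b, s, z) \<partial>MZ) \<partial>MS \<partial>MB)"
proof -
  have inner: "(\<integral>\<^sup>+b. A (b, s) * (\<integral>\<^sup>+z. pz b s z * (\<integral>\<^sup>+v. pb s z v * F (v, s, z) \<partial>MB) \<partial>MZ) \<partial>MB) =
    (\<integral>\<^sup>+b. A (b, s) * (\<integral>\<^sup>+z. pz b s z * F (b, s, z) \<partial>MZ) \<partial>MB)" if s[measurable]: "s \<in> space MS" for s
  proof -
    have key: "(\<integral>\<^sup>+b. A (b, s) * pz b s z \<partial>MB) * pb s z v = A (v, s) * pz v s z"
      if z: "z \<in> space MZ" and v: "v \<in> space MB" for z v
    proof -
      obtain d where d: "\<And>b. b \<in> space MB \<Longrightarrow> A (b, s) * pz b s z = d * pb s z b"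
        using b_conditional[OF s z] by blast
      have "(\<integral>\<^sup>+b. A (b, s) * pz b s z \<partial>MB) = d"
        using pb_one[OF s z] z by (simp add: d nn_integral_cmult cong: nn_integral_cong)
      then show ?thesis using d[OF v] by simp
    qed
    have "(\<integral>\<^sup>+b. A (b, s) * (\<integral>\<^sup>+z. pz b s z * (\<integral>\<^sup>+v. pb s z v * F (v, s, z) \<partial>MB) \<partial>MZ) \<partial>MB)
        = (\<integral>\<^sup>+b. \<integral>\<^sup>+z. (A (b, s) * pz b s z) * (\<integral>\<^sup>+v. pb s z v * F (v, s, z) \<partial>MB) \<partial>MZ \<partial>MB)"
      by (simp add: nn_integral_cmult mult.assoc cong: nn_integral_cong)
    also have "\<dots> = (\<integral>\<^sup>+z. \<integral>\<^sup>+b. (A (b, s) * pz b s z) * (\<integral>\<^sup>+v. pb s z v * F (v, s, z) \<partial>MB) \<partial>MB \<partial>MZ)"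
      by (intro BZ.Fubini'[symmetric]) measurable
    also have "\<dots> = (\<integral>\<^sup>+z. \<integral>\<^sup>+v. (\<integral>\<^sup>+b. A (b, s) * pz b s z \<partial>MB) * (pb s z v * F (v, s, z)) \<partial>MB \<partial>MZ)"
      by (rule nn_integral_cong) (simp add: nn_integral_cmult nn_integral_multc)
    also have "\<dots> = (\<integral>\<^sup>+z. \<integral>\<^sup>+v. A (v, s) * (pz v s z * F (v, s, z)) \<partial>MB \<partial>MZ)"
      by (simp add: key mult.assoc[symmetric] cong: nn_integral_cong)
    also have "\<dots> = (\<integral>\<^sup>+v. \<integral>\<^sup>+z. A (v, s) * (pz v s z * F (v, s, z)) \<partial>MZ \<partial>MB)"
      by (intro BZ.Fubini') measurable
    also have "\<dots> = (\<integral>\<^sup>+b. A (b, s) * (\<integral>\<^sup>+z. pz b s z * F (b, s, z) \<partial>MZ) \<partial>MB)"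
      by (simp add: nn_integral_cmult cong: nn_integral_cong)
    finally show ?thesis .
  qed
  have "(\<integral>\<^sup>+b. \<integral>\<^sup>+s. A (b, s) * (\<integral>\<^sup>+z. pz b s z * (\<integral>\<^sup>+v. pb s z v * F (v, s, z) \<partial>MB) \<partial>MZ) \<partial>MS \<partial>MB) =
    (\<integral>\<^sup>+s. \<integral>\<^sup>+b. A (b, s) * (\<integral>\<^sup>+z. pz b s z * (\<integral>\<^sup>+v. pb s z v * F (v, s, z) \<partial>MB) \<partial>MZ) \<partial>MB \<partial>MS)"
    by (intro BS.Fubini'[symmetric]) measurable
  also have "\<dots> = (\<integral>\<^sup>+s. \<integral>\<^sup>+b. A (b, s) * (\<integral>\<^sup>+z. pz b s z * F (b, s, z) \<partial>MZ) \<partial>MB \<partial>MS)"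
    by (intro nn_integral_cong inner)
  also have "\<dots> = (\<integral>\<^sup>+b. \<integral>\<^sup>+s. A (b, s) * (\<integral>\<^sup>+z. pz b s z * F (b, s, z) \<partial>MZ) \<partial>MS \<partial>MB)"
    by (intro BS.Fubini') measurable
  finally show ?thesis .
qed

lemma marginal_nn_integral:
  assumes f[measurable]: "f \<in> borel_measurable (MB \<Otimes>\<^sub>M MS)"
  shows "(\<integral>\<^sup>+x. f x \<partial>density (MB \<Otimes>\<^sub>M MS) A) = (\<integral>\<^sup>+b. \<integral>\<^sup>+s. A (b, s) * f (b, s) \<partial>MS \<partial>MB)"
  by (simp add: nn_integral_density MS.nn_integral_fst[symmetric])

lemma invariantI:
  assumes K: "K \<in> (MB \<Otimes>\<^sub>M MS) \<rightarrow>\<^sub>M prob_algebra (MB \<Otimes>\<^sub>M MS)"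
    and ne: "space (MB \<Otimes>\<^sub>M MS) \<noteq> {}"
    and inv: "\<And>f. f \<in> borel_measurable (MB \<Otimes>\<^sub>M MS) \<Longrightarrow>
      (\<integral>\<^sup>+b. \<integral>\<^sup>+s. A (b, s) * (\<integral>\<^sup>+x. f x \<partial>K (b, s)) \<partial>MS \<partial>MB) = (\<integral>\<^sup>+b. \<integral>\<^sup>+s. A (b, s) * f (b, s) \<partial>MS \<partial>MB)"
  shows "density (MB \<Otimes>\<^sub>M MS) A \<bind> K = density (MB \<Otimes>\<^sub>M MS) A"
proof -
  let ?P = "density (MB \<Otimes>\<^sub>M MS) A"
  have K': "K \<in> ?P \<rightarrow>\<^sub>M subprob_algebra (MB \<Otimes>\<^sub>M MS)"
    using measurable_prob_algebraD[OF K] by simp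
  have sets: "sets (?P \<bind> K) = sets (MB \<Otimes>\<^sub>M MS)"
    using ne by (intro sets_bind[of _ _ "MB \<Otimes>\<^sub>M MS"]) (use subprob_measurableD(2)[OF K'] in auto)
  show ?thesis
  proof (rule measure_eqI)
    fix E assume "E \<in> sets (?P \<bind> K)"
    then have E[measurable]: "E \<in> sets (MB \<Otimes>\<^sub>M MS)" using sets by simp
    have meas: "(\<lambda>x. emeasure (K x) E) \<in> borel_measurable (MB \<Otimes>\<^sub>M MS)"
      using measurable_compose[OF measurable_prob_algebraD[OF K] measurable_emeasure_subprob_algebra[OF E]] .
    have KE: "(\<integral>\<^sup>+x. indicator E x \<partial>K y) = emeasure (K y) E" if "y \<in> space (MB \<Otimes>\<^sub>M MS)" for y
      using measurable_space[OF K that] E by (simp add: space_prob_algebra)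
    have "emeasure (?P \<bind> K) E = (\<integral>\<^sup>+x. emeasure (K x) E \<partial>?P)"
      using ne K' E by (intro emeasure_bind) auto
    also have "\<dots> = (\<integral>\<^sup>+b. \<integral>\<^sup>+s. A (b, s) * emeasure (K (b, s)) E \<partial>MS \<partial>MB)"
      using meas by (rule marginal_nn_integral)
    also have "\<dots> = (\<integral>\<^sup>+b. \<integral>\<^sup>+s. A (b, s) * (\<integral>\<^sup>+x. indicator E x \<partial>K (b, s)) \<partial>MS \<partial>MB)"
      by (intro nn_integral_cong) (simp add: KE space_pair_measure)
    also have "\<dots> = (\<integral>\<^sup>+b. \<integral>\<^sup>+s. A (b, s) * indicator E (b, s) \<partial>MS \<partial>MB)"
      by (rule inv) simp
    also have "\<dots> = emeasure ?P E"
      by (subst marginal_nn_integral[symmetric]) auto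
    finally show "emeasure (?P \<bind> K) E = emeasure ?P E" .
  qed (use sets in simp)
qed

text \<open>The scan is a draw of \<open>z\<close>, an \<open>s\<close> update and a \<open>b\<close> update with the same \<open>z\<close>, each of which
  preserves the joint density of the three blocks.\<close>

lemma systematic_invariant:
  assumes "space (MB \<Otimes>\<^sub>M MS) \<noteq> {}"
  shows "density (MB \<Otimes>\<^sub>M MS) A \<bind> systematic = density (MB \<Otimes>\<^sub>M MS) A"
proof (rule invariantI[OF systematic_kernel assms])
  fix f :: "'b \<times> 's \<Rightarrow> ennreal" assume f[measurable]: "f \<in> borel_measurable (MB \<Otimes>\<^sub>M MS)"
  have "(\<integral>\<^sup>+b. \<integral>\<^sup>+s. A (b, s) * (\<integral>\<^sup>+x. f x \<partial>systematic (b, s)) \<partial>MS \<partial>MB) =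
      (\<integral>\<^sup>+b. \<integral>\<^sup>+s. A (b, s) * (\<integral>\<^sup>+z. pz b s z * (\<integral>\<^sup>+v. ps b z v *
        (\<integral>\<^sup>+u. pb v z u * f (u, v) \<partial>MB) \<partial>MS) \<partial>MZ) \<partial>MS \<partial>MB)"
    by (intro nn_integral_cong) (simp add: nn_integral_systematic)
  also have "\<dots> = (\<integral>\<^sup>+b. \<integral>\<^sup>+s. A (b, s) * (\<integral>\<^sup>+z. pz b s z * (\<integral>\<^sup>+u. pb s z u * f (u, s) \<partial>MB) \<partial>MZ) \<partial>MS \<partial>MB)"
    by (rule s_update_invariant[of "\<lambda>(b, z, v). \<integral>\<^sup>+u. pb v z u * f (u, v) \<partial>MB", unfolded prod.case]) measurable
  also have "\<dots> = (\<integral>\<^sup>+b. \<integral>\<^sup>+s. A (b, s) * (\<integral>\<^sup>+z. pz b s z * f (b, s) \<partial>MZ) \<partial>MS \<partial>MB)"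
    by (rule b_update_invariant[of "\<lambda>(b, s, z). f (b, s)", unfolded prod.case]) measurable
  also have "\<dots> = (\<integral>\<^sup>+b. \<integral>\<^sup>+s. A (b, s) * f (b, s) \<partial>MS \<partial>MB)"
    by (intro nn_integral_cong) (simp add: nn_integral_multc pz_one)
  finally show "(\<integral>\<^sup>+b. \<integral>\<^sup>+s. A (b, s) * (\<integral>\<^sup>+x. f x \<partial>systematic (b, s)) \<partial>MS \<partial>MB) =
      (\<integral>\<^sup>+b. \<integral>\<^sup>+s. A (b, s) * f (b, s) \<partial>MS \<partial>MB)" .
qed

lemma hybrid_invariant:
  assumes ne: "space (MB \<Otimes>\<^sub>M MS) \<noteq> {}" and r: "0 < r" "r < 1"
  shows "density (MB \<Otimes>\<^sub>M MS) A \<bind> hybrid r = density (MB \<Otimes>\<^sub>M MS) A"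
proof (rule invariantI[OF hybrid_kernel[OF r] ne])
  fix f :: "'b \<times> 's \<Rightarrow> ennreal" assume f[measurable]: "f \<in> borel_measurable (MB \<Otimes>\<^sub>M MS)"
  have z_out: "(\<integral>\<^sup>+b. \<integral>\<^sup>+s. A (b, s) * (\<integral>\<^sup>+z. pz b s z * f (b, s) \<partial>MZ) \<partial>MS \<partial>MB)
      = (\<integral>\<^sup>+b. \<integral>\<^sup>+s. A (b, s) * f (b, s) \<partial>MS \<partial>MB)"
    by (intro nn_integral_cong) (simp add: nn_integral_multc pz_one)
  have "(\<integral>\<^sup>+b. \<integral>\<^sup>+s. A (b, s) * (\<integral>\<^sup>+x. f x \<partial>hybrid r (b, s)) \<partial>MS \<partial>MB) =
      (\<integral>\<^sup>+b. \<integral>\<^sup>+s. ennreal r * (A (b, s) * (\<integral>\<^sup>+z. pz b s z * (\<integral>\<^sup>+v. ps b z v * f (b, v) \<partial>MS) \<partial>MZ)) +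
        ennreal (1 - r) * (A (b, s) * (\<integral>\<^sup>+z. pz b s z * (\<integral>\<^sup>+v. pb s z v * f (v, s) \<partial>MB) \<partial>MZ)) \<partial>MS \<partial>MB)"
    by (intro nn_integral_cong) (simp add: nn_integral_hybrid[OF f _ _ r] distrib_left mult_ac)
  also have "\<dots> =
      ennreal r * (\<integral>\<^sup>+b. \<integral>\<^sup>+s. A (b, s) * (\<integral>\<^sup>+z. pz b s z * (\<integral>\<^sup>+v. ps b z v * f (b, v) \<partial>MS) \<partial>MZ) \<partial>MS \<partial>MB) +
      ennreal (1 - r) * (\<integral>\<^sup>+b. \<integral>\<^sup>+s. A (b, s) * (\<integral>\<^sup>+z. pz b s z * (\<integral>\<^sup>+v. pb s z v * f (v, s) \<partial>MB) \<partial>MZ) \<partial>MS \<partial>MB)"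
    by (simp add: nn_integral_add nn_integral_cmult cong: nn_integral_cong)
  also have "\<dots> = ennreal r * (\<integral>\<^sup>+b. \<integral>\<^sup>+s. A (b, s) * f (b, s) \<partial>MS \<partial>MB) +
      ennreal (1 - r) * (\<integral>\<^sup>+b. \<integral>\<^sup>+s. A (b, s) * f (b, s) \<partial>MS \<partial>MB)"
    using s_update_invariant[of "\<lambda>(b, z, s). f (b, s)"] b_update_invariant[of "\<lambda>(b, s, z). f (b, s)"]
    by (simp add: z_out)
  also have "\<dots> = (\<integral>\<^sup>+b. \<integral>\<^sup>+s. A (b, s) * f (b, s) \<partial>MS \<partial>MB)"
    using r by (simp flip: distrib_right ennreal_plus)
  finally show "(\<integral>\<^sup>+b. \<integral>\<^sup>+s. A (b, s) * (\<integral>\<^sup>+x. f x \<partial>hybrid r (b, s)) \<partial>MS \<partial>MB) =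
      (\<integral>\<^sup>+b. \<integral>\<^sup>+s. A (b, s) * f (b, s) \<partial>MS \<partial>MB)" .
qed

end

end

text \<open>The transition density is increasing in the conditional densities of \<open>z\<close> and \<open>s\<close>, so lower bounds
  for these that do not depend on the current state yield a minorizing measure.\<close>

lemma (in latent_gibbs) systematic_mono_density:
  assumes f[measurable]: "f \<in> borel_measurable (MB \<Otimes>\<^sub>M MS)"
    and x[measurable]: "b \<in> space MB" "s \<in> space MS"
    and meas: "z1 \<in> borel_measurable MZ" "(\<lambda>(z, v). s1 z v) \<in> borel_measurable (MZ \<Otimes>\<^sub>M MS)"
    and low: "\<And>z. z \<in> space MZ \<Longrightarrow> z1 z \<le> pz b s z"
      "\<And>z v. z \<in> space MZ \<Longrightarrow> v \<in> space MS \<Longrightarrow> s1 z v \<le> ps b z v"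
  shows "(\<integral>\<^sup>+x. f x \<partial>density (MB \<Otimes>\<^sub>M MS) (\<lambda>(b', v). \<integral>\<^sup>+z. pb v z b' * s1 z v * z1 z \<partial>MZ))
    \<le> (\<integral>\<^sup>+x. f x \<partial>systematic (b, s))"
proof -
  note [measurable] = meas(1)
  have [measurable]: "(\<lambda>x. s1 (g x) (k x)) \<in> borel_measurable N" if "g \<in> N \<rightarrow>\<^sub>M MZ" "k \<in> N \<rightarrow>\<^sub>M MS" for g k and N :: "(('b \<times> 's) \<times> 'z) measure"
    using measurable_compose[OF _ meas(2), of "\<lambda>x. (g x, k x)" N] that by simp
  have "(\<integral>\<^sup>+x. f x \<partial>density (MB \<Otimes>\<^sub>M MS) (\<lambda>(b', v). \<integral>\<^sup>+z. pb v z b' * s1 z v * z1 z \<partial>MZ))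
      = (\<integral>\<^sup>+x. (\<integral>\<^sup>+z. pb (snd x) z (fst x) * s1 z (snd x) * z1 z \<partial>MZ) * f x \<partial>(MB \<Otimes>\<^sub>M MS))"
    by (simp add: case_prod_beta' nn_integral_density)
  also have "\<dots> \<le> (\<integral>\<^sup>+x. (\<integral>\<^sup>+z. pb (snd x) z (fst x) * ps b z (snd x) * pz b s z \<partial>MZ) * f x \<partial>(MB \<Otimes>\<^sub>M MS))"
    using low by (intro nn_integral_mono mult_mono) (auto simp: space_pair_measure)
  also have "\<dots> = (\<integral>\<^sup>+x. f x \<partial>systematic (b, s))"
    by (simp add: systematic_def case_prod_beta' nn_integral_density)
  finally show ?thesis .
qed

text \<open>With probability \<open>r (1 - r)\<close> an \<open>s\<close> update is followed by a \<open>b\<close> update, each with its own draw of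
  the latent block. The measure on the left is the law of these two steps with the densities of the
  two latent draws and of \<open>s\<close> replaced by lower bounds.\<close>

lemma (in latent_gibbs) hybrid_two_step_lower_bound:
  assumes f[measurable]: "f \<in> borel_measurable (MB \<Otimes>\<^sub>M MS)"
    and x[measurable]: "b \<in> space MB" "s \<in> space MS" and r: "0 < r" "r < 1"
    and meas: "z1 \<in> borel_measurable MZ" "(\<lambda>(z, v). s1 z v) \<in> borel_measurable (MZ \<Otimes>\<^sub>M MS)"
      "(\<lambda>(v, z). z2 v z) \<in> borel_measurable (MS \<Otimes>\<^sub>M MZ)"
    and low: "\<And>z. z \<in> space MZ \<Longrightarrow> z1 z \<le> pz b s z"
      "\<And>z v. z \<in> space MZ \<Longrightarrow> v \<in> space MS \<Longrightarrow> s1 z v \<le> ps b z v"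
      "\<And>v z. v \<in> space MS \<Longrightarrow> z \<in> space MZ \<Longrightarrow> z2 v z \<le> pz b v z"
  shows "(\<integral>\<^sup>+x. f x \<partial>density (MB \<Otimes>\<^sub>M MS) (\<lambda>(b', v). ennreal r * ennreal (1 - r) *
      ((\<integral>\<^sup>+z. z1 z * s1 z v \<partial>MZ) * (\<integral>\<^sup>+z. z2 v z * pb v z b' \<partial>MZ))))
    \<le> (\<integral>\<^sup>+w. \<integral>\<^sup>+x. f x \<partial>hybrid r w \<partial>hybrid r (b, s))"
proof -
  define s1' where "s1' = (\<lambda>(z, v). s1 z v)"
  define z2' where "z2' = (\<lambda>(v, z). z2 v z)"
  have e: "s1 z v = s1' (z, v)" "z2 v z = z2' (v, z)" for z v by (simp_all add: s1'_def z2'_def)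
  have [measurable]: "z1 \<in> borel_measurable MZ" "s1' \<in> borel_measurable (MZ \<Otimes>\<^sub>M MS)" "z2' \<in> borel_measurable (MS \<Otimes>\<^sub>M MZ)"
    using meas by (auto simp: s1'_def z2'_def)
  let ?S = "\<lambda>v. \<integral>\<^sup>+z. z1 z * s1' (z, v) \<partial>MZ"
  let ?T = "\<lambda>b' v. \<integral>\<^sup>+z. z2' (v, z) * pb v z b' \<partial>MZ"
  let ?F = "\<lambda>w. \<integral>\<^sup>+x. f x \<partial>hybrid r w"
  have Fm[measurable]: "?F \<in> borel_measurable (MB \<Otimes>\<^sub>M MS)"
    using measurable_compose[OF measurable_prob_algebraD[OF hybrid_kernel[OF r]] nn_integral_measurable_subprob_algebra[OF f]] .
  have step2: "ennreal (1 - r) * (\<integral>\<^sup>+b'. ?T b' v * f (b', v) \<partial>MB) \<le> ?F (b, v)" if v[measurable]: "v \<in> space MS" for v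
  proof -
    have "(\<integral>\<^sup>+b'. ?T b' v * f (b', v) \<partial>MB) = (\<integral>\<^sup>+b'. \<integral>\<^sup>+z. z2' (v, z) * (pb v z b' * f (b', v)) \<partial>MZ \<partial>MB)"
      by (rule nn_integral_cong) (simp add: nn_integral_multc[symmetric] mult.assoc)
    also have "\<dots> = (\<integral>\<^sup>+z. \<integral>\<^sup>+b'. z2' (v, z) * (pb v z b' * f (b', v)) \<partial>MB \<partial>MZ)"
      by (intro BZ.Fubini'[symmetric]) measurable
    also have "\<dots> = (\<integral>\<^sup>+z. z2' (v, z) * (\<integral>\<^sup>+b'. pb v z b' * f (b', v) \<partial>MB) \<partial>MZ)"
      by (rule nn_integral_cong) (simp add: nn_integral_cmult)
    also have "\<dots> \<le> (\<integral>\<^sup>+z. pz b v z * (\<integral>\<^sup>+b'. pb v z b' * f (b', v) \<partial>MB) \<partial>MZ)"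
      using low(3)[OF v] by (intro nn_integral_mono mult_right_mono) (auto simp: e)
    finally have "(\<integral>\<^sup>+b'. ?T b' v * f (b', v) \<partial>MB) \<le> (\<integral>\<^sup>+z. pz b v z * (\<integral>\<^sup>+b'. pb v z b' * f (b', v) \<partial>MB) \<partial>MZ)" .
    then show ?thesis
      unfolding nn_integral_hybrid[OF f x(1) v r] by (intro add_increasing mult_left_mono) auto
  qed
  have "(\<integral>\<^sup>+x. f x \<partial>density (MB \<Otimes>\<^sub>M MS) (\<lambda>(b', v). ennreal r * ennreal (1 - r) * (?S v * ?T b' v)))
      = (\<integral>\<^sup>+b'. \<integral>\<^sup>+v. ennreal r * ennreal (1 - r) * (?S v * ?T b' v) * f (b', v) \<partial>MS \<partial>MB)"
    by (simp add: case_prod_beta' nn_integral_density MS.nn_integral_fst[symmetric])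
  also have "\<dots> = (\<integral>\<^sup>+v. \<integral>\<^sup>+b'. ennreal r * ennreal (1 - r) * (?S v * ?T b' v) * f (b', v) \<partial>MB \<partial>MS)"
    by (intro BS.Fubini'[symmetric]) measurable
  also have "\<dots> = (\<integral>\<^sup>+v. ennreal r * (?S v * (ennreal (1 - r) * (\<integral>\<^sup>+b'. ?T b' v * f (b', v) \<partial>MB))) \<partial>MS)"
    by (rule nn_integral_cong) (simp add: nn_integral_cmult[symmetric] mult_ac)
  also have "\<dots> \<le> (\<integral>\<^sup>+v. ennreal r * (?S v * ?F (b, v)) \<partial>MS)"
    using step2 by (intro nn_integral_mono mult_left_mono) auto
  also have "\<dots> = ennreal r * (\<integral>\<^sup>+v. ?S v * ?F (b, v) \<partial>MS)"
    by (rule nn_integral_cmult) measurable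
  also have "(\<integral>\<^sup>+v. ?S v * ?F (b, v) \<partial>MS) = (\<integral>\<^sup>+v. \<integral>\<^sup>+z. z1 z * (s1' (z, v) * ?F (b, v)) \<partial>MZ \<partial>MS)"
    by (rule nn_integral_cong) (simp add: nn_integral_multc[symmetric] mult.assoc)
  also have "\<dots> = (\<integral>\<^sup>+z. \<integral>\<^sup>+v. z1 z * (s1' (z, v) * ?F (b, v)) \<partial>MS \<partial>MZ)"
    by (intro SZ.Fubini'[symmetric]) measurable
  also have "\<dots> \<le> (\<integral>\<^sup>+z. \<integral>\<^sup>+v. pz b s z * (ps b z v * ?F (b, v)) \<partial>MS \<partial>MZ)"
    using low(1,2) by (intro nn_integral_mono mult_mono) (auto simp: e)
  also have "\<dots> = (\<integral>\<^sup>+z. pz b s z * (\<integral>\<^sup>+v. ps b z v * ?F (b, v) \<partial>MS) \<partial>MZ)"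
    by (rule nn_integral_cong) (simp add: nn_integral_cmult)
  finally have "(\<integral>\<^sup>+x. f x \<partial>density (MB \<Otimes>\<^sub>M MS) (\<lambda>(b', v). ennreal r * ennreal (1 - r) * (?S v * ?T b' v)))
      \<le> ennreal r * (\<integral>\<^sup>+z. pz b s z * (\<integral>\<^sup>+v. ps b z v * ?F (b, v) \<partial>MS) \<partial>MZ)"
    by (simp add: mult_left_mono)
  also have "\<dots> \<le> (\<integral>\<^sup>+w. ?F w \<partial>hybrid r (b, s))"
    unfolding nn_integral_hybrid[OF Fm x r] by (rule add_increasing2) auto
  finally show ?thesis unfolding e .
qed

section \<open>Linear change of variables and Gaussian integrals\<close>

lemma Basis_cart: "(Basis :: (real ^ 'n) set) = range (\<lambda>i. axis i 1)"
  by (auto simp: Basis_vec_def)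

lemma prod_Basis_cart: "(\<Prod>b\<in>(Basis :: (real ^ 'n) set). f b) = (\<Prod>i\<in>UNIV. f (axis i 1))"
  unfolding Basis_cart by (subst prod.reindex) (auto simp: inj_on_def axis_eq_axis)

lemma sum_Basis_cart: "(\<Sum>b\<in>(Basis :: (real ^ 'n) set). f b) = (\<Sum>i\<in>UNIV. f (axis i 1))"
  unfolding Basis_cart by (subst sum.reindex) (auto simp: inj_on_def axis_eq_axis)

lemma nn_integral_lborel_cart_prod:
  fixes f :: "'n::finite \<Rightarrow> real \<Rightarrow> ennreal"
  assumes "\<And>i. f i \<in> borel_measurable borel"
  shows "(\<integral>\<^sup>+x. (\<Prod>i\<in>UNIV. f i (x $ i)) \<partial>lborel) = (\<Prod>i\<in>UNIV. \<integral>\<^sup>+u. f i u \<partial>lborel)"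
proof -
  have "(\<integral>\<^sup>+x. (\<Prod>b\<in>(Basis :: (real ^ 'n) set). f (axis_index b) (x \<bullet> b)) \<partial>lborel)
      = (\<Prod>b\<in>(Basis :: (real ^ 'n) set). \<integral>\<^sup>+u. f (axis_index b) u \<partial>lborel)"
    using assms by (intro nn_integral_lborel_prod) auto
  then show ?thesis by (simp add: prod_Basis_cart inner_axis axis_index_axis)
qed

text \<open>With all coordinates but the \<open>i\<close>-th fixed, a shear is a translation of the \<open>i\<close>-th one.\<close>

lemma nn_integral_lborel_shear:
  fixes g :: "'a::euclidean_space \<Rightarrow> ennreal"
  assumes ij: "i \<in> Basis" "j \<in> Basis" "i \<noteq> j" and g[measurable]: "g \<in> borel_measurable borel"
  shows "(\<integral>\<^sup>+x. g (x + (c * (x \<bullet> j)) *\<^sub>R i) \<partial>lborel) = (\<integral>\<^sup>+x. g x \<partial>lborel)"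
proof -
  interpret L: product_sigma_finite "\<lambda>_::'a. lborel :: real measure" ..
  let ?B = "Basis :: 'a set" let ?C = "?B - {i}"
  let ?v = "\<lambda>f. \<Sum>b\<in>?B. f b *\<^sub>R b"
  let ?P = "\<Pi>\<^sub>M b\<in>?B. lborel :: real measure" let ?Q = "\<Pi>\<^sub>M b\<in>?C. lborel :: real measure"
  have ins: "insert i ?C = ?B" using ij by auto
  have [measurable]: "?v \<in> borel_measurable ?P" by measurable
  have inner: "?v f \<bullet> b = f b" if "b \<in> ?B" for f b
    using that by (simp add: inner_sum_left_Basis)
  have upd: "?v (f(i := u)) = ?v f + (u - f i) *\<^sub>R i" for f u
  proof (rule euclidean_eqI)
    fix b :: 'a assume b: "b \<in> ?B"
    have "(?v f + (u - f i) *\<^sub>R i) \<bullet> b = f b + (u - f i) * (i \<bullet> b)"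
      by (simp only: inner_add_left inner_scaleR_left inner[OF b])
    then show "?v (f(i := u)) \<bullet> b = (?v f + (u - f i) *\<^sub>R i) \<bullet> b"
      using ij b by (simp only: inner[OF b]) (simp add: inner_Basis)
  qed
  have split: "(\<integral>\<^sup>+x. k x \<partial>lborel) = (\<integral>\<^sup>+f. \<integral>\<^sup>+u. k (?v (f(i := u))) \<partial>lborel \<partial>?Q)"
    if k[measurable]: "k \<in> borel_measurable borel" for k :: "'a \<Rightarrow> ennreal"
  proof -
    have "(\<integral>\<^sup>+x. k x \<partial>lborel) = (\<integral>\<^sup>+f. k (?v f) \<partial>?P)"
      by (subst lborel_eq) (simp add: nn_integral_distr)
    also have "\<dots> = (\<integral>\<^sup>+f. k (?v f) \<partial>(\<Pi>\<^sub>M b\<in>insert i ?C. lborel))" by (simp only: ins)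
    also have "\<dots> = (\<integral>\<^sup>+f. \<integral>\<^sup>+u. k (?v (f(i := u))) \<partial>lborel \<partial>?Q)"
      by (rule L.product_nn_integral_insert) (simp, simp, simp only: ins, measurable)
    finally show ?thesis .
  qed
  have shift: "?v (f(i := u)) + (c * (?v (f(i := u)) \<bullet> j)) *\<^sub>R i = ?v (f(i := c * f j + 1 * u))" for f u
  proof -
    have "?v (f(i := u)) \<bullet> j = f j" by (simp only: inner[OF ij(2)] fun_upd_other[OF ij(3)[symmetric]])
    then have "?v (f(i := u)) + (c * (?v (f(i := u)) \<bullet> j)) *\<^sub>R i = ?v (f(i := u)) + (c * f j) *\<^sub>R i"
      by (simp only:)
    then show ?thesis unfolding upd by (simp add: algebra_simps)
  qed
  have "(\<integral>\<^sup>+x. g (x + (c * (x \<bullet> j)) *\<^sub>R i) \<partial>lborel)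
      = (\<integral>\<^sup>+f. \<integral>\<^sup>+u. g (?v (f(i := u)) + (c * (?v (f(i := u)) \<bullet> j)) *\<^sub>R i) \<partial>lborel \<partial>?Q)"
    by (rule split) measurable
  also have "\<dots> = (\<integral>\<^sup>+f. \<integral>\<^sup>+u. g (?v (f(i := c * f j + 1 * u))) \<partial>lborel \<partial>?Q)"
    by (simp only: shift)
  also have "\<dots> = (\<integral>\<^sup>+f. \<integral>\<^sup>+u. g (?v (f(i := u))) \<partial>lborel \<partial>?Q)"
  proof (rule nn_integral_cong)
    fix f
    have "(\<lambda>u. g (?v (f(i := u)))) \<in> borel_measurable borel" unfolding upd by measurable
    from nn_integral_real_affine[OF this, of 1 "c * f j"]
    show "(\<integral>\<^sup>+u. g (?v (f(i := c * f j + 1 * u))) \<partial>lborel) = (\<integral>\<^sup>+u. g (?v (f(i := u))) \<partial>lborel)"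
      by simp
  qed
  also have "\<dots> = (\<integral>\<^sup>+x. g x \<partial>lborel)" by (rule split[symmetric]) measurable
  finally show ?thesis .
qed

lemma lborel_permute_coordinates:
  fixes \<pi> :: "'n::finite \<Rightarrow> 'n"
  assumes \<pi>: "\<pi> permutes UNIV"
  shows "distr lborel borel (\<lambda>x :: real ^ 'n. \<chi> i. x $ \<pi> i) = lborel"
proof (rule sym, rule lborel_eqI)
  let ?T = "\<lambda>x :: real ^ 'n. \<chi> i. x $ \<pi> i" and ?S = "\<lambda>x :: real ^ 'n. \<chi> i. x $ inv \<pi> i"
  have [measurable]: "?T \<in> borel_measurable borel"
    by (intro borel_measurable_continuous_onI continuous_intros)
  fix l u :: "real ^ 'n" assume le: "\<And>b. b \<in> Basis \<Longrightarrow> l \<bullet> b \<le> u \<bullet> b"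
  then have le': "l $ i \<le> u $ i" for i using le[of "axis i 1"] by (simp add: inner_axis)
  have pre: "?T -` box l u = box (?S l) (?S u)"
  proof -
    have "(\<forall>i. l $ i < x $ \<pi> i \<and> x $ \<pi> i < u $ i) \<longleftrightarrow>
        (\<forall>i. l $ inv \<pi> i < x $ i \<and> x $ i < u $ inv \<pi> i)" for x :: "real ^ 'n"
      using permutes_inverses[OF \<pi>] by metis
    then show ?thesis by (auto simp: mem_box_cart)
  qed
  have "emeasure (distr lborel borel ?T) (box l u) = emeasure lborel (box (?S l) (?S u))"
    by (simp add: emeasure_distr pre)
  also have "\<dots> = (\<Prod>b\<in>Basis. (?S u - ?S l) \<bullet> b)"
    using le' by (intro emeasure_lborel_box) (auto simp: Basis_cart inner_axis)
  also have "(\<Prod>b\<in>Basis. (?S u - ?S l) \<bullet> b) = (\<Prod>i\<in>UNIV. (\<lambda>i. u $ i - l $ i) (inv \<pi> i))"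
    by (simp add: prod_Basis_cart inner_axis)
  also have "\<dots> = (\<Prod>i\<in>UNIV. u $ i - l $ i)"
    using prod.permute[OF permutes_inv[OF \<pi>], of "\<lambda>i. u $ i - l $ i"] by (simp add: o_def)
  also have "\<dots> = (\<Prod>b\<in>Basis. (u - l) \<bullet> b)" by (simp add: prod_Basis_cart inner_axis)
  finally show "emeasure (distr lborel borel ?T) (box l u) = (\<Prod>b\<in>Basis. (u - l) \<bullet> b)" .
qed simp

lemma borel_measurable_matrix_vector[measurable (raw)]:
  fixes A :: "real ^ 'n ^ 'm"
  assumes [measurable]: "f \<in> borel_measurable M"
  shows "(\<lambda>x. A *v f x) \<in> borel_measurable M"
proof -
  have "(\<lambda>v. A *v v) \<in> borel_measurable borel"
    by (intro borel_measurable_continuous_onI linear_continuous_on)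
       (simp add: linear_conv_bounded_linear[symmetric] matrix_vector_mul_linear)
  then show ?thesis by measurable
qed

text \<open>An invertible matrix is a product of elementary ones. Diagonal matrices rescale the
  coordinates, transpositions permute them, and the remaining elementary matrices are shears.\<close>

proposition nn_integral_lborel_matrix:
  fixes A :: "real ^ 'n ^ 'n"
  assumes "det A \<noteq> 0" and "g \<in> borel_measurable borel"
  shows "(\<integral>\<^sup>+x. g x \<partial>lborel) = ennreal \<bar>det A\<bar> * (\<integral>\<^sup>+x. g (A *v x) \<partial>lborel)"
proof -
  have "det A \<noteq> 0 \<longrightarrow> (\<forall>g\<in>borel_measurable borel.
    (\<integral>\<^sup>+x. g x \<partial>lborel) = ennreal \<bar>det A\<bar> * (\<integral>\<^sup>+x. g (A *v x) \<partial>lborel))"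
  proof (induction A rule: induct_matrix_elementary_alt)
    fix A B :: "real ^ 'n ^ 'n"
    assume A: "det A \<noteq> 0 \<longrightarrow> (\<forall>g\<in>borel_measurable borel.
        (\<integral>\<^sup>+x. g x \<partial>lborel) = ennreal \<bar>det A\<bar> * (\<integral>\<^sup>+x. g (A *v x) \<partial>lborel))"
      and B: "det B \<noteq> 0 \<longrightarrow> (\<forall>g\<in>borel_measurable borel.
        (\<integral>\<^sup>+x. g x \<partial>lborel) = ennreal \<bar>det B\<bar> * (\<integral>\<^sup>+x. g (B *v x) \<partial>lborel))"
    show "det (A ** B) \<noteq> 0 \<longrightarrow> (\<forall>g\<in>borel_measurable borel.
        (\<integral>\<^sup>+x. g x \<partial>lborel) = ennreal \<bar>det (A ** B)\<bar> * (\<integral>\<^sup>+x. g ((A ** B) *v x) \<partial>lborel))"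
    proof (intro impI ballI)
      fix g :: "real ^ 'n \<Rightarrow> ennreal"
      assume "det (A ** B) \<noteq> 0" and g[measurable]: "g \<in> borel_measurable borel"
      then have d: "det A \<noteq> 0" "det B \<noteq> 0" by (auto simp: det_mul)
      have gA: "(\<lambda>x. g (A *v x)) \<in> borel_measurable borel" by measurable
      show "(\<integral>\<^sup>+x. g x \<partial>lborel) = ennreal \<bar>det (A ** B)\<bar> * (\<integral>\<^sup>+x. g ((A ** B) *v x) \<partial>lborel)"
        using A[rule_format, OF d(1) g] B[rule_format, OF d(2) gA]
        by (simp add: det_mul abs_mult ennreal_mult matrix_vector_mul_assoc mult.assoc)
    qed
  next
    fix A :: "real ^ 'n ^ 'n" and i assume "row i A = 0"
    then have "det A = 0" by (rule det_zero_row)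
    then show "det A \<noteq> 0 \<longrightarrow> (\<forall>g\<in>borel_measurable borel.
        (\<integral>\<^sup>+x. g x \<partial>lborel) = ennreal \<bar>det A\<bar> * (\<integral>\<^sup>+x. g (A *v x) \<partial>lborel))" by simp
  next
    fix A :: "real ^ 'n ^ 'n" assume diag: "\<And>i j. i \<noteq> j \<Longrightarrow> A $ i $ j = 0"
    show "det A \<noteq> 0 \<longrightarrow> (\<forall>g\<in>borel_measurable borel.
        (\<integral>\<^sup>+x. g x \<partial>lborel) = ennreal \<bar>det A\<bar> * (\<integral>\<^sup>+x. g (A *v x) \<partial>lborel))"
    proof (intro impI ballI)
      fix g :: "real ^ 'n \<Rightarrow> ennreal"
      assume "det A \<noteq> 0" and g[measurable]: "g \<in> borel_measurable borel"
      have detA: "det A = (\<Prod>i\<in>UNIV. A $ i $ i)" using diag by (rule det_diagonal)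
      define c where "c b = A $ axis_index b $ axis_index b" for b :: "real ^ 'n"
      have c: "c b \<noteq> 0" if "b \<in> Basis" for b
        using \<open>det A \<noteq> 0\<close> by (auto simp: detA c_def)
      have Av: "A *v x = 0 + (\<Sum>j\<in>Basis. (c j * (x \<bullet> j)) *\<^sub>R j)" for x
      proof -
        have "(A *v x) $ i = A $ i $ i * x $ i" for i
        proof -
          have "(A *v x) $ i = (\<Sum>j\<in>UNIV. A $ i $ j * x $ j)" by (simp add: matrix_vector_mult_def)
          also have "\<dots> = (\<Sum>j\<in>UNIV. if j = i then A $ i $ i * x $ i else 0)"
            by (intro sum.cong) (auto simp: diag)
          finally show ?thesis by simp
        qed
        then show ?thesis
          by (simp add: vec_eq_iff sum_Basis_cart c_def axis_index_axis inner_axis)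
             (simp add: axis_def if_distrib cong: if_cong)
      qed
      have "(\<integral>\<^sup>+x. g x \<partial>lborel) = (\<integral>\<^sup>+x. g x \<partial>density (distr lborel borel (\<lambda>x. A *v x)) (\<lambda>_. (\<Prod>j\<in>Basis. \<bar>c j\<bar>)))"
        unfolding Av using c by (subst lborel_affine_euclidean[of c 0]) auto
      also have "\<dots> = (\<Prod>j\<in>Basis. \<bar>c j\<bar>) * (\<integral>\<^sup>+x. g (A *v x) \<partial>lborel)"
        by (simp add: nn_integral_density nn_integral_distr nn_integral_cmult)
      also have "(\<Prod>j\<in>Basis. \<bar>c j\<bar>) = \<bar>det A\<bar>"
        by (simp add: detA prod_Basis_cart c_def axis_index_axis abs_prod)
      finally show "(\<integral>\<^sup>+x. g x \<partial>lborel) = ennreal \<bar>det A\<bar> * (\<integral>\<^sup>+x. g (A *v x) \<partial>lborel)" .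
    qed
  next
    fix m n :: 'n assume mn: "m \<noteq> n"
    let ?A = "\<chi> i j. mat 1 $ i $ Transposition.transpose m n j :: real ^ 'n ^ 'n"
    have Av: "?A *v x = (\<chi> i. x $ Transposition.transpose m n i)" for x
    proof -
      have "(?A *v x) $ i = x $ Transposition.transpose m n i" for i
      proof -
        have "(?A *v x) $ i = (\<Sum>j\<in>UNIV. (if i = Transposition.transpose m n j then 1 else 0) * x $ j)"
          by (simp add: matrix_vector_mult_def mat_def)
        also have "\<dots> = (\<Sum>j\<in>UNIV. if j = Transposition.transpose m n i then x $ j else 0)"
          by (intro sum.cong) auto
        finally show ?thesis by simp
      qed
      then show ?thesis by (simp add: vec_eq_iff)
    qed
    have perm: "Transposition.transpose m n permutes UNIV" by (rule permutes_swap_id) auto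
    have "det ?A = of_int (sign (Transposition.transpose m n)) * det (mat 1 :: real ^ 'n ^ 'n)"
      using perm by (rule det_permute_columns)
    then have det: "\<bar>det ?A\<bar> = 1" using mn by (simp add: sign_swap_id)
    show "det ?A \<noteq> 0 \<longrightarrow> (\<forall>g\<in>borel_measurable borel.
        (\<integral>\<^sup>+x. g x \<partial>lborel) = ennreal \<bar>det ?A\<bar> * (\<integral>\<^sup>+x. g (?A *v x) \<partial>lborel))"
    proof (intro impI ballI)
      fix g :: "real ^ 'n \<Rightarrow> ennreal" assume g[measurable]: "g \<in> borel_measurable borel"
      have m: "(\<lambda>x :: real ^ 'n. \<chi> i. x $ Transposition.transpose m n i) \<in> borel_measurable borel"
        by (intro borel_measurable_continuous_onI continuous_intros)
      show "(\<integral>\<^sup>+x. g x \<partial>lborel) = ennreal \<bar>det ?A\<bar> * (\<integral>\<^sup>+x. g (?A *v x) \<partial>lborel)"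
        unfolding Av det using m
        by (subst lborel_permute_coordinates[OF perm, symmetric]) (simp add: nn_integral_distr)
    qed
  next
    fix m n :: 'n assume mn: "m \<noteq> n"
    let ?A = "\<chi> i j. of_bool (i = m \<and> j = n \<or> i = j) :: real ^ 'n ^ 'n"
    have Av: "?A *v x = x + (1 * (x \<bullet> axis n 1)) *\<^sub>R axis m 1" for x
    proof -
      have "(?A *v x) $ i = (\<Sum>j\<in>UNIV. of_bool (i = m \<and> j = n \<or> i = j) * x $ j)" for i
        by (simp add: matrix_vector_mult_def)
      also have "\<dots> i = (\<Sum>j\<in>UNIV. (if j = i then x $ j else 0) + (if j = n then (if i = m then x $ n else 0) else 0))" for i
        using mn by (intro sum.cong) auto
      finally have comp: "(?A *v x) $ i = x $ i + (if i = m then x $ n else 0)" for i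
        by (simp add: sum.distrib)
      have "x \<bullet> axis n 1 = x $ n" by (simp add: inner_axis)
      moreover have "axis m (1::real) $ i = (if i = m then 1 else 0)" for i by (simp add: axis_def)
      ultimately have "(x + (1 * (x \<bullet> axis n 1)) *\<^sub>R axis m 1) $ i = x $ i + (if i = m then x $ n else 0)" for i
        by simp
      then show ?thesis by (simp only: vec_eq_iff comp) simp
    qed
    have "det ?A = det ((\<chi> k. if k = m then row m (mat 1) + 1 *s row n (mat 1) else row k (mat 1)) :: real ^ 'n ^ 'n)"
      using mn by (intro arg_cong[of _ _ det]) (auto simp: vec_eq_iff row_def mat_def)
    also have "\<dots> = det (mat 1 :: real ^ 'n ^ 'n)" using mn by (rule det_row_operation)
    finally have det: "det ?A = 1" by simp
    show "det ?A \<noteq> 0 \<longrightarrow> (\<forall>g\<in>borel_measurable borel.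
        (\<integral>\<^sup>+x. g x \<partial>lborel) = ennreal \<bar>det ?A\<bar> * (\<integral>\<^sup>+x. g (?A *v x) \<partial>lborel))"
    proof (intro impI ballI)
      fix g :: "real ^ 'n \<Rightarrow> ennreal" assume "g \<in> borel_measurable borel"
      then have "(\<integral>\<^sup>+x. g (x + (1 * (x \<bullet> axis n 1)) *\<^sub>R axis m 1) \<partial>lborel) = (\<integral>\<^sup>+x. g x \<partial>lborel)"
        using mn by (intro nn_integral_lborel_shear) (auto simp: Basis_cart axis_eq_axis)
      then show "(\<integral>\<^sup>+x. g x \<partial>lborel) = ennreal \<bar>det ?A\<bar> * (\<integral>\<^sup>+x. g (?A *v x) \<partial>lborel)"
        unfolding Av det by simp
    qed
  qed
  with assms show ?thesis by blast
qed

lemma matrix_inv_unique: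
  fixes A B :: "real ^ 'n ^ 'n"
  assumes "A ** B = mat 1"
  shows "matrix_inv A = B"
proof -
  have BA: "B ** A = mat 1" using assms by (simp add: matrix_left_right_inverse)
  have "A ** matrix_inv A = mat 1 \<and> matrix_inv A ** A = mat 1"
    unfolding matrix_inv_def using assms BA by (intro someI_ex[of "\<lambda>A'. A ** A' = mat 1 \<and> A' ** A = mat 1"]) blast
  then have "B = B ** (A ** matrix_inv A)" by simp
  also have "\<dots> = matrix_inv A" by (simp add: matrix_mul_assoc BA)
  finally show ?thesis ..
qed

lemma matrix_inv_det_nz:
  fixes A :: "real ^ 'n ^ 'n"
  assumes "det A \<noteq> 0"
  shows "A ** matrix_inv A = mat 1" and "matrix_inv A ** A = mat 1"
    and "matrix_inv (matrix_inv A) = A" and "det (matrix_inv A) = 1 / det A"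
proof -
  obtain B where "A ** B = mat 1"
    using assms invertible_det_nz[of A] unfolding invertible_def by blast
  then show 1: "A ** matrix_inv A = mat 1" by (simp add: matrix_inv_unique)
  then show 2: "matrix_inv A ** A = mat 1" by (simp add: matrix_left_right_inverse)
  then show "matrix_inv (matrix_inv A) = A" by (rule matrix_inv_unique)
  have "det A * det (matrix_inv A) = 1" using 1 by (metis det_I det_mul)
  then show "det (matrix_inv A) = 1 / det A" using assms by (simp add: field_simps)
qed

lemma symmetric_matrix_inner:
  fixes A :: "real ^ 'n ^ 'n"
  assumes "transpose A = A"
  shows "u \<bullet> (A *v v) = v \<bullet> (A *v u)"
  using assms by (metis dot_lmul_matrix inner_commute vector_transpose_matrix)

text \<open>The columns of \<open>M\<close> are an orthonormal basis for the inner product \<open>u \<bullet> A v\<close>. It is built by the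
  Gram-Schmidt process, one column for each index of the type.\<close>

lemma pos_def_orthonormal_frame:
  fixes A :: "real ^ 'n ^ 'n"
  assumes A: "pos_def_matrix A"
  shows "\<exists>M :: real ^ 'n ^ 'n. transpose M ** A ** M = mat 1"
proof -
  have sym: "u \<bullet> (A *v v) = v \<bullet> (A *v u)" for u v
    using A by (intro symmetric_matrix_inner) (simp add: pos_def_matrix_def)
  have pos: "0 < v \<bullet> (A *v v)" if "v \<noteq> 0" for v using A that by (simp add: pos_def_matrix_def)
  have "\<exists>f :: 'n \<Rightarrow> real ^ 'n. \<forall>i\<in>K. \<forall>j\<in>K. f i \<bullet> (A *v f j) = (if i = j then 1 else 0)" for K
  proof (induction K rule: finite_induct[OF finite])
    case (2 k K)
    then obtain f :: "'n \<Rightarrow> real ^ 'n"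
      where f: "\<And>i j. i \<in> K \<Longrightarrow> j \<in> K \<Longrightarrow> f i \<bullet> (A *v f j) = (if i = j then 1 else 0)" by blast
    have "dim (f ` K) \<le> card (f ` K)" by (rule dim_le_card') simp
    also have "\<dots> \<le> card K" by (rule card_image_le) simp
    also have "\<dots> < CARD('n)"
      using 2(2) by (intro psubset_card_mono) auto
    finally have "dim (f ` K) \<noteq> dim (UNIV :: (real ^ 'n) set)" by simp
    then have "span (f ` K) \<noteq> UNIV" by (metis dim_span)
    (* fewer than CARD('n) vectors do not span, so there is a direction left to orthogonalize *)
    then obtain v where v: "v \<notin> span (f ` K)" by auto
    define w where "w = v - (\<Sum>i\<in>K. (v \<bullet> (A *v f i)) *\<^sub>R f i)"
    have "(\<Sum>i\<in>K. (v \<bullet> (A *v f i)) *\<^sub>R f i) \<in> span (f ` K)"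
      by (intro span_sum span_scale span_base) auto
    then have "w \<noteq> 0" using v by (auto simp: w_def)
    then have ww: "0 < w \<bullet> (A *v w)" by (rule pos)
    have wf: "w \<bullet> (A *v f j) = 0" if "j \<in> K" for j
    proof -
      have "(\<Sum>i\<in>K. (v \<bullet> (A *v f i)) * (f i \<bullet> (A *v f j))) = (\<Sum>i\<in>K. if i = j then v \<bullet> (A *v f j) else 0)"
        using f that by (intro sum.cong) auto
      then show ?thesis using that by (simp add: w_def inner_diff_left inner_sum_left)
    qed
    define c where "c = 1 / sqrt (w \<bullet> (A *v w))"
    have c: "c * (c * (w \<bullet> (A *v w))) = 1" using ww by (simp add: c_def)
    have fw: "f j \<bullet> (A *v w) = 0" if "j \<in> K" for j using wf[OF that] sym[of "f j" w] by simp
    define g where "g = f(k := c *\<^sub>R w)"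
    have gk: "g k = c *\<^sub>R w" and gK: "\<And>i. i \<in> K \<Longrightarrow> g i = f i" using 2(2) by (auto simp: g_def)
    have "g i \<bullet> (A *v g j) = (if i = j then 1 else 0)" if "i \<in> insert k K" "j \<in> insert k K" for i j
    proof (cases "i = k"; cases "j = k")
      assume "i = k" "j = k"
      then show ?thesis using c by (simp add: gk matrix_vector_mult_scaleR)
    next
      assume "i = k" "j \<noteq> k"
      then show ?thesis using that by (simp add: gk gK wf)
    next
      assume "i \<noteq> k" "j = k"
      then show ?thesis using that by (simp add: gk gK fw matrix_vector_mult_scaleR)
    next
      assume "i \<noteq> k" "j \<noteq> k"
      then show ?thesis using that by (simp add: gK f)
    qed
    then show ?case by blast
  qed simp
  from this[of UNIV] obtain f :: "'n \<Rightarrow> real ^ 'n"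
    where f: "\<And>i j. f i \<bullet> (A *v f j) = (if i = j then 1 else 0)" by blast
  define M :: "real ^ 'n ^ 'n" where "M = (\<chi> r c. f c $ r)"
  have "(transpose M ** A ** M) $ i $ j = f i \<bullet> (A *v f j)" for i j
  proof -
    have "(transpose M ** (A ** M)) $ i $ j = (\<Sum>k\<in>UNIV. f i $ k * (\<Sum>l\<in>UNIV. A $ k $ l * f j $ l))"
      by (simp add: matrix_matrix_mult_def transpose_def M_def)
    then show ?thesis by (simp add: matrix_mul_assoc inner_vec_def matrix_vector_mult_def)
  qed
  then show ?thesis by (intro exI[of _ M]) (simp add: vec_eq_iff f mat_def)
qed

lemma pos_def_det:
  fixes A :: "real ^ 'n ^ 'n"
  assumes "pos_def_matrix A"
  shows "0 < det A"
proof -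
  obtain M :: "real ^ 'n ^ 'n" where M: "transpose M ** A ** M = mat 1" using pos_def_orthonormal_frame[OF assms] by blast
  have "det M * det A * det M = 1" using arg_cong[OF M, of det] by (simp add: det_mul)
  then have "det A * (det M)\<^sup>2 = 1" by (simp add: power2_eq_square mult_ac)
  then show ?thesis using mult_nonpos_nonneg[of "det A" "(det M)\<^sup>2"] by (cases "0 < det A") auto
qed

lemma nn_integral_std_gaussian:
  "(\<integral>\<^sup>+x. ennreal (exp (- (x \<bullet> x) / 2)) \<partial>(lborel :: (real ^ 'n) measure)) = ennreal (sqrt ((2 * pi) ^ CARD('n)))"
proof -
  have one: "(\<integral>\<^sup>+u. ennreal (exp (- u\<^sup>2 / 2)) \<partial>lborel) = ennreal (sqrt (2 * pi))"
  proof -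
    interpret N: prob_space "density lborel std_normal_density"
      by (rule prob_space_normal_density) simp
    have "(\<integral>\<^sup>+u. ennreal (std_normal_density u) \<partial>lborel) = 1"
      using N.emeasure_space_1 by (simp add: emeasure_density)
    moreover have "(\<integral>\<^sup>+u. ennreal (exp (- u\<^sup>2 / 2)) \<partial>lborel)
        = (\<integral>\<^sup>+u. ennreal (sqrt (2 * pi)) * ennreal (std_normal_density u) \<partial>lborel)"
      by (intro nn_integral_cong) (simp add: std_normal_density_def flip: ennreal_mult)
    ultimately show ?thesis by (simp add: nn_integral_cmult)
  qed
  have "ennreal (exp (- (x \<bullet> x) / 2)) = (\<Prod>i\<in>UNIV. ennreal (exp (- (x $ i)\<^sup>2 / 2)))" for x :: "real ^ 'n"
    by (simp add: prod_ennreal exp_sum[symmetric] inner_vec_def power2_eq_square sum_divide_distrib sum_negf)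
  then have "(\<integral>\<^sup>+x. ennreal (exp (- (x \<bullet> x) / 2)) \<partial>(lborel :: (real ^ 'n) measure))
      = (\<Prod>i\<in>(UNIV :: 'n set). \<integral>\<^sup>+u. ennreal (exp (- u\<^sup>2 / 2)) \<partial>lborel)"
    using nn_integral_lborel_cart_prod[of "\<lambda>(_::'n) u. ennreal (exp (- u\<^sup>2 / 2))"] by simp
  then have "(\<integral>\<^sup>+x. ennreal (exp (- (x \<bullet> x) / 2)) \<partial>(lborel :: (real ^ 'n) measure))
      = ennreal (sqrt (2 * pi)) ^ CARD('n)" by (simp only: one prod_constant)
  also have "\<dots> = ennreal (sqrt (2 * pi) ^ CARD('n))" by (simp add: ennreal_power)
  finally show ?thesis by (simp only: real_sqrt_power)
qed

text \<open>In the coordinates of an \<open>A\<close>-orthonormal frame \<open>M\<close> the quadratic form is the squared norm, and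
  \<open>M\<^sup>T A M = 1\<close> gives \<open>(det M)\<^sup>2 = 1 / det A\<close>.\<close>

lemma nn_integral_gaussian:
  fixes A :: "real ^ 'n ^ 'n"
  assumes A: "pos_def_matrix A"
  shows "(\<integral>\<^sup>+x. ennreal (exp (- ((x - \<nu>) \<bullet> (A *v (x - \<nu>))) / 2)) \<partial>lborel)
    = ennreal (sqrt ((2 * pi) ^ CARD('n) / det A))"
proof -
  obtain M :: "real ^ 'n ^ 'n" where M: "transpose M ** A ** M = mat 1" using pos_def_orthonormal_frame[OF A] by blast
  have "det M * det A * det M = 1" using arg_cong[OF M, of det] by (simp add: det_mul)
  then have d: "det M \<noteq> 0" "(det M)\<^sup>2 = 1 / det A" using pos_def_det[OF A]
    by (auto simp: power2_eq_square field_simps)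
  have q: "(M *v u) \<bullet> (A *v (M *v u)) = u \<bullet> u" for u
  proof -
    have "(M *v u) \<bullet> (A *v (M *v u)) = u \<bullet> (transpose M *v (A *v (M *v u)))"
      by (metis dot_lmul_matrix inner_commute vector_transpose_matrix)
    also have "\<dots> = u \<bullet> ((transpose M ** A ** M) *v u)" by (simp add: matrix_vector_mul_assoc matrix_mul_assoc)
    finally show ?thesis by (simp add: M)
  qed
  have "(\<integral>\<^sup>+x. ennreal (exp (- ((x - \<nu>) \<bullet> (A *v (x - \<nu>))) / 2)) \<partial>lborel)
      = (\<integral>\<^sup>+x. ennreal (exp (- (x \<bullet> (A *v x)) / 2)) \<partial>lborel)"
  proof -
    have "(\<integral>\<^sup>+x. ennreal (exp (- (x \<bullet> (A *v x)) / 2)) \<partial>lborel)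
      = (\<integral>\<^sup>+x. ennreal (exp (- (x \<bullet> (A *v x)) / 2)) \<partial>distr lborel borel ((+) (- \<nu>)))"
      by (simp add: lborel_distr_plus)
    then show ?thesis by (subst (asm) nn_integral_distr) auto
  qed
  also have "\<dots> = ennreal \<bar>det M\<bar> * (\<integral>\<^sup>+u. ennreal (exp (- (u \<bullet> u) / 2)) \<partial>(lborel :: (real ^ 'n) measure))"
    by (subst nn_integral_lborel_matrix[OF d(1)]) (simp_all add: q)
  also have "\<dots> = ennreal (\<bar>det M\<bar> * sqrt ((2 * pi) ^ CARD('n)))"
    by (simp only: nn_integral_std_gaussian) (simp add: ennreal_mult)
  also have "\<bar>det M\<bar> = sqrt (1 / det A)" using d(2) by (metis real_sqrt_abs)
  finally show ?thesis by (simp add: real_sqrt_mult[symmetric] del: real_sqrt_mult)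
qed

lemma mvn_density_of_precision:
  fixes A :: "real ^ 'n ^ 'n"
  assumes A: "pos_def_matrix A"
  shows "mvn_density \<nu> (matrix_inv A) b =
    exp (- ((b - \<nu>) \<bullet> (A *v (b - \<nu>))) / 2) / sqrt ((2 * pi) ^ CARD('n) / det A)"
  using pos_def_det[OF A] by (simp add: mvn_density_def matrix_inv_det_nz)

lemma nn_integral_mvn_density:
  fixes A :: "real ^ 'n ^ 'n"
  assumes A: "pos_def_matrix A"
  shows "(\<integral>\<^sup>+b. ennreal (mvn_density \<nu> (matrix_inv A) b) \<partial>lborel) = 1"
proof -
  define N where "N = sqrt ((2 * pi) ^ CARD('n) / det A)"
  have N: "0 < N" using pos_def_det[OF A] by (simp add: N_def)
  have "(\<integral>\<^sup>+b. ennreal (mvn_density \<nu> (matrix_inv A) b) \<partial>lborel)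
      = (\<integral>\<^sup>+b. ennreal (1 / N) * ennreal (exp (- ((b - \<nu>) \<bullet> (A *v (b - \<nu>))) / 2)) \<partial>lborel)"
    unfolding mvn_density_of_precision[OF A] N_def[symmetric]
    using N by (intro nn_integral_cong) (simp flip: ennreal_mult)
  also have "\<dots> = ennreal (1 / N) * ennreal N"
    by (subst nn_integral_cmult, measurable) (simp only: nn_integral_gaussian[OF A, folded N_def])
  also have "\<dots> = 1" using N by (simp flip: ennreal_mult)
  finally show ?thesis .
qed

text \<open>The exact value is the dimension, but any bound that is uniform in \<open>A\<close> serves the same purpose. By
  \<open>t \<le> 4 exp (t / 4)\<close> the integrand is at most a multiple of the density with precision \<open>A / 2\<close>, so
  only normalizing constants are needed.\<close>

lemma mvn_mean_quadratic_form_le: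
  fixes A :: "real ^ 'n ^ 'n"
  assumes A: "pos_def_matrix A"
  shows "(\<integral>\<^sup>+b. ennreal ((b - \<nu>) \<bullet> (A *v (b - \<nu>))) * ennreal (mvn_density \<nu> (matrix_inv A) b) \<partial>lborel)
    \<le> ennreal (4 * sqrt (2 ^ CARD('n)))"
proof -
  define N where "N = sqrt ((2 * pi) ^ CARD('n) / det A)"
  have N: "0 < N" using pos_def_det[OF A] by (simp add: N_def)
  define H where "H = (1 / 2) *\<^sub>R A"
  have Hv: "x \<bullet> (H *v x) = (x \<bullet> (A *v x)) / 2" for x
    by (simp add: H_def scaleR_matrix_vector_assoc[symmetric])
  have H: "pos_def_matrix H"
    using A unfolding pos_def_matrix_def Hv by (auto simp: H_def transpose_def vec_eq_iff)
  have "H = (\<chi> i. (1 / 2) *s A $ i)" by (simp add: H_def vec_eq_iff)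
  then have "det H = (1 / 2) ^ CARD('n) * det A"
    using det_rows_mul[of "\<lambda>_. 1 / 2" "\<lambda>i. A $ i"] by simp
  then have "(2 * pi) ^ CARD('n) / det H = 2 ^ CARD('n) * ((2 * pi) ^ CARD('n) / det A)"
    by (simp add: power_one_over)
  then have NH: "sqrt ((2 * pi) ^ CARD('n) / det H) = sqrt (2 ^ CARD('n)) * N"
    by (simp only: N_def real_sqrt_mult)
  have "(\<integral>\<^sup>+b. ennreal ((b - \<nu>) \<bullet> (A *v (b - \<nu>))) * ennreal (mvn_density \<nu> (matrix_inv A) b) \<partial>lborel)
      \<le> (\<integral>\<^sup>+b. ennreal (4 / N) * ennreal (exp (- ((b - \<nu>) \<bullet> (H *v (b - \<nu>))) / 2)) \<partial>lborel)"
  proof (rule nn_integral_mono)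
    fix b :: "real ^ 'n"
    define t where "t = (b - \<nu>) \<bullet> (A *v (b - \<nu>))"
    have "0 \<le> t" using A by (cases "b = \<nu>") (auto simp: t_def pos_def_matrix_def less_imp_le)
    have "t \<le> 4 * exp (t / 4)" using exp_ge_add_one_self[of "t / 4"] by linarith
    then have "t * exp (- t / 2) \<le> 4 * exp (t / 4) * exp (- t / 2)" by (intro mult_right_mono) auto
    also have "\<dots> = 4 * exp (- (t / 2) / 2)" by (simp add: exp_add[symmetric])
    finally have "t * (exp (- t / 2) / N) \<le> 4 / N * exp (- (t / 2) / 2)"
      using N by (simp add: field_simps)
    then have "ennreal (t * (exp (- t / 2) / N)) \<le> ennreal (4 / N * exp (- (t / 2) / 2))"
      by (rule ennreal_leI)
    then show "ennreal ((b - \<nu>) \<bullet> (A *v (b - \<nu>))) * ennreal (mvn_density \<nu> (matrix_inv A) b)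
        \<le> ennreal (4 / N) * ennreal (exp (- ((b - \<nu>) \<bullet> (H *v (b - \<nu>))) / 2))"
      unfolding Hv mvn_density_of_precision[OF A] N_def[symmetric] t_def[symmetric]
      using N \<open>0 \<le> t\<close> by (simp add: ennreal_mult[symmetric])
  qed
  also have "\<dots> = ennreal (4 / N) * ennreal (sqrt (2 ^ CARD('n)) * N)"
    by (subst nn_integral_cmult, measurable) (simp only: NH[symmetric] nn_integral_gaussian[OF H])
  also have "\<dots> = ennreal (4 / N * (sqrt (2 ^ CARD('n)) * N))" using N by (subst ennreal_mult) auto
  also have "4 / N * (sqrt (2 ^ CARD('n)) * N) = 4 * sqrt (2 ^ CARD('n))" using N by simp
  finally show ?thesis .
qed

lemma pos_def_matrix_inv:
  fixes A :: "real ^ 'n ^ 'n"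
  assumes A: "pos_def_matrix A"
  shows "pos_def_matrix (matrix_inv A)"
  unfolding pos_def_matrix_def
proof (intro conjI allI impI)
  have d: "det A \<noteq> 0" using pos_def_det[OF A] by simp
  have tA: "transpose A = A" using A by (simp add: pos_def_matrix_def)
  have "A ** transpose (matrix_inv A) = transpose (matrix_inv A ** A)"
    by (simp add: matrix_transpose_mul tA)
  also have "\<dots> = mat 1" by (simp add: matrix_inv_det_nz[OF d] transpose_mat)
  finally show "transpose (matrix_inv A) = matrix_inv A" by (rule matrix_inv_unique[symmetric])
  fix v :: "real ^ 'n" assume "v \<noteq> 0"
  have v: "v = A *v (matrix_inv A *v v)"
    by (simp add: matrix_vector_mul_assoc matrix_inv_det_nz[OF d])
  then have "matrix_inv A *v v \<noteq> 0" using \<open>v \<noteq> 0\<close> by (metis matrix_vector_mult_0_right)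
  then have "0 < (matrix_inv A *v v) \<bullet> (A *v (matrix_inv A *v v))" using A by (simp add: pos_def_matrix_def)
  then show "0 < v \<bullet> (matrix_inv A *v v)" by (simp add: v[symmetric] inner_commute)
qed

lemma matrix_inv_Q:
  fixes z :: "real ^ 'm"
  assumes "\<And>i. 0 < z $ i"
  shows "matrix_inv (Q_matrix z) = (\<chi> i j. if i = j then z $ i else 0)"
proof (rule matrix_inv_unique)
  have "(Q_matrix z ** (\<chi> i j. if i = j then z $ i else 0)) $ i $ j = (mat 1 :: real ^ 'm ^ 'm) $ i $ j" for i j
  proof -
    have "(Q_matrix z ** (\<chi> i j. if i = j then z $ i else 0)) $ i $ j
        = (\<Sum>k\<in>UNIV. (if i = k then inverse (z $ i) else 0) * (if k = j then z $ k else 0))"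
      by (simp add: matrix_matrix_mult_def Q_matrix_def)
    also have "\<dots> = (\<Sum>k\<in>UNIV. if k = i then (if i = j then 1 else 0) else 0)"
      using assms[of i] by (intro sum.cong) auto
    finally show ?thesis by (simp add: mat_def)
  qed
  then show "Q_matrix z ** (\<chi> i j. if i = j then z $ i else 0) = mat 1" by (simp add: vec_eq_iff)
qed

lemma matrix_inv_Q_vector:
  fixes z :: "real ^ 'm"
  assumes "\<And>i. 0 < z $ i"
  shows "(matrix_inv (Q_matrix z) *v u) $ i = z $ i * u $ i"
proof -
  have "(matrix_inv (Q_matrix z) *v u) $ i = (\<Sum>j\<in>UNIV. (if i = j then z $ i else 0) * u $ j)"
    by (simp add: matrix_inv_Q[OF assms] matrix_vector_mult_def)
  also have "\<dots> = (\<Sum>j\<in>UNIV. if j = i then z $ i * u $ i else 0)" by (intro sum.cong) auto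
  finally show ?thesis by simp
qed

lemma inner_transpose_matrix:
  fixes A :: "real ^ 'n ^ 'm"
  shows "v \<bullet> (transpose A *v u) = (A *v v) \<bullet> u"
  by (metis dot_lmul_matrix inner_commute vector_transpose_matrix)

section \<open>Inverse gamma integrals\<close>

lemma nn_integral_pos_reals:
  "(\<integral>\<^sup>+u. f u \<partial>pos_reals) = (\<integral>\<^sup>+u. f u * indicator {0<..} u \<partial>lborel)"
  by (rule nn_integral_restrict_space) simp

text \<open>The substitution \<open>t = b / v\<close> turns the Gamma integral into this one.\<close>

lemma nn_integral_inv_gamma_density:
  assumes a: "0 < a" and b: "0 < b"
  shows "(\<integral>\<^sup>+v. ennreal (inv_gamma_density a b v) \<partial>pos_reals) = 1"
proof -
  let ?f = "\<lambda>t::real. t powr (a - 1) / exp t"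
  let ?k = "\<lambda>v::real. \<bar>- b / v\<^sup>2\<bar> * ?f (b / v)"
  have hasint: "(?f has_integral Gamma a) {0<..}"
    using Gamma_integral_real[OF a]
  proof (rule has_integral_spike_set_eq[THEN iffD1, rotated 2])
    show "negligible {x \<in> {0..} - {0<..}. ?f x \<noteq> 0}" by (rule negligible_subset[of "{0}"]) auto
    show "negligible {x \<in> {0<..} - {0..}. ?f x \<noteq> 0}" by (rule negligible_subset[of "{0}"]) auto
  qed
  then have abs: "?f absolutely_integrable_on {0<..}"
    by (intro nonnegative_absolutely_integrable_1) auto
  have img: "(\<lambda>v. b / v) ` {0<..} = {0<..}"
  proof (intro equalityI subsetI)
    fix t :: real assume "t \<in> {0<..}"
    then show "t \<in> (\<lambda>v. b / v) ` {0<..}" using b by (intro image_eqI[of _ _ "b / t"]) auto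
  qed (use b in auto)
  have "?k absolutely_integrable_on {0<..} \<and> integral {0<..} ?k = Gamma a"
    using b abs integral_unique[OF hasint]
    by (subst has_absolute_integral_change_of_variables_1'[where g = "\<lambda>v. b / v"])
       (auto intro!: derivative_eq_intros inj_onI simp: img power2_eq_square)
  then have k: "(?k has_integral Gamma a) {0<..}"
    using set_lebesgue_integral_eq_integral(1) by (metis integrable_integral)
  have ker: "inv_gamma_density a b v = 1 / Gamma a * ?k v" if v: "0 < v" for v
  proof -
    have "b powr a = b * b powr (a - 1)" using b by (simp add: powr_diff)
    moreover have "v powr (- a - 1) = 1 / v\<^sup>2 * (1 / v powr (a - 1))"
    proof -
      have "- a - 1 = (- 2) + (- (a - 1))" by simp
      then have "v powr (- a - 1) = v powr (- 2) * v powr (- (a - 1))" by (simp only: powr_add)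
      also have "v powr (- 2) = 1 / v\<^sup>2" using v by (simp add: powr_minus_divide)
      finally show ?thesis by (simp only: powr_minus_divide[of v "a - 1"])
    qed
    ultimately have "inv_gamma_density a b v
        = b * b powr (a - 1) / Gamma a * (1 / v\<^sup>2 * (1 / v powr (a - 1))) * exp (- b / v)"
      by (simp only: inv_gamma_density_def)
    moreover have "exp (- b / v) = 1 / exp (b / v)" by (simp add: exp_minus field_simps)
    moreover have "(b / v) powr (a - 1) = b powr (a - 1) / v powr (a - 1)"
      using v b by (simp add: powr_divide)
    ultimately show ?thesis using v b by simp
  qed
  have "(\<integral>\<^sup>+v. ennreal (inv_gamma_density a b v) \<partial>pos_reals)
      = (\<integral>\<^sup>+v. ennreal (1 / Gamma a) * ennreal (indicator {0<..} v * ?k v) \<partial>lborel)"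
    unfolding nn_integral_pos_reals using Gamma_real_pos[OF a]
    by (intro nn_integral_cong) (auto simp: ker ennreal_mult[symmetric] split: split_indicator)
  also have "\<dots> = ennreal (1 / Gamma a) * (\<integral>\<^sup>+v. ennreal (indicator {0<..} v * ?k v) \<partial>lborel)"
    by (rule nn_integral_cmult) measurable
  also have "(\<integral>\<^sup>+v. ennreal (indicator {0<..} v * ?k v) \<partial>lborel) = ennreal (Gamma a)"
    using k by (intro nn_integral_has_integral_lebesgue) auto
  also have "ennreal (1 / Gamma a) * ennreal (Gamma a) = 1"
    using Gamma_real_pos[OF a] by (simp flip: ennreal_mult)
  finally show ?thesis .
qed

lemma inv_gamma_density_pos: "0 < a \<Longrightarrow> 0 < b \<Longrightarrow> 0 < v \<Longrightarrow> 0 < inv_gamma_density a b v"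
  by (simp add: inv_gamma_density_def Gamma_real_pos)

lemma inv_gamma_density_measurable[measurable]: "inv_gamma_density a b \<in> borel_measurable borel"
  unfolding inv_gamma_density_def[abs_def] by measurable

lemma measurable_pos_reals_id: "f \<in> borel_measurable borel \<Longrightarrow> f \<in> borel_measurable pos_reals"
  by (intro measurable_restrict_space1) simp

text \<open>Multiplication by \<open>v\<close> lowers the shape parameter by one.\<close>

lemma inv_gamma_mean:
  assumes a: "1 < a" and b: "0 < b"
  shows "(\<integral>\<^sup>+v. ennreal (inv_gamma_density a b v) * ennreal v \<partial>pos_reals) = ennreal (b / (a - 1))"
proof -
  have shift: "inv_gamma_density a b v * v = b / (a - 1) * inv_gamma_density (a - 1) b v" if v: "0 < v" for v
  proof -
    have "a - 1 \<notin> \<int>\<^sub>\<le>\<^sub>0" using a nonpos_Ints_nonpos[of "a - 1"] by force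
    from Gamma_plus1[OF this] have "Gamma a = (a - 1) * Gamma (a - 1)" by simp
    moreover have "b powr a = b * b powr (a - 1)" using b by (simp add: powr_diff)
    moreover have "v powr (- a - 1) * v = v powr (- (a - 1) - 1)"
      using powr_add[of v "- a - 1" 1] v by simp
    moreover have "inv_gamma_density a b v * v = b powr a / Gamma a * (v powr (- a - 1) * v) * exp (- b / v)"
      by (simp add: inv_gamma_density_def)
    ultimately have "inv_gamma_density a b v * v
        = b * b powr (a - 1) / ((a - 1) * Gamma (a - 1)) * v powr (- (a - 1) - 1) * exp (- b / v)"
      by (simp only:)
    then show ?thesis by (simp add: inv_gamma_density_def)
  qed
  have "(\<integral>\<^sup>+v. ennreal (inv_gamma_density a b v) * ennreal v \<partial>pos_reals)
      = (\<integral>\<^sup>+v. ennreal (b / (a - 1)) * ennreal (inv_gamma_density (a - 1) b v) \<partial>pos_reals)"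
    using a b shift inv_gamma_density_pos[of a b] inv_gamma_density_pos[of "a - 1" b]
    by (intro nn_integral_cong)
       (auto simp: space_restrict_space ennreal_mult[symmetric] less_imp_le)
  also have "\<dots> = ennreal (b / (a - 1))"
    using a b by (simp add: nn_integral_cmult measurable_pos_reals_id nn_integral_inv_gamma_density)
  finally show ?thesis .
qed

text \<open>Multiplication by \<open>1 / v\<close> raises the shape parameter by one.\<close>

lemma inv_gamma_mean_inverse:
  assumes a: "0 < a" and b: "0 < b"
  shows "(\<integral>\<^sup>+v. ennreal (inv_gamma_density a b v) * ennreal (1 / v) \<partial>pos_reals) = ennreal (a / b)"
proof -
  have shift: "inv_gamma_density a b v * (1 / v) = a / b * inv_gamma_density (a + 1) b v" if v: "0 < v" for v
  proof -
    have "a \<notin> \<int>\<^sub>\<le>\<^sub>0" using a nonpos_Ints_nonpos[of a] by force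
    then have "Gamma (a + 1) = a * Gamma a" by (rule Gamma_plus1)
    moreover have "b powr (a + 1) = b * b powr a" using b by (simp add: powr_add)
    moreover have "v powr (- a - 1) * (1 / v) = v powr (- (a + 1) - 1)"
    proof -
      have "v powr (- (a + 1) - 1) = v powr ((- a - 1) + (- 1))" by (simp add: algebra_simps)
      then show ?thesis using v by (simp only: powr_add) (simp add: powr_minus_divide)
    qed
    moreover have "inv_gamma_density (a + 1) b v = b powr (a + 1) / Gamma (a + 1) * v powr (- (a + 1) - 1) * exp (- b / v)"
      by (simp add: inv_gamma_density_def)
    ultimately have "inv_gamma_density (a + 1) b v
        = b * b powr a / (a * Gamma a) * (v powr (- a - 1) * (1 / v)) * exp (- b / v)"
      by (simp only:)
    then show ?thesis using a b Gamma_real_pos[of a] by (simp add: inv_gamma_density_def)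
  qed
  have "(\<integral>\<^sup>+v. ennreal (inv_gamma_density a b v) * ennreal (1 / v) \<partial>pos_reals)
      = (\<integral>\<^sup>+v. ennreal (a / b) * ennreal (inv_gamma_density (a + 1) b v) \<partial>pos_reals)"
  proof (rule nn_integral_cong)
    fix v assume "v \<in> space pos_reals"
    then have v: "0 < v" by (simp add: space_restrict_space)
    have "ennreal (inv_gamma_density a b v) * ennreal (1 / v) = ennreal (inv_gamma_density a b v * (1 / v))"
      using v a b inv_gamma_density_pos[of a b v] by (intro ennreal_mult[symmetric]) auto
    also have "\<dots> = ennreal (a / b) * ennreal (inv_gamma_density (a + 1) b v)"
      unfolding shift[OF v] using v a b inv_gamma_density_pos[of "a + 1" b v] by (intro ennreal_mult) auto
    finally show "ennreal (inv_gamma_density a b v) * ennreal (1 / v)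
        = ennreal (a / b) * ennreal (inv_gamma_density (a + 1) b v)" .
  qed
  also have "\<dots> = ennreal (a / b)"
    using a b by (simp add: nn_integral_cmult measurable_pos_reals_id nn_integral_inv_gamma_density)
  finally show ?thesis .
qed

section \<open>Positive reals and positive vectors\<close>

lemma space_pos_reals: "space pos_reals = {0<..}"
  by (simp add: space_restrict_space)

lemma space_pos_vectors: "space (pos_vectors :: (real ^ 'm) measure) = {z. \<forall>i. 0 < z $ i}"
  by (simp add: space_restrict_space)

lemma pos_reals_borel: "f \<in> N \<rightarrow>\<^sub>M pos_reals \<Longrightarrow> f \<in> borel_measurable N"
  by (simp add: measurable_restrict_space2_iff)

lemma pos_vectors_set: "{z :: real ^ 'm. \<forall>i. 0 < z $ i} \<in> sets lborel"
proof -
  have "open {z :: real ^ 'm. \<forall>i. 0 < z $ i}"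
    unfolding Collect_all_eq by (intro open_INT ballI open_Collect_less continuous_intros) simp_all
  then show ?thesis by simp
qed

lemma pos_vectors_coordinate: "(\<lambda>z. z $ i) \<in> (pos_vectors :: (real ^ 'm) measure) \<rightarrow>\<^sub>M pos_reals"
proof (rule measurable_restrict_space3)
  show "(\<lambda>z. z $ i) \<in> (lborel :: (real ^ 'm) measure) \<rightarrow>\<^sub>M lborel"
    by measurable
qed auto

lemma sigma_finite_pos_reals: "sigma_finite_measure pos_reals"
  by (intro sigma_finite_measure_restrict_space sigma_finite_lborel) simp

lemma sigma_finite_pos_vectors: "sigma_finite_measure (pos_vectors :: (real ^ 'm) measure)"
  using pos_vectors_set by (intro sigma_finite_measure_restrict_space sigma_finite_lborel)

lemma nn_integral_pos_vectors_prod: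
  fixes f :: "'m::finite \<Rightarrow> real \<Rightarrow> ennreal"
  assumes f: "\<And>i. f i \<in> borel_measurable pos_reals"
  shows "(\<integral>\<^sup>+z. (\<Prod>i\<in>UNIV. f i (z $ i)) \<partial>pos_vectors) = (\<Prod>i\<in>UNIV. \<integral>\<^sup>+u. f i u \<partial>pos_reals)"
proof -
  have m: "(\<lambda>u. f i u * indicator {0<..} u) \<in> borel_measurable borel" for i
    using f[of i] by (subst (asm) borel_measurable_restrict_space_iff_ennreal) auto
  have ind: "indicator {z :: real ^ 'm. \<forall>i. 0 < z $ i} z = (\<Prod>i\<in>UNIV. indicator {0<..} (z $ i) :: ennreal)" for z
    by (auto simp: indicator_def)
  have "(\<integral>\<^sup>+z. (\<Prod>i\<in>UNIV. f i (z $ i)) \<partial>pos_vectors)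
      = (\<integral>\<^sup>+z. (\<Prod>i\<in>UNIV. f i (z $ i)) * indicator {z. \<forall>i. 0 < z $ i} z \<partial>lborel)"
    using pos_vectors_set by (intro nn_integral_restrict_space) simp
  also have "\<dots> = (\<integral>\<^sup>+z. (\<Prod>i\<in>UNIV. f i (z $ i) * indicator {0<..} (z $ i)) \<partial>lborel)"
    by (simp add: ind prod.distrib)
  also have "\<dots> = (\<Prod>i\<in>UNIV. \<integral>\<^sup>+u. f i u * indicator {0<..} u \<partial>lborel)"
    using m by (rule nn_integral_lborel_cart_prod)
  finally show ?thesis by (simp add: nn_integral_pos_reals)
qed

text \<open>A density has total mass one, so it does not vanish almost everywhere.\<close>

lemma nn_integral_mixing_pos:
  assumes h: "mixing_density h" and w: "w \<in> borel_measurable pos_reals" and pos: "\<And>u. 0 < u \<Longrightarrow> 0 < w u"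
  shows "(\<integral>\<^sup>+u. ennreal (w u * h u) \<partial>pos_reals) \<noteq> 0"
proof
  have [measurable]: "h \<in> borel_measurable pos_reals" using h by (simp add: mixing_density_def)
  note w[measurable]
  assume "(\<integral>\<^sup>+u. ennreal (w u * h u) \<partial>pos_reals) = 0"
  then have "AE u in pos_reals. ennreal (w u * h u) = 0"
    by (subst (asm) nn_integral_0_iff_AE) measurable
  then have "AE u in pos_reals. ennreal (h u) = 0"
  proof (rule AE_mp, intro AE_I2 impI)
    fix u assume "u \<in> space pos_reals" "ennreal (w u * h u) = 0"
    then have "w u * h u \<le> 0" "0 < w u" using pos by (auto simp: space_pos_reals ennreal_eq_0_iff)
    then show "ennreal (h u) = 0" by (simp add: ennreal_eq_0_iff mult_le_0_iff)
  qed
  then have "(\<integral>\<^sup>+u. ennreal (h u) \<partial>pos_reals) = (\<integral>\<^sup>+u. 0 \<partial>pos_reals)" by (rule nn_integral_cong_AE)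
  then show False using h by (simp add: mixing_density_def)
qed

lemma state_space_pair: "(state_space :: ((real ^ 'p) \<times> real) measure) = lborel \<Otimes>\<^sub>M pos_reals"
proof -
  have *: "(UNIV :: (real ^ 'p) set) \<times> {0<..} \<in> sets (borel :: ((real ^ 'p) \<times> real) measure)"
    by (intro borel_open open_Times) auto
  have c: "fst \<in> borel_measurable (borel :: ((real ^ 'p) \<times> real) measure)"
    "snd \<in> borel_measurable (borel :: ((real ^ 'p) \<times> real) measure)"
    by (auto intro!: borel_measurable_continuous_onI continuous_intros)
  have "lborel \<Otimes>\<^sub>M pos_reals = (state_space :: ((real ^ 'p) \<times> real) measure)"
  proof (rule pair_measure_eqI[OF sigma_finite_lborel sigma_finite_pos_reals])
    show sets: "sets (lborel \<Otimes>\<^sub>M pos_reals) = sets (state_space :: ((real ^ 'p) \<times> real) measure)"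
    proof (rule antisym)
      have id: "(\<lambda>x. x) \<in> (state_space :: ((real ^ 'p) \<times> real) measure) \<rightarrow>\<^sub>M lborel \<Otimes>\<^sub>M pos_reals"
      proof (rule measurable_pair)
        show "fst \<circ> (\<lambda>x. x) \<in> (state_space :: ((real ^ 'p) \<times> real) measure) \<rightarrow>\<^sub>M lborel"
          using c(1) by (simp add: comp_def measurable_restrict_space1)
        show "snd \<circ> (\<lambda>x. x) \<in> (state_space :: ((real ^ 'p) \<times> real) measure) \<rightarrow>\<^sub>M pos_reals"
          unfolding comp_def by (rule measurable_restrict_space3) (use c(2) in auto)
      qed
      have sp: "space (lborel \<Otimes>\<^sub>M pos_reals) = (UNIV :: (real ^ 'p) set) \<times> {0<..}"
        by (simp add: space_pair_measure space_restrict_space)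
      show "sets (lborel \<Otimes>\<^sub>M pos_reals) \<subseteq> sets (state_space :: ((real ^ 'p) \<times> real) measure)"
      proof
        fix A assume A: "A \<in> sets (lborel \<Otimes>\<^sub>M pos_reals :: ((real ^ 'p) \<times> real) measure)"
        from measurable_sets[OF id A] sets.sets_into_space[OF A]
        show "A \<in> sets (state_space :: ((real ^ 'p) \<times> real) measure)"
          by (simp add: space_restrict_space sp Int_absorb2 vimage_def)
      qed
      show "sets (state_space :: ((real ^ 'p) \<times> real) measure) \<subseteq> sets (lborel \<Otimes>\<^sub>M pos_reals)"
      proof
        have id2: "(\<lambda>x. x) \<in> lborel \<Otimes>\<^sub>M pos_reals \<rightarrow>\<^sub>M (borel :: ((real ^ 'p) \<times> real) measure)"
        proof -
          have "fst \<in> borel_measurable (lborel \<Otimes>\<^sub>M pos_reals :: ((real ^ 'p) \<times> real) measure)"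
            using measurable_fst[of "lborel :: (real ^ 'p) measure" pos_reals] by simp
          moreover have "snd \<in> borel_measurable (lborel \<Otimes>\<^sub>M pos_reals :: ((real ^ 'p) \<times> real) measure)"
            by (rule pos_reals_borel[OF measurable_snd])
          ultimately have "(\<lambda>x. (fst x, snd x)) \<in> borel_measurable (lborel \<Otimes>\<^sub>M pos_reals :: ((real ^ 'p) \<times> real) measure)"
            by (rule borel_measurable_Pair)
          then show ?thesis by simp
        qed
        fix A assume "A \<in> sets (state_space :: ((real ^ 'p) \<times> real) measure)"
        then have A: "A \<in> sets borel" "A \<subseteq> UNIV \<times> {0<..}"
          using * by (auto simp: sets_restrict_space_iff)
        from measurable_sets[OF id2 A(1)] A(2)
        show "A \<in> sets (lborel \<Otimes>\<^sub>M pos_reals)" by (simp add: sp Int_absorb2 vimage_def)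
      qed
    qed
    fix A :: "(real ^ 'p) set" and B :: "real set"
    assume A: "A \<in> sets lborel" and B: "B \<in> sets pos_reals"
    then have B': "B \<in> sets lborel" "B \<subseteq> {0<..}" by (auto simp: sets_restrict_space_iff)
    have "emeasure (state_space :: ((real ^ 'p) \<times> real) measure) (A \<times> B) = emeasure (lborel \<Otimes>\<^sub>M lborel) (A \<times> B)"
      using * B' by (subst emeasure_restrict_space) (auto simp: lborel_prod)
    also have "\<dots> = emeasure lborel A * emeasure lborel B"
      using A B' by (intro lborel.emeasure_pair_measure_Times)
    also have "emeasure lborel B = emeasure pos_reals B"
      using B' by (subst emeasure_restrict_space) auto
    finally show "emeasure lborel A * emeasure pos_reals B
        = emeasure (state_space :: ((real ^ 'p) \<times> real) measure) (A \<times> B)" by simp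
  qed
  then show ?thesis by simp
qed

lemma density_cong_space:
  assumes "\<And>x. x \<in> space M \<Longrightarrow> f x = g x"
  shows "density M f = density M g"
  unfolding density_def using assms
  by (intro arg_cong[of _ _ "measure_of (space M) (sets M)"] ext nn_integral_cong) simp

lemma one_plus_power_le:
  fixes t :: real
  assumes "0 \<le> t"
  shows "(1 + t) ^ n \<le> 2 ^ n * (1 + t ^ n)"
proof -
  have "(1 + t) ^ n \<le> (2 * max 1 t) ^ n" using assms by (intro power_mono) auto
  also have "\<dots> = 2 ^ n * (max 1 t) ^ n" by (simp add: power_mult_distrib)
  also have "\<dots> \<le> 2 ^ n * (1 + t ^ n)" using assms by (intro mult_left_mono) (auto simp: max_def)
  finally show ?thesis .
qed

section \<open>The regression model: conditional distribution of the latent variables\<close>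

locale scale_mixture_regression =
  fixes y :: "real ^ 'm" and X :: "real ^ 'p ^ 'm" and h :: "real \<Rightarrow> real"
    and \<alpha> \<gamma> :: real and \<mu> :: "real ^ 'p" and \<Sigma> :: "real ^ 'p ^ 'p"
  assumes card_ge_2: "2 \<le> CARD('m)" and \<Sigma>_pos_def: "pos_def_matrix \<Sigma>"
    and \<alpha>_pos: "0 < \<alpha>" and \<gamma>_pos: "0 < \<gamma>"
    and mixing: "mixing_density h" and conditionals: "z_conditionals_exist y X h"
begin

abbreviation resid :: "'m \<Rightarrow> real ^ 'p \<Rightarrow> real" where
  "resid i \<beta> \<equiv> y $ i - X $ i \<bullet> \<beta>"

abbreviation zk where "zk \<equiv> z_kernel y X h"

definition z_norm :: "'m \<Rightarrow> real ^ 'p \<Rightarrow> real \<Rightarrow> real" where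
  "z_norm i \<beta> s = (\<integral>u. zk i \<beta> s u \<partial>pos_reals)"

lemma h_measurable[measurable]: "h \<in> borel_measurable pos_reals"
  and h_nonneg: "0 < u \<Longrightarrow> 0 \<le> h u"
  and h_one: "(\<integral>\<^sup>+u. ennreal (h u) \<partial>pos_reals) = 1"
  using mixing by (auto simp: mixing_density_def)

lemma z_kernel_nonneg: "0 < u \<Longrightarrow> 0 \<le> zk i \<beta> s u"
  by (simp add: z_kernel_def h_nonneg)

lemma z_kernel_measurable_gen:
  assumes [measurable]: "f \<in> borel_measurable N" "g \<in> borel_measurable N" and k: "k \<in> N \<rightarrow>\<^sub>M pos_reals"
  shows "(\<lambda>x. zk i (f x) (g x) (k x)) \<in> borel_measurable N"
proof -
  have [measurable]: "k \<in> borel_measurable N" using k by (rule pos_reals_borel)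
  have [measurable]: "(\<lambda>x. h (k x)) \<in> borel_measurable N" using k h_measurable by (rule measurable_compose)
  show ?thesis unfolding z_kernel_def by measurable
qed

lemma z_kernel_measurable[measurable]: "zk i \<beta> s \<in> borel_measurable pos_reals"
  using z_kernel_measurable_gen[of "\<lambda>_. \<beta>" pos_reals "\<lambda>_. s" "\<lambda>u. u"] by simp

lemma z_kernel_integrable: "0 < s \<Longrightarrow> integrable pos_reals (zk i \<beta> s)"
  using conditionals by (simp add: z_conditionals_exist_def)

lemma nn_integral_z_kernel: "0 < s \<Longrightarrow> (\<integral>\<^sup>+u. ennreal (zk i \<beta> s u) \<partial>pos_reals) = ennreal (z_norm i \<beta> s)"
  unfolding z_norm_def by (intro nn_integral_eq_integral z_kernel_integrable) (auto simp: space_pos_reals z_kernel_nonneg)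

lemma z_norm_pos: assumes s: "0 < s" shows "0 < z_norm i \<beta> s"
proof -
  let ?w = "\<lambda>u. sqrt u * exp (- (u / 2) * ((resid i \<beta>)\<^sup>2 / s))"
  have "?w \<in> borel_measurable pos_reals" by (intro measurable_restrict_space1) measurable
  then have "(\<integral>\<^sup>+u. ennreal (?w u * h u) \<partial>pos_reals) \<noteq> 0"
    using mixing by (intro nn_integral_mixing_pos) auto
  then have "(\<integral>\<^sup>+u. ennreal (zk i \<beta> s u) \<partial>pos_reals) \<noteq> 0" by (simp add: z_kernel_def)
  then show ?thesis by (simp add: nn_integral_z_kernel[OF s] ennreal_eq_0_iff not_le)
qed

text \<open>Measurability in both \<open>\<beta>\<close> and \<open>s\<close>, as needed for the joint measurability of the density of \<open>z\<close>.\<close>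

lemma z_norm_measurable:
  assumes [measurable]: "f \<in> borel_measurable N" "g \<in> borel_measurable N"
  shows "(\<lambda>x. z_norm i (f x) (g x)) \<in> borel_measurable N"
proof -
  interpret P: sigma_finite_measure pos_reals by (rule sigma_finite_pos_reals)
  have [measurable]: "(\<lambda>w. zk i (f (fst w)) (g (fst w)) (snd w)) \<in> borel_measurable (N \<Otimes>\<^sub>M pos_reals)"
    by (intro z_kernel_measurable_gen) measurable
  show ?thesis unfolding z_norm_def by (intro P.borel_measurable_lebesgue_integral) (simp add: case_prod_beta')
qed

lemma zdens_eq: "z_component_density y X h i \<beta> s u = zk i \<beta> s u / z_norm i \<beta> s"
  by (simp add: z_component_density_def z_norm_def)

lemma zdens_nonneg: "0 < s \<Longrightarrow> 0 < u \<Longrightarrow> 0 \<le> z_component_density y X h i \<beta> s u"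
  using z_norm_pos z_kernel_nonneg by (simp add: zdens_eq less_imp_le)

lemma zdens_measurable[measurable]: "z_component_density y X h i \<beta> s \<in> borel_measurable pos_reals"
  unfolding zdens_eq[abs_def] by measurable

lemma nn_integral_zdens:
  assumes s: "0 < s"
  shows "(\<integral>\<^sup>+u. ennreal (z_component_density y X h i \<beta> s u) \<partial>pos_reals) = 1"
proof -
  have "(\<integral>\<^sup>+u. ennreal (z_component_density y X h i \<beta> s u) \<partial>pos_reals)
      = (\<integral>\<^sup>+u. ennreal (1 / z_norm i \<beta> s) * ennreal (zk i \<beta> s u) \<partial>pos_reals)"
    using z_norm_pos[OF s, of i \<beta>] z_kernel_nonneg
    by (intro nn_integral_cong) (simp add: zdens_eq space_pos_reals ennreal_mult[symmetric] less_imp_le)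
  also have "\<dots> = ennreal (1 / z_norm i \<beta> s) * ennreal (z_norm i \<beta> s)"
    by (simp add: nn_integral_cmult nn_integral_z_kernel[OF s])
  also have "\<dots> = 1" using z_norm_pos[OF s, of i \<beta>] by (simp add: ennreal_mult[symmetric])
  finally show ?thesis .
qed

lemma z_density_nonneg: "0 < s \<Longrightarrow> (\<And>i. 0 < z $ i) \<Longrightarrow> 0 \<le> z_density y X h \<beta> s z"
  unfolding z_density_def by (intro prod_nonneg) (auto intro: zdens_nonneg)

lemma z_density_ennreal:
  "0 < s \<Longrightarrow> (\<And>i. 0 < z $ i) \<Longrightarrow>
    ennreal (z_density y X h \<beta> s z) = (\<Prod>i\<in>UNIV. ennreal (z_component_density y X h i \<beta> s (z $ i)))"
  unfolding z_density_def by (intro prod_ennreal[symmetric] zdens_nonneg) auto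

lemma nn_integral_z_density:
  assumes s: "0 < s"
  shows "(\<integral>\<^sup>+z. ennreal (z_density y X h \<beta> s z) \<partial>pos_vectors) = 1"
proof -
  have "(\<integral>\<^sup>+z. ennreal (z_density y X h \<beta> s z) \<partial>pos_vectors)
      = (\<integral>\<^sup>+z. (\<Prod>i\<in>UNIV. ennreal (z_component_density y X h i \<beta> s (z $ i))) \<partial>pos_vectors)"
    by (intro nn_integral_cong z_density_ennreal s) (auto simp: space_pos_vectors)
  also have "\<dots> = 1" by (subst nn_integral_pos_vectors_prod) (simp_all add: nn_integral_zdens s)
  finally show ?thesis .
qed

text \<open>If the residual vanishes, both sides are zero, whatever the default value of the mean. Otherwise half
  of the exponent absorbs the additional factor \<open>u\<close>, and the other half is the kernel with \<open>2 s\<close> in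
  place of \<open>s\<close>, which is integrable.\<close>

lemma nn_integral_z_component_second:
  assumes s: "0 < s"
  shows "(\<integral>\<^sup>+u. ennreal (u * (resid i \<beta>)\<^sup>2) * ennreal (z_component_density y X h i \<beta> s u) \<partial>pos_reals)
    = ennreal (z_mean y X h i \<beta> s * (resid i \<beta>)\<^sup>2)"
proof (cases "resid i \<beta> = 0")
  case False
  define k where "k = (resid i \<beta>)\<^sup>2 / (4 * s)"
  have k: "0 < k" using False s by (simp add: k_def)
  have bound: "u * zk i \<beta> s u \<le> 1 / k * zk i \<beta> (2 * s) u" if u: "0 < u" for u
  proof -
    have ex: "exp (- (u / 2) * ((resid i \<beta>)\<^sup>2 / s)) = exp (- (u * k)) * exp (- (u / 2) * ((resid i \<beta>)\<^sup>2 / (2 * s)))"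
      using s by (simp add: k_def exp_add[symmetric] field_simps)
    have "u * k \<le> exp (u * k)" using exp_ge_add_one_self[of "u * k"] by linarith
    then have "u * exp (- (u * k)) \<le> 1 / k" using k by (simp add: exp_minus field_simps)
    then have "u * exp (- (u * k)) * zk i \<beta> (2 * s) u \<le> 1 / k * zk i \<beta> (2 * s) u"
      by (intro mult_right_mono z_kernel_nonneg u)
    moreover have "u * zk i \<beta> s u = u * exp (- (u * k)) * zk i \<beta> (2 * s) u"
      unfolding z_kernel_def ex by (simp add: mult_ac)
    ultimately show ?thesis by (simp only:)
  qed
  have "integrable pos_reals (\<lambda>u. u * zk i \<beta> s u)"
  proof (rule Bochner_Integration.integrable_bound)
    show "integrable pos_reals (\<lambda>u. 1 / k * zk i \<beta> (2 * s) u)" using s by (intro integrable_mult_right z_kernel_integrable) simp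
    show "(\<lambda>u. u * zk i \<beta> s u) \<in> borel_measurable pos_reals"
      by (intro borel_measurable_times z_kernel_measurable measurable_restrict_space1) simp
    show "AE u in pos_reals. norm (u * zk i \<beta> s u) \<le> norm (1 / k * zk i \<beta> (2 * s) u)"
      using bound k z_kernel_nonneg by (intro AE_I2) (auto simp: space_pos_reals abs_mult)
  qed
  then have "integrable pos_reals (\<lambda>u. u * z_component_density y X h i \<beta> s u)"
    unfolding zdens_eq by simp
  then have int: "integrable pos_reals (\<lambda>u. u * z_component_density y X h i \<beta> s u * (resid i \<beta>)\<^sup>2)" by simp
  have "(\<integral>\<^sup>+u. ennreal (u * (resid i \<beta>)\<^sup>2) * ennreal (z_component_density y X h i \<beta> s u) \<partial>pos_reals)
      = (\<integral>\<^sup>+u. ennreal (u * z_component_density y X h i \<beta> s u * (resid i \<beta>)\<^sup>2) \<partial>pos_reals)"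
    using zdens_nonneg[OF s] by (intro nn_integral_cong) (simp add: space_pos_reals ennreal_mult[symmetric] mult_ac)
  also have "\<dots> = ennreal (\<integral>u. u * z_component_density y X h i \<beta> s u * (resid i \<beta>)\<^sup>2 \<partial>pos_reals)"
    using zdens_nonneg[OF s] by (intro nn_integral_eq_integral int AE_I2) (auto simp: space_pos_reals)
  finally show ?thesis by (simp add: z_mean_def)
qed simp

text \<open>The numerator of the drift hypothesis is the conditional mean of the weighted residual sum of squares,
  which is what enters the scale parameter of \<open>\<sigma>\<^sup>2\<close>.\<close>

lemma nn_integral_weighted_residuals:
  assumes s: "0 < s"
  shows "(\<integral>\<^sup>+z. ennreal (z_density y X h \<beta> s z) * ennreal (\<Sum>i\<in>UNIV. z $ i * (resid i \<beta>)\<^sup>2) \<partial>pos_vectors)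
    = ennreal (\<Sum>i\<in>UNIV. z_mean y X h i \<beta> s * (resid i \<beta>)\<^sup>2)"
proof -
  let ?d = "\<lambda>i u. ennreal (z_component_density y X h i \<beta> s u)"
  let ?f = "\<lambda>i j u. if j = i then ennreal (u * (resid i \<beta>)\<^sup>2) * ?d i u else ?d j u"
  have [measurable]: "(\<lambda>u. u) \<in> borel_measurable pos_reals" by (rule measurable_pos_reals_id) simp
  have m: "?f i j \<in> borel_measurable pos_reals" for i j by measurable
  have split: "(\<Prod>j\<in>UNIV. ?f i j (a j)) = ennreal (a i * (resid i \<beta>)\<^sup>2) * (\<Prod>j\<in>UNIV. ?d j (a j))" for i and a :: "'m \<Rightarrow> real"
    by (simp add: prod.remove[of UNIV i] mult.assoc)
  have one: "(\<integral>\<^sup>+z. ennreal (z $ i * (resid i \<beta>)\<^sup>2) * (\<Prod>j\<in>UNIV. ?d j (z $ j)) \<partial>pos_vectors)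
      = ennreal (z_mean y X h i \<beta> s * (resid i \<beta>)\<^sup>2)" for i
  proof -
    have "(\<integral>\<^sup>+z. ennreal (z $ i * (resid i \<beta>)\<^sup>2) * (\<Prod>j\<in>UNIV. ?d j (z $ j)) \<partial>pos_vectors)
        = (\<Prod>j\<in>UNIV. \<integral>\<^sup>+u. ?f i j u \<partial>pos_reals)"
      unfolding split[symmetric] using m by (rule nn_integral_pos_vectors_prod)
    also have "\<dots> = ennreal (z_mean y X h i \<beta> s * (resid i \<beta>)\<^sup>2)"
      by (simp add: prod.remove[of UNIV i] nn_integral_zdens s nn_integral_z_component_second[OF s])
    finally show ?thesis .
  qed
  have [measurable]: "(\<lambda>z. ?d j (z $ j)) \<in> borel_measurable pos_vectors" for j
    by (rule measurable_compose[OF pos_vectors_coordinate]) measurable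
  have [measurable]: "(\<lambda>z. z $ j) \<in> borel_measurable pos_vectors" for j
    by (rule pos_reals_borel[OF pos_vectors_coordinate])
  have "(\<integral>\<^sup>+z. ennreal (z_density y X h \<beta> s z) * ennreal (\<Sum>i\<in>UNIV. z $ i * (resid i \<beta>)\<^sup>2) \<partial>pos_vectors)
      = (\<integral>\<^sup>+z. (\<Sum>i\<in>UNIV. ennreal (z $ i * (resid i \<beta>)\<^sup>2) * (\<Prod>j\<in>UNIV. ?d j (z $ j))) \<partial>pos_vectors)"
    by (intro nn_integral_cong)
       (auto simp: space_pos_vectors z_density_ennreal s sum_distrib_left mult.commute sum_ennreal[symmetric] less_imp_le simp del: sum_ennreal)
  also have "\<dots> = (\<Sum>i\<in>UNIV. ennreal (z_mean y X h i \<beta> s * (resid i \<beta>)\<^sup>2))"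
    by (subst nn_integral_sum) (auto simp: one)
  also have "\<dots> = ennreal (\<Sum>i\<in>UNIV. z_mean y X h i \<beta> s * (resid i \<beta>)\<^sup>2)"
  proof (rule sum_ennreal)
    fix i
    have "0 \<le> z_mean y X h i \<beta> s"
      unfolding z_mean_def using zdens_nonneg[OF s] by (intro integral_nonneg_AE AE_I2) (auto simp: space_pos_reals)
    then show "0 \<le> z_mean y X h i \<beta> s * (resid i \<beta>)\<^sup>2" by simp
  qed
  finally show ?thesis .
qed

text \<open>The residual is constant if \<open>x\<^sub>i = 0\<close>, and can be made zero otherwise.\<close>

lemma residual_minimizer: "\<exists>\<beta>0. \<forall>\<beta>. (resid i \<beta>0)\<^sup>2 \<le> (resid i \<beta>)\<^sup>2"
proof (cases "X $ i = 0")
  case False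
  then have "resid i ((y $ i / (X $ i \<bullet> X $ i)) *\<^sub>R X $ i) = 0" by simp
  then show ?thesis by (metis zero_eq_power2 zero_le_power2)
qed simp

definition best_fit :: "'m \<Rightarrow> real ^ 'p" where
  "best_fit i = (SOME \<beta>0. \<forall>\<beta>. (resid i \<beta>0)\<^sup>2 \<le> (resid i \<beta>)\<^sup>2)"

lemma best_fit: "(resid i (best_fit i))\<^sup>2 \<le> (resid i \<beta>)\<^sup>2"
  unfolding best_fit_def using someI_ex[OF residual_minimizer[of i]] by blast

text \<open>The kernel decreases in \<open>r\<^sup>2 / s\<close>. This bounds the normalizing constant uniformly over \<open>\<beta>\<close>, also when
  \<open>h\<close> is such that the kernel without the exponential factor is not integrable: in that case the
  residual cannot vanish.\<close>

lemma z_norm_le: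
  assumes s: "0 < s" "s \<le> R"
  shows "z_norm i \<beta> s \<le> z_norm i (best_fit i) R"
  unfolding z_norm_def
proof (rule integral_mono)
  show "integrable pos_reals (zk i \<beta> s)" "integrable pos_reals (zk i (best_fit i) R)"
    using s by (auto intro: z_kernel_integrable)
  fix u assume "u \<in> space pos_reals"
  then have u: "0 < u" by (simp add: space_pos_reals)
  have "(resid i (best_fit i))\<^sup>2 / R \<le> (resid i \<beta>)\<^sup>2 / s"
    using best_fit s by (intro frac_le) auto
  then have "(u / 2) * ((resid i (best_fit i))\<^sup>2 / R) \<le> (u / 2) * ((resid i \<beta>)\<^sup>2 / s)"
    using u by (intro mult_left_mono) auto
  then show "zk i \<beta> s u \<le> zk i (best_fit i) R u"
    unfolding z_kernel_def using u h_nonneg[OF u]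
    by (intro mult_right_mono mult_left_mono) auto
qed

text \<open>If the residual can be made zero, the normalizing constant is bounded. Otherwise the residual is
  bounded away from zero, and \<open>\<surd>u exp (- u c\<^sup>2 / (2 s)) \<le> \<surd>s / c\<close>.\<close>

lemma z_norm_growth: "\<exists>C. 0 \<le> C \<and> (\<forall>\<beta> s. 0 < s \<longrightarrow> z_norm i \<beta> s \<le> C * (1 + sqrt s))"
proof (cases "resid i (best_fit i) = 0")
  case True
  have "z_norm i \<beta> s \<le> z_norm i (best_fit i) 1 * (1 + sqrt s)" if s: "0 < s" for \<beta> s
  proof -
    have "z_norm i \<beta> s \<le> z_norm i (best_fit i) s" using s by (intro z_norm_le) auto
    also have "\<dots> = z_norm i (best_fit i) 1" by (simp add: z_norm_def z_kernel_def True)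
    also have "\<dots> \<le> z_norm i (best_fit i) 1 * (1 + sqrt s)" using z_norm_pos[of 1 i "best_fit i"] s by simp
    finally show ?thesis .
  qed
  then show ?thesis using z_norm_pos[of 1 i "best_fit i"] by (intro exI[of _ "z_norm i (best_fit i) 1"]) auto
next
  case False
  define c where "c = \<bar>resid i (best_fit i)\<bar>"
  have c: "0 < c" "c\<^sup>2 = (resid i (best_fit i))\<^sup>2" using False by (auto simp: c_def)
  have hint: "integrable pos_reals h" "(\<integral>u. h u \<partial>pos_reals) = 1"
  proof -
    have ae: "AE u in pos_reals. 0 \<le> h u" by (auto simp: space_pos_reals h_nonneg)
    show "integrable pos_reals h" using h_one ae by (intro integrableI_nonneg) auto
    then show "(\<integral>u. h u \<partial>pos_reals) = 1"
      using nn_integral_eq_integral[OF _ ae] h_one by simp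
  qed
  have "z_norm i \<beta> s \<le> 1 / c * (1 + sqrt s)" if s: "0 < s" for \<beta> s
  proof -
    have "z_norm i \<beta> s \<le> (\<integral>u. sqrt s / c * h u \<partial>pos_reals)"
      unfolding z_norm_def
    proof (rule integral_mono)
      fix u assume "u \<in> space pos_reals"
      then have u: "0 < u" by (simp add: space_pos_reals)
      define t where "t = sqrt u * c / sqrt s"
      have t: "0 < t" "t\<^sup>2 = u * (c\<^sup>2 / s)" using u c s by (auto simp: t_def power_mult_distrib power_divide)
      have "t \<le> 1 + t\<^sup>2 / 2" using zero_le_power2[of "t - 1"] by (simp add: power2_eq_square algebra_simps)
      also have "\<dots> \<le> exp (t\<^sup>2 / 2)" by (rule exp_ge_add_one_self)
      finally have "t * exp (- (t\<^sup>2 / 2)) \<le> 1" by (simp add: exp_minus field_simps)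
      moreover have "exp (- (u / 2) * ((resid i \<beta>)\<^sup>2 / s)) \<le> exp (- (t\<^sup>2 / 2))"
      proof -
        have "c\<^sup>2 / s \<le> (resid i \<beta>)\<^sup>2 / s" using c(2) best_fit[of i \<beta>] s by (intro divide_right_mono) auto
        then have "u * (c\<^sup>2 / s) \<le> u * ((resid i \<beta>)\<^sup>2 / s)" using u by (intro mult_left_mono) auto
        moreover have "- (u / 2) * B \<le> - (u * A / 2)" if "u * A \<le> u * B" for A B using that by simp
        ultimately show ?thesis unfolding t(2) by (simp only: exp_le_cancel_iff)
      qed
      then have "t * exp (- (u / 2) * ((resid i \<beta>)\<^sup>2 / s)) \<le> t * exp (- (t\<^sup>2 / 2))"
        using t by (intro mult_left_mono) auto
      ultimately have "t * exp (- (u / 2) * ((resid i \<beta>)\<^sup>2 / s)) \<le> 1" by linarith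
      then have "sqrt s / c * (t * exp (- (u / 2) * ((resid i \<beta>)\<^sup>2 / s))) \<le> sqrt s / c * 1"
        using s c by (intro mult_left_mono) auto
      moreover have "sqrt s / c * t = sqrt u" using s c by (simp add: t_def)
      ultimately have "sqrt u * exp (- (u / 2) * ((resid i \<beta>)\<^sup>2 / s)) \<le> sqrt s / c"
        by (simp only: mult.assoc[symmetric] mult_1_right)
      then show "zk i \<beta> s u \<le> sqrt s / c * h u"
        unfolding z_kernel_def using h_nonneg[OF u] by (intro mult_right_mono) auto
    qed (use z_kernel_integrable[OF s] hint in auto)
    also have "\<dots> = 1 / c * sqrt s" by (simp add: hint)
    also have "\<dots> \<le> 1 / c * (1 + sqrt s)" using c by (intro mult_left_mono) auto
    finally show ?thesis .
  qed
  then show ?thesis using c by (intro exI[of _ "1 / c"]) auto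
qed

end

section \<open>The remaining full conditionals\<close>

context scale_mixture_regression
begin

abbreviation \<Sigma>inv where "\<Sigma>inv \<equiv> matrix_inv \<Sigma>"

lemma \<Sigma>inv_pos_def: "pos_def_matrix \<Sigma>inv"
  using \<Sigma>_pos_def by (rule pos_def_matrix_inv)

lemma \<Sigma>inv_sym: "u \<bullet> (\<Sigma>inv *v v) = v \<bullet> (\<Sigma>inv *v u)"
  using \<Sigma>inv_pos_def by (intro symmetric_matrix_inner) (simp add: pos_def_matrix_def)

lemma \<Sigma>inv_nonneg: "0 \<le> v \<bullet> (\<Sigma>inv *v v)"
  using \<Sigma>inv_pos_def by (cases "v = 0") (auto simp: pos_def_matrix_def less_imp_le)

text \<open>The matrix inverted in \<open>\<Sigma>'\<close>, and below it the precision matrix of \<open>\<beta>\<close> given \<open>s\<close> and \<open>z\<close>.\<close>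

definition A_matrix :: "real \<Rightarrow> real ^ 'm \<Rightarrow> real ^ 'p ^ 'p" where
  "A_matrix s z = transpose X ** matrix_inv (Q_matrix z) ** X + s *\<^sub>R \<Sigma>inv"

definition H_matrix :: "real \<Rightarrow> real ^ 'm \<Rightarrow> real ^ 'p ^ 'p" where
  "H_matrix s z = (1 / s) *\<^sub>R A_matrix s z"

lemma inner_A_matrix:
  assumes z: "\<And>i. 0 < z $ i"
  shows "v \<bullet> (A_matrix s z *v w) = (\<Sum>i\<in>UNIV. z $ i * (X $ i \<bullet> v) * (X $ i \<bullet> w)) + s * (v \<bullet> (\<Sigma>inv *v w))"
proof -
  have "v \<bullet> ((transpose X ** matrix_inv (Q_matrix z) ** X) *v w)
      = (X *v v) \<bullet> (matrix_inv (Q_matrix z) *v (X *v w))"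
    by (simp only: matrix_vector_mul_assoc[symmetric] inner_transpose_matrix)
  also have "\<dots> = (\<Sum>i\<in>UNIV. (X *v v) $ i * (z $ i * (X *v w) $ i))"
    by (simp add: inner_vec_def matrix_inv_Q_vector[OF z])
  also have "\<dots> = (\<Sum>i\<in>UNIV. z $ i * (X $ i \<bullet> v) * (X $ i \<bullet> w))"
    by (intro sum.cong) (auto simp: matrix_vector_mul_component)
  finally show ?thesis
    by (simp add: A_matrix_def matrix_vector_mult_add_rdistrib inner_add_right scaleR_matrix_vector_assoc[symmetric])
qed

lemma A_matrix_pos_def:
  assumes s: "0 < s" and z: "\<And>i. 0 < z $ i"
  shows "pos_def_matrix (A_matrix s z)"
  unfolding pos_def_matrix_def
proof (intro conjI allI impI)
  have sym: "v \<bullet> (A_matrix s z *v w) = w \<bullet> (A_matrix s z *v v)" for v w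
    unfolding inner_A_matrix[OF z] \<Sigma>inv_sym[of v w] by (simp only: mult_ac)
  have "transpose (A_matrix s z) *v v = A_matrix s z *v v" for v
  proof (rule vector_eq_ldot[THEN iffD1], rule allI)
    fix w
    have "w \<bullet> (transpose (A_matrix s z) *v v) = v \<bullet> (A_matrix s z *v w)"
      by (simp only: inner_transpose_matrix inner_commute[of v])
    then show "w \<bullet> (transpose (A_matrix s z) *v v) = w \<bullet> (A_matrix s z *v v)"
      by (simp only: sym[of v w])
  qed
  then show "transpose (A_matrix s z) = A_matrix s z" unfolding matrix_eq by blast
  fix v :: "real ^ 'p" assume "v \<noteq> 0"
  then have "0 < v \<bullet> (\<Sigma>inv *v v)" using \<Sigma>inv_pos_def by (simp add: pos_def_matrix_def)
  moreover have "0 \<le> (\<Sum>i\<in>UNIV. z $ i * (X $ i \<bullet> v) * (X $ i \<bullet> v))"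
    using z by (intro sum_nonneg) (simp add: mult.assoc less_imp_le)
  ultimately show "0 < v \<bullet> (A_matrix s z *v v)"
    unfolding inner_A_matrix[OF z] using s by (intro add_nonneg_pos) auto
qed

lemma inner_H_matrix:
  assumes s: "0 < s" and z: "\<And>i. 0 < z $ i"
  shows "v \<bullet> (H_matrix s z *v w) = (\<Sum>i\<in>UNIV. z $ i * (X $ i \<bullet> v) * (X $ i \<bullet> w)) / s + v \<bullet> (\<Sigma>inv *v w)"
  unfolding H_matrix_def using s
  by (simp add: scaleR_matrix_vector_assoc[symmetric] inner_A_matrix[OF z] add_divide_distrib)

lemma H_matrix_pos_def:
  assumes s: "0 < s" and z: "\<And>i. 0 < z $ i"
  shows "pos_def_matrix (H_matrix s z)"
  using A_matrix_pos_def[OF assms] s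
  by (auto simp: pos_def_matrix_def H_matrix_def transpose_def vec_eq_iff scaleR_matrix_vector_assoc[symmetric])

abbreviation bmean where "bmean \<equiv> beta_mean y X \<mu> \<Sigma>"

lemma scaled_beta_cov:
  assumes s: "0 < s" and z: "\<And>i. 0 < z $ i"
  shows "s *\<^sub>R beta_cov X \<Sigma> s z = matrix_inv (H_matrix s z)"
proof -
  have d: "det (A_matrix s z) \<noteq> 0" using pos_def_det[OF A_matrix_pos_def[OF assms]] by simp
  have "H_matrix s z ** (s *\<^sub>R matrix_inv (A_matrix s z)) = A_matrix s z ** matrix_inv (A_matrix s z)"
    using s by (simp add: H_matrix_def matrix_matrix_mult_def vec_eq_iff sum_distrib_left)
  also have "\<dots> = mat 1" by (rule matrix_inv_det_nz[OF d])
  finally show ?thesis by (simp add: matrix_inv_unique beta_cov_def A_matrix_def)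
qed

text \<open>The gradient of the penalized least squares problem vanishes at the conditional mean. This gives the
  cross term in \<open>complete_square\<close>, and it is the only property of the mean used to bound it.\<close>

lemma normal_equations:
  assumes s: "0 < s" and z: "\<And>i. 0 < z $ i"
  shows "(\<Sum>i\<in>UNIV. z $ i * resid i (bmean s z) * (X $ i \<bullet> v)) = s * (v \<bullet> (\<Sigma>inv *v (bmean s z - \<mu>)))"
proof -
  let ?m = "bmean s z"
  let ?c = "(transpose X ** matrix_inv (Q_matrix z)) *v y + s *\<^sub>R (\<Sigma>inv *v \<mu>)"
  have d: "det (A_matrix s z) \<noteq> 0" using pos_def_det[OF A_matrix_pos_def[OF assms]] by simp
  have "A_matrix s z *v ?m = (A_matrix s z ** matrix_inv (A_matrix s z)) *v ?c"
    unfolding beta_mean_def beta_cov_def A_matrix_def[symmetric] by (simp only: matrix_vector_mul_assoc)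
  also have "\<dots> = ?c" by (simp add: matrix_inv_det_nz[OF d])
  finally have "v \<bullet> (A_matrix s z *v ?m) = v \<bullet> ?c" by simp
  moreover have "v \<bullet> ((transpose X ** matrix_inv (Q_matrix z)) *v y) = (\<Sum>i\<in>UNIV. z $ i * y $ i * (X $ i \<bullet> v))"
  proof -
    have "v \<bullet> ((transpose X ** matrix_inv (Q_matrix z)) *v y) = (X *v v) \<bullet> (matrix_inv (Q_matrix z) *v y)"
      by (simp only: matrix_vector_mul_assoc[symmetric] inner_transpose_matrix)
    then show ?thesis
      by (simp add: inner_vec_def[of "X *v v"] matrix_inv_Q_vector[OF z] matrix_vector_mul_component[of X] mult_ac)
  qed
  ultimately have "(\<Sum>i\<in>UNIV. z $ i * (X $ i \<bullet> v) * (X $ i \<bullet> ?m)) + s * (v \<bullet> (\<Sigma>inv *v ?m))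
      = (\<Sum>i\<in>UNIV. z $ i * y $ i * (X $ i \<bullet> v)) + s * (v \<bullet> (\<Sigma>inv *v \<mu>))"
    unfolding inner_A_matrix[OF z] by (simp add: inner_add_right)
  moreover have "(\<Sum>i\<in>UNIV. z $ i * resid i ?m * (X $ i \<bullet> v))
      = (\<Sum>i\<in>UNIV. z $ i * y $ i * (X $ i \<bullet> v)) - (\<Sum>i\<in>UNIV. z $ i * (X $ i \<bullet> v) * (X $ i \<bullet> ?m))"
    by (simp add: sum_subtractf[symmetric] algebra_simps)
  ultimately show ?thesis
    by (simp add: matrix_vector_mult_diff_distrib inner_diff_right algebra_simps)
qed

text \<open>Minus twice the logarithm of the \<open>\<beta>\<close>-dependent factor of the joint posterior density.\<close>

definition misfit :: "real \<Rightarrow> real ^ 'm \<Rightarrow> real ^ 'p \<Rightarrow> real" where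
  "misfit s z b = (\<Sum>i\<in>UNIV. z $ i * (resid i b)\<^sup>2) / s + (b - \<mu>) \<bullet> (\<Sigma>inv *v (b - \<mu>))"

lemma complete_square:
  assumes s: "0 < s" and z: "\<And>i. 0 < z $ i"
  shows "misfit s z b = (b - bmean s z) \<bullet> (H_matrix s z *v (b - bmean s z)) + misfit s z (bmean s z)"
proof -
  define m where "m = bmean s z"
  define v where "v = b - m"
  have b: "b = m + v" by (simp add: v_def)
  have "(\<Sum>i\<in>UNIV. z $ i * (resid i b)\<^sup>2)
      = (\<Sum>i\<in>UNIV. z $ i * (resid i m)\<^sup>2 - 2 * (z $ i * resid i m * (X $ i \<bullet> v)) + z $ i * (X $ i \<bullet> v) * (X $ i \<bullet> v))"
    unfolding b by (intro sum.cong) (auto simp: inner_add_right power2_eq_square algebra_simps)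
  also have "\<dots> = (\<Sum>i\<in>UNIV. z $ i * (resid i m)\<^sup>2) - 2 * (s * (v \<bullet> (\<Sigma>inv *v (m - \<mu>))))
      + (\<Sum>i\<in>UNIV. z $ i * (X $ i \<bullet> v) * (X $ i \<bullet> v))"
    unfolding normal_equations[OF assms, of v, folded m_def, symmetric]
    by (simp add: sum.distrib sum_subtractf sum_distrib_left)
  finally have 1: "(\<Sum>i\<in>UNIV. z $ i * (resid i b)\<^sup>2) / s
      = (\<Sum>i\<in>UNIV. z $ i * (resid i m)\<^sup>2) / s - 2 * (v \<bullet> (\<Sigma>inv *v (m - \<mu>)))
        + (\<Sum>i\<in>UNIV. z $ i * (X $ i \<bullet> v) * (X $ i \<bullet> v)) / s"
    using s by (simp add: add_divide_distrib diff_divide_distrib)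
  have "b - \<mu> = (m - \<mu>) + v" by (simp add: b)
  then have 2: "(b - \<mu>) \<bullet> (\<Sigma>inv *v (b - \<mu>))
      = (m - \<mu>) \<bullet> (\<Sigma>inv *v (m - \<mu>)) + 2 * (v \<bullet> (\<Sigma>inv *v (m - \<mu>))) + v \<bullet> (\<Sigma>inv *v v)"
    by (simp only: matrix_vector_right_distrib inner_add_left inner_add_right \<Sigma>inv_sym[of "m - \<mu>" v])
  show ?thesis
    unfolding m_def[symmetric] v_def[symmetric] inner_H_matrix[OF assms] misfit_def 1 2 by simp
qed

abbreviation bdens where "bdens \<equiv> beta_density y X \<mu> \<Sigma>"
abbreviation sdens where "sdens \<equiv> sigma2_density y X \<alpha> \<gamma>"
abbreviation zdens where "zdens \<equiv> z_density y X h"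

definition beta_normalizer :: "real \<Rightarrow> real ^ 'm \<Rightarrow> real" where
  "beta_normalizer s z = exp (- misfit s z (bmean s z) / 2) * sqrt ((2 * pi) ^ CARD('p) / det (H_matrix s z))"

lemma beta_density_misfit:
  assumes s: "0 < s" and z: "\<And>i. 0 < z $ i"
  shows "exp (- misfit s z b / 2) = beta_normalizer s z * bdens s z b" and "0 < beta_normalizer s z" and "0 < bdens s z b"
    and "bdens s z b = mvn_density (bmean s z) (matrix_inv (H_matrix s z)) b"
proof -
  note H = H_matrix_pos_def[OF assms]
  define N where "N = sqrt ((2 * pi) ^ CARD('p) / det (H_matrix s z))"
  have N: "0 < N" using pos_def_det[OF H] by (simp add: N_def)
  show 1: "bdens s z b = mvn_density (bmean s z) (matrix_inv (H_matrix s z)) b"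
    by (simp add: beta_density_def scaled_beta_cov[OF assms])
  have 2: "bdens s z b = exp (- ((b - bmean s z) \<bullet> (H_matrix s z *v (b - bmean s z))) / 2) / N"
    unfolding 1 mvn_density_of_precision[OF H] N_def ..
  show "0 < bdens s z b" using N by (simp add: 2)
  show "0 < beta_normalizer s z" unfolding beta_normalizer_def N_def[symmetric] using N by simp
  show "exp (- misfit s z b / 2) = beta_normalizer s z * bdens s z b"
    unfolding complete_square[OF assms, of b] 2 beta_normalizer_def N_def[symmetric]
    using N by (simp add: exp_add[symmetric] field_simps)
qed

lemma nn_integral_beta_density:
  assumes s: "0 < s" and z: "\<And>i. 0 < z $ i"
  shows "(\<integral>\<^sup>+b. ennreal (bdens s z b) \<partial>lborel) = 1"
  using nn_integral_mvn_density[OF H_matrix_pos_def[OF assms]] by (simp add: beta_density_misfit(4)[OF assms])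

definition shape :: real where "shape = real CARD('m) / 2 + \<alpha>"

text \<open>Scale parameter of the inverse gamma law of \<open>\<sigma>\<^sup>2\<close>; \<open>shape\<close> is its shape parameter.\<close>

definition rate :: "real ^ 'p \<Rightarrow> real ^ 'm \<Rightarrow> real" where
  "rate b z = ((\<Sum>i\<in>UNIV. z $ i * (resid i b)\<^sup>2) + 2 * \<gamma>) / 2"

lemma shape_gt_1: "1 < shape" and rate_ge: "(\<And>i. 0 < z $ i) \<Longrightarrow> \<gamma> \<le> rate b z"
proof -
  show "1 < shape" using card_ge_2 \<alpha>_pos by (simp add: shape_def)
  show "\<gamma> \<le> rate b z" if "\<And>i. 0 < z $ i"
    using sum_nonneg[of UNIV "\<lambda>i. z $ i * (resid i b)\<^sup>2"] that by (simp add: rate_def less_imp_le)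
qed

lemma rate_pos: "(\<And>i. 0 < z $ i) \<Longrightarrow> 0 < rate b z"
  using rate_ge[of z b] \<gamma>_pos by simp

lemma sigma2_density_eq:
  assumes z: "\<And>i. 0 < z $ i"
  shows "sdens b z = inv_gamma_density shape (rate b z)"
proof -
  have "(y - X *v b) \<bullet> (matrix_inv (Q_matrix z) *v (y - X *v b)) = (\<Sum>i\<in>UNIV. z $ i * (resid i b)\<^sup>2)"
    by (simp add: inner_vec_def[of "y - X *v b"] matrix_inv_Q_vector[OF z] matrix_vector_mul_component[of X] power2_eq_square mult_ac)
  then show ?thesis by (simp add: sigma2_density_def shape_def rate_def)
qed

lemma sdens_pos: "0 < s \<Longrightarrow> (\<And>i. 0 < z $ i) \<Longrightarrow> 0 < sdens b z s"
  using shape_gt_1 rate_pos[of z b] by (simp add: sigma2_density_eq inv_gamma_density_pos)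

lemma nn_integral_sdens: "(\<And>i. 0 < z $ i) \<Longrightarrow> (\<integral>\<^sup>+s. ennreal (sdens b z s) \<partial>pos_reals) = 1"
  using shape_gt_1 rate_pos[of z b] by (simp add: sigma2_density_eq nn_integral_inv_gamma_density)

definition prior_b :: "real ^ 'p \<Rightarrow> real" where
  "prior_b b = exp (- ((b - \<mu>) \<bullet> (\<Sigma>inv *v (b - \<mu>))) / 2)"

text \<open>The joint posterior kernel integrated over the latent variables.\<close>

definition marginal_kernel :: "(real ^ 'p) \<times> real \<Rightarrow> real" where
  "marginal_kernel = (\<lambda>(b, s). (\<Prod>i\<in>UNIV. z_norm i b s / sqrt (2 * pi * s)) * s powr (- \<alpha> - 1) * exp (- \<gamma> / s) * prior_b b)"

abbreviation joint where "joint \<equiv> joint_posterior_kernel y X h \<alpha> \<gamma> \<mu> \<Sigma>"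

lemma marginal_kernel_pos: "0 < s \<Longrightarrow> 0 < marginal_kernel (b, s)"
  unfolding marginal_kernel_def prod.case prior_b_def by (intro mult_pos_pos prod_pos divide_pos_pos) (auto intro: z_norm_pos)

text \<open>The joint posterior kernel as a multiple of each full conditional: first as a function of \<open>z\<close>, then of
  \<open>s\<close>, then of \<open>\<beta>\<close>.\<close>

lemma joint_z: 
  assumes s: "0 < s"
  shows "joint ((b, s), z) = marginal_kernel (b, s) * zdens b s z"
proof -
  have "sqrt (z $ i) / sqrt (2 * pi * s) * exp (- (z $ i / 2) * ((resid i b)\<^sup>2 / s)) * h (z $ i)
      = z_norm i b s / sqrt (2 * pi * s) * z_component_density y X h i b s (z $ i)" for i
    using z_norm_pos[OF s, of i b] by (simp add: zdens_eq z_kernel_def)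
  then show ?thesis
    unfolding joint_posterior_kernel_def marginal_kernel_def z_density_def prior_b_def prod.case
    by (simp only: prod.distrib mult_ac)
qed

lemma joint_s:
  assumes z: "\<And>i. 0 < z $ i"
  shows "\<exists>c\<ge>0. \<forall>s>0. joint ((b, s), z) = c * sdens b z s"
proof -
  let ?C = "(\<Prod>i\<in>UNIV. sqrt (z $ i) * h (z $ i)) / sqrt (2 * pi) ^ CARD('m) * prior_b b"
  let ?k = "rate b z powr shape / Gamma shape"
  have C: "0 \<le> ?C" unfolding prior_b_def
    using z h_nonneg by (intro mult_nonneg_nonneg divide_nonneg_nonneg prod_nonneg) (auto simp: less_imp_le)
  have k: "0 < ?k" using Gamma_real_pos[of shape] shape_gt_1 rate_pos[OF z, of b] by simp
  have "joint ((b, s), z) = ?C / ?k * sdens b z s" if s: "0 < s" for s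
  proof -
    have "(\<Prod>i\<in>UNIV. sqrt (z $ i) / sqrt (2 * pi * s) * exp (- (z $ i / 2) * ((resid i b)\<^sup>2 / s)) * h (z $ i))
        = (\<Prod>i\<in>UNIV. (sqrt (z $ i) * h (z $ i)) * (1 / sqrt (2 * pi)) * (1 / sqrt s) * exp (- (z $ i / 2) * ((resid i b)\<^sup>2 / s)))"
      by (intro prod.cong) (auto simp: real_sqrt_mult)
    also have "\<dots> = (\<Prod>i\<in>UNIV. sqrt (z $ i) * h (z $ i)) * (1 / sqrt (2 * pi)) ^ CARD('m) * (1 / sqrt s) ^ CARD('m)
        * exp (\<Sum>i\<in>UNIV. - (z $ i / 2) * ((resid i b)\<^sup>2 / s))"
      by (simp only: prod.distrib exp_sum[OF finite] prod_constant)
    also have "(\<Sum>i\<in>UNIV. - (z $ i / 2) * ((resid i b)\<^sup>2 / s)) = - (\<Sum>i\<in>UNIV. z $ i * (resid i b)\<^sup>2) / 2 / s"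
      by (simp add: sum_negf sum_divide_distrib)
    also have "(1 / sqrt s) ^ CARD('m) = s powr (- (real CARD('m) / 2))"
    proof -
      have "sqrt s ^ CARD('m) = s powr (real CARD('m) / 2)"
        using s by (simp add: powr_half_sqrt[symmetric] powr_realpow[symmetric] powr_powr)
      then show ?thesis by (simp add: power_one_over powr_minus_divide)
    qed
    finally have "joint ((b, s), z) = ?C * (s powr (- (real CARD('m) / 2)) * s powr (- \<alpha> - 1))
        * (exp (- (\<Sum>i\<in>UNIV. z $ i * (resid i b)\<^sup>2) / 2 / s) * exp (- \<gamma> / s))"
      unfolding joint_posterior_kernel_def prior_b_def prod.case by (simp add: power_one_over)
    also have "s powr (- (real CARD('m) / 2)) * s powr (- \<alpha> - 1) = s powr (- shape - 1)"
      by (subst powr_add[symmetric], rule arg_cong[of _ _ "\<lambda>t. s powr t"]) (simp add: shape_def)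
    also have "exp (- (\<Sum>i\<in>UNIV. z $ i * (resid i b)\<^sup>2) / 2 / s) * exp (- \<gamma> / s) = exp (- rate b z / s)"
      using s by (simp add: rate_def exp_add[symmetric] field_simps)
    also have "?C * s powr (- shape - 1) * exp (- rate b z / s) = ?C / ?k * sdens b z s"
    proof -
      have "C * P * E = C / K * (K * P * E)" if "0 < K" for C P E K :: real using that by simp
      from this[OF k] show ?thesis unfolding sigma2_density_eq[OF z] inv_gamma_density_def .
    qed
    finally show ?thesis .
  qed
  moreover have "0 \<le> ?C / ?k" using C k by (rule divide_nonneg_pos)
  ultimately show ?thesis by blast
qed

lemma joint_b:
  assumes s: "0 < s" and z: "\<And>i. 0 < z $ i"
  shows "\<exists>d\<ge>0. \<forall>b. joint ((b, s), z) = d * bdens s z b"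
proof -
  let ?D = "(\<Prod>i\<in>UNIV. sqrt (z $ i) / sqrt (2 * pi * s) * h (z $ i)) * s powr (- \<alpha> - 1) * exp (- \<gamma> / s)"
  have D: "0 \<le> ?D"
    using z h_nonneg s by (intro mult_nonneg_nonneg prod_nonneg) (auto simp: less_imp_le)
  have "joint ((b, s), z) = ?D * beta_normalizer s z * bdens s z b" for b
  proof -
    have "(\<Prod>i\<in>UNIV. sqrt (z $ i) / sqrt (2 * pi * s) * exp (- (z $ i / 2) * ((resid i b)\<^sup>2 / s)) * h (z $ i))
        = (\<Prod>i\<in>UNIV. sqrt (z $ i) / sqrt (2 * pi * s) * h (z $ i)) * exp (\<Sum>i\<in>UNIV. - (z $ i / 2) * ((resid i b)\<^sup>2 / s))"
      unfolding prod.distrib[symmetric] exp_sum[OF finite] by (intro prod.cong) (simp_all only: mult_ac)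
    moreover have "(\<Sum>i\<in>UNIV. - (z $ i / 2) * ((resid i b)\<^sup>2 / s)) = - ((\<Sum>i\<in>UNIV. z $ i * (resid i b)\<^sup>2) / s) / 2"
      by (simp add: sum_negf sum_divide_distrib mult_ac)
    ultimately have "joint ((b, s), z) = ?D * (exp (- ((\<Sum>i\<in>UNIV. z $ i * (resid i b)\<^sup>2) / s) / 2) *
        exp (- ((b - \<mu>) \<bullet> (\<Sigma>inv *v (b - \<mu>))) / 2))"
      unfolding joint_posterior_kernel_def prod.case by simp
    also have "exp (- ((\<Sum>i\<in>UNIV. z $ i * (resid i b)\<^sup>2) / s) / 2) * exp (- ((b - \<mu>) \<bullet> (\<Sigma>inv *v (b - \<mu>))) / 2)
        = exp (- misfit s z b / 2)"
      by (simp add: misfit_def exp_add[symmetric] add_divide_distrib)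
    also have "\<dots> = beta_normalizer s z * bdens s z b" by (rule beta_density_misfit(1)[OF assms])
    finally show ?thesis by simp
  qed
  then show ?thesis using D beta_density_misfit(2)[OF assms] by (intro exI[of _ "?D * beta_normalizer s z"]) auto
qed

lemma misfit_measurable:
  assumes f[measurable]: "f \<in> borel_measurable N" and g: "g \<in> N \<rightarrow>\<^sub>M pos_vectors" and k[measurable]: "k \<in> borel_measurable N"
  shows "(\<lambda>x. misfit (f x) (g x) (k x)) \<in> borel_measurable N"
proof -
  have [measurable]: "(\<lambda>x. g x $ i) \<in> borel_measurable N" for i
    by (rule pos_reals_borel[OF measurable_compose[OF g pos_vectors_coordinate]])
  show ?thesis unfolding misfit_def by measurable
qed

lemma zdens_joint_measurable:
  "(\<lambda>(b, s, z). ennreal (zdens b s z)) \<in> borel_measurable (lborel \<Otimes>\<^sub>M (pos_reals \<Otimes>\<^sub>M pos_vectors))"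
proof -
  let ?N = "(lborel :: (real ^ 'p) measure) \<Otimes>\<^sub>M (pos_reals \<Otimes>\<^sub>M (pos_vectors :: (real ^ 'm) measure))"
  have b: "fst \<in> borel_measurable ?N" using measurable_fst[of "lborel :: (real ^ 'p) measure"] by simp
  have s: "(\<lambda>x. fst (snd x)) \<in> borel_measurable ?N"
    by (rule pos_reals_borel) measurable
  have z: "(\<lambda>x. snd (snd x) $ i) \<in> ?N \<rightarrow>\<^sub>M pos_reals" for i
    by (rule measurable_compose[OF _ pos_vectors_coordinate]) measurable
  have [measurable]: "(\<lambda>x. zk i (fst x) (fst (snd x)) (snd (snd x) $ i)) \<in> borel_measurable ?N" for i
    using b s z by (rule z_kernel_measurable_gen)
  have [measurable]: "(\<lambda>x. z_norm i (fst x) (fst (snd x))) \<in> borel_measurable ?N" for i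
    using b s by (rule z_norm_measurable)
  show ?thesis unfolding case_prod_beta' z_density_def zdens_eq by measurable
qed

lemma sdens_joint_measurable:
  "(\<lambda>(b, z, s). ennreal (sdens b z s)) \<in> borel_measurable (lborel \<Otimes>\<^sub>M (pos_vectors \<Otimes>\<^sub>M pos_reals))"
proof -
  let ?N = "(lborel :: (real ^ 'p) measure) \<Otimes>\<^sub>M ((pos_vectors :: (real ^ 'm) measure) \<Otimes>\<^sub>M pos_reals)"
  have [measurable]: "fst \<in> borel_measurable ?N" using measurable_fst[of "lborel :: (real ^ 'p) measure"] by simp
  have [measurable]: "(\<lambda>x. snd (snd x)) \<in> borel_measurable ?N"
    by (rule pos_reals_borel) measurable
  have [measurable]: "(\<lambda>x. fst (snd x) $ i) \<in> borel_measurable ?N" for i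
    by (rule pos_reals_borel[OF measurable_compose[OF _ pos_vectors_coordinate]]) measurable
  have "(\<lambda>x. ennreal (inv_gamma_density shape (rate (fst x) (fst (snd x))) (snd (snd x)))) \<in> borel_measurable ?N"
    unfolding inv_gamma_density_def rate_def by measurable
  then show ?thesis
    by (rule measurable_cong[THEN iffD1, rotated])
       (auto simp: space_pair_measure space_pos_vectors sigma2_density_eq)
qed

text \<open>The normal density is written with a matrix inverse and a determinant that depend on \<open>s\<close> and \<open>z\<close>.
  As a quotient of an explicit function by its integral it is visibly measurable in all variables.\<close>

lemma bdens_ratio:
  assumes s: "0 < s" and z: "\<And>i. 0 < z $ i"
  shows "ennreal (bdens s z b) = ennreal (exp (- misfit s z b / 2)) / (\<integral>\<^sup>+b'. ennreal (exp (- misfit s z b' / 2)) \<partial>lborel)"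
proof -
  note bd = beta_density_misfit[OF assms]
  have meas: "(\<lambda>b. ennreal (bdens s z b)) \<in> borel_measurable lborel"
  proof -
    have "bdens s z b = exp (- misfit s z b / 2) / beta_normalizer s z" for b using bd(1)[of b] bd(2) by simp
    moreover have "misfit s z \<in> borel_measurable lborel" unfolding misfit_def by measurable
    ultimately show ?thesis by simp
  qed
  have "(\<integral>\<^sup>+b'. ennreal (exp (- misfit s z b' / 2)) \<partial>lborel)
      = (\<integral>\<^sup>+b'. ennreal (beta_normalizer s z) * ennreal (bdens s z b') \<partial>lborel)"
    unfolding bd(1) using bd(2,3) by (intro nn_integral_cong ennreal_mult) (auto intro: less_imp_le)
  also have "\<dots> = ennreal (beta_normalizer s z)"
    using meas by (simp add: nn_integral_cmult nn_integral_beta_density[OF assms])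
  finally show ?thesis unfolding bd(1)[of b] using bd(2) bd(3)[of b] by (simp add: divide_ennreal)
qed

lemma bdens_joint_measurable:
  "(\<lambda>(s, z, b). ennreal (bdens s z b)) \<in> borel_measurable (pos_reals \<Otimes>\<^sub>M (pos_vectors \<Otimes>\<^sub>M lborel))"
proof -
  let ?N = "pos_reals \<Otimes>\<^sub>M ((pos_vectors :: (real ^ 'm) measure) \<Otimes>\<^sub>M (lborel :: (real ^ 'p) measure))"
  have s: "fst \<in> borel_measurable ?N" by (rule pos_reals_borel) measurable
  have b: "(\<lambda>x. snd (snd x)) \<in> borel_measurable ?N"
  proof -
    have "(\<lambda>x. snd (snd x)) \<in> ?N \<rightarrow>\<^sub>M (lborel :: (real ^ 'p) measure)" by measurable
    then show ?thesis by simp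
  qed
  have [measurable]: "(\<lambda>x. misfit (fst x) (fst (snd x)) (snd (snd x))) \<in> borel_measurable ?N"
    using s _ b by (rule misfit_measurable) measurable
  have s': "(\<lambda>w. fst (fst w)) \<in> borel_measurable (?N \<Otimes>\<^sub>M (lborel :: (real ^ 'p) measure))"
    by (rule pos_reals_borel) measurable
  have b': "snd \<in> borel_measurable (?N \<Otimes>\<^sub>M (lborel :: (real ^ 'p) measure))"
    using measurable_snd[of ?N "lborel :: (real ^ 'p) measure"] by simp
  have [measurable]: "(\<lambda>w. misfit (fst (fst w)) (fst (snd (fst w))) (snd w)) \<in> borel_measurable (?N \<Otimes>\<^sub>M (lborel :: (real ^ 'p) measure))"
    using s' _ b' by (rule misfit_measurable) measurable
  have "(\<lambda>x. ennreal (exp (- misfit (fst x) (fst (snd x)) (snd (snd x)) / 2)) /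
      (\<integral>\<^sup>+b'. ennreal (exp (- misfit (fst x) (fst (snd x)) b' / 2)) \<partial>lborel)) \<in> borel_measurable ?N"
    by measurable
  then show ?thesis
    by (rule measurable_cong[THEN iffD1, rotated])
       (auto simp: space_pair_measure space_pos_vectors space_pos_reals bdens_ratio)
qed

sublocale gibbs: latent_gibbs "lborel :: (real ^ 'p) measure" pos_reals "pos_vectors :: (real ^ 'm) measure"
  "\<lambda>s z b. ennreal (bdens s z b)" "\<lambda>b z s. ennreal (sdens b z s)" "\<lambda>b s z. ennreal (zdens b s z)"
proof (intro latent_gibbs.intro latent_gibbs_axioms.intro)
  show "sigma_finite_measure (lborel :: (real ^ 'p) measure)" by (rule sigma_finite_lborel)
  show "sigma_finite_measure pos_reals" by (rule sigma_finite_pos_reals)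
  show "sigma_finite_measure (pos_vectors :: (real ^ 'm) measure)" by (rule sigma_finite_pos_vectors)
  show "(\<lambda>(s, z, b). ennreal (bdens s z b)) \<in> borel_measurable (pos_reals \<Otimes>\<^sub>M (pos_vectors \<Otimes>\<^sub>M lborel))"
    by (rule bdens_joint_measurable)
  show "(\<lambda>(b, z, s). ennreal (sdens b z s)) \<in> borel_measurable (lborel \<Otimes>\<^sub>M (pos_vectors \<Otimes>\<^sub>M pos_reals))"
    by (rule sdens_joint_measurable)
  show "(\<lambda>(b, s, z). ennreal (zdens b s z)) \<in> borel_measurable (lborel \<Otimes>\<^sub>M (pos_reals \<Otimes>\<^sub>M pos_vectors))"
    by (rule zdens_joint_measurable)
qed (auto simp: space_pos_reals space_pos_vectors nn_integral_beta_density nn_integral_sdens nn_integral_z_density)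

end

section \<open>The posterior distribution\<close>

context scale_mixture_regression
begin

lemma marginal_kernel_measurable[measurable]: "marginal_kernel \<in> borel_measurable (lborel \<Otimes>\<^sub>M pos_reals)"
proof -
  let ?N = "(lborel :: (real ^ 'p) measure) \<Otimes>\<^sub>M pos_reals"
  have [measurable]: "fst \<in> borel_measurable ?N" using measurable_fst[of "lborel :: (real ^ 'p) measure"] by simp
  have [measurable]: "snd \<in> borel_measurable ?N" by (rule pos_reals_borel) measurable
  have [measurable]: "(\<lambda>x. z_norm i (fst x) (snd x)) \<in> borel_measurable ?N" for i
    by (rule z_norm_measurable) measurable
  show ?thesis unfolding marginal_kernel_def prior_b_def case_prod_beta' by measurable
qed

definition marginal_mass :: ennreal where
  "marginal_mass = (\<integral>\<^sup>+x. ennreal (marginal_kernel x) \<partial>(lborel \<Otimes>\<^sub>M pos_reals))"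

lemma nn_integral_state_nonzero:
  assumes f[measurable]: "f \<in> borel_measurable (lborel \<Otimes>\<^sub>M pos_reals)"
    and pos: "\<And>b s. 0 < s \<Longrightarrow> f (b, s) \<noteq> 0"
  shows "(\<integral>\<^sup>+x. f x \<partial>((lborel :: (real ^ 'p) measure) \<Otimes>\<^sub>M pos_reals)) \<noteq> 0"
proof
  assume "(\<integral>\<^sup>+x. f x \<partial>((lborel :: (real ^ 'p) measure) \<Otimes>\<^sub>M pos_reals)) = 0"
  then have "AE x in lborel \<Otimes>\<^sub>M pos_reals. f x = 0"
    by (subst (asm) nn_integral_0_iff_AE) measurable
  moreover have "f x \<noteq> 0" if "x \<in> space (lborel \<Otimes>\<^sub>M pos_reals)" for x
    using that pos[of "snd x" "fst x"] by (auto simp: space_pair_measure space_pos_reals)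
  ultimately have "AE x in lborel \<Otimes>\<^sub>M pos_reals :: ((real ^ 'p) \<times> real) measure. False"
    by (auto elim!: AE_mp)
  then have "emeasure (lborel \<Otimes>\<^sub>M pos_reals) (UNIV \<times> {0<..} :: ((real ^ 'p) \<times> real) set) = 0"
    by (subst (asm) AE_iff_measurable[OF sets.top]) (auto simp: space_pair_measure space_pos_reals)
  moreover have "emeasure (lborel \<Otimes>\<^sub>M pos_reals) (UNIV \<times> {0<..} :: ((real ^ 'p) \<times> real) set)
      = emeasure lborel (UNIV :: (real ^ 'p) set) * emeasure pos_reals {0<..}"
    by (rule gibbs.MS.emeasure_pair_measure_Times) (auto simp: sets_restrict_space_iff)
  moreover have "emeasure pos_reals {0<..} \<noteq> 0"
  proof -
    have "emeasure lborel {0<..<1::real} \<le> emeasure lborel {0::real<..}" by (intro emeasure_mono) auto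
    then show ?thesis by (subst emeasure_restrict_space) auto
  qed
  ultimately show False by simp
qed

lemma marginal_mass_nonzero: "marginal_mass \<noteq> 0"
  unfolding marginal_mass_def
proof (rule nn_integral_state_nonzero)
  show "ennreal (marginal_kernel (b, s)) \<noteq> 0" if "0 < s" for b s
    using marginal_kernel_pos[OF that, of b] by (simp add: ennreal_eq_0_iff not_le)
qed measurable

text \<open>By \<open>z_norm_growth\<close> the integrand is at most a multiple of
  \<open>(1 + s\<^sup>-\<^sup>m\<^sup>/\<^sup>2) s\<^sup>-\<^sup>\<alpha>\<^sup>-\<^sup>1 exp (- \<gamma> / s)\<close> times the Gaussian prior, that is, a sum of two products of an inverse
  gamma and a normal kernel.\<close>

lemma marginal_mass_finite: "marginal_mass < \<infinity>"
proof -
  obtain C where C: "\<And>i. 0 \<le> C i" "\<And>i b s. 0 < s \<Longrightarrow> z_norm i b s \<le> C i * (1 + sqrt s)"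
    using z_norm_growth by metis
  define D where "D = (\<Prod>i\<in>UNIV. C i / sqrt (2 * pi)) * 2 ^ CARD('m)"
  have D: "0 \<le> D" using C by (auto simp: D_def intro!: mult_nonneg_nonneg prod_nonneg)
  define k where "k a = Gamma a / \<gamma> powr a" for a
  have k: "0 < k a" "s powr (- a - 1) * exp (- \<gamma> / s) = k a * inv_gamma_density a \<gamma> s" if "0 < a" for a s
  proof -
    have "Gamma a \<noteq> 0" "0 < Gamma a" using Gamma_real_pos[OF that] by auto
    then show "0 < k a" "s powr (- a - 1) * exp (- \<gamma> / s) = k a * inv_gamma_density a \<gamma> s"
      using \<gamma>_pos by (simp_all add: k_def inv_gamma_density_def)
  qed
  have sh: "0 < shape" using shape_gt_1 by simp
  have bound: "marginal_kernel (b, s) \<le> prior_b b * (D * k \<alpha> * inv_gamma_density \<alpha> \<gamma> s + D * k shape * inv_gamma_density shape \<gamma> s)"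
    if s: "0 < s" for b s
  proof -
    have "(\<Prod>i\<in>UNIV. z_norm i b s / sqrt (2 * pi * s)) \<le> (\<Prod>i\<in>UNIV. C i / sqrt (2 * pi) * (1 + 1 / sqrt s))"
    proof (rule prod_mono, intro conjI)
      fix i
      show "0 \<le> z_norm i b s / sqrt (2 * pi * s)" using z_norm_pos[OF s, of i b] s by simp
      have "z_norm i b s / sqrt (2 * pi * s) \<le> C i * (1 + sqrt s) / sqrt (2 * pi * s)"
        using C(2)[OF s] s by (intro divide_right_mono) auto
      also have "\<dots> = C i / sqrt (2 * pi) * (1 + 1 / sqrt s)"
        using s by (simp add: real_sqrt_mult field_simps)
      finally show "z_norm i b s / sqrt (2 * pi * s) \<le> C i / sqrt (2 * pi) * (1 + 1 / sqrt s)" .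
    qed
    also have "\<dots> = (\<Prod>i\<in>UNIV. C i / sqrt (2 * pi)) * (1 + 1 / sqrt s) ^ CARD('m)"
      by (simp only: prod.distrib prod_constant)
    also have "\<dots> \<le> (\<Prod>i\<in>UNIV. C i / sqrt (2 * pi)) * (2 ^ CARD('m) * (1 + (1 / sqrt s) ^ CARD('m)))"
      using C s by (intro mult_left_mono one_plus_power_le prod_nonneg) auto
    also have "\<dots> = D * (1 + (1 / sqrt s) ^ CARD('m))" by (simp add: D_def)
    also have "(1 / sqrt s) ^ CARD('m) = s powr (- (real CARD('m) / 2))"
    proof -
      have "sqrt s ^ CARD('m) = s powr (real CARD('m) / 2)"
        using s by (simp add: powr_half_sqrt[symmetric] powr_realpow[symmetric] powr_powr)
      then show ?thesis by (simp add: power_one_over powr_minus_divide)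
    qed
    finally have P: "(\<Prod>i\<in>UNIV. z_norm i b s / sqrt (2 * pi * s)) \<le> D * (1 + s powr (- (real CARD('m) / 2)))" .
    have e: "s powr (- (real CARD('m) / 2)) * s powr (- \<alpha> - 1) = s powr (- shape - 1)"
      by (subst powr_add[symmetric], rule arg_cong[of _ _ "\<lambda>t. s powr t"]) (simp add: shape_def)
    have "marginal_kernel (b, s) \<le> D * (1 + s powr (- (real CARD('m) / 2))) * s powr (- \<alpha> - 1) * exp (- \<gamma> / s) * prior_b b"
      unfolding marginal_kernel_def prod.case using P by (intro mult_right_mono) (auto simp: prior_b_def)
    also have "\<dots> = prior_b b * (D * (s powr (- \<alpha> - 1) * exp (- \<gamma> / s)) + D * (s powr (- shape - 1) * exp (- \<gamma> / s)))"
      unfolding e[symmetric] by (simp add: algebra_simps)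
    also have "\<dots> = prior_b b * (D * k \<alpha> * inv_gamma_density \<alpha> \<gamma> s + D * k shape * inv_gamma_density shape \<gamma> s)"
      unfolding k(2)[OF \<alpha>_pos] k(2)[OF sh] by simp
    finally show ?thesis .
  qed
  have [measurable]: "inv_gamma_density a \<gamma> \<in> borel_measurable pos_reals" for a
    by (rule measurable_pos_reals_id) measurable
  have "marginal_mass = (\<integral>\<^sup>+b. \<integral>\<^sup>+s. ennreal (marginal_kernel (b, s)) \<partial>pos_reals \<partial>lborel)"
    unfolding marginal_mass_def by (subst gibbs.MS.nn_integral_fst[symmetric]) auto
  also have "\<dots> \<le> (\<integral>\<^sup>+b. \<integral>\<^sup>+s. ennreal (prior_b b) * (ennreal (D * k \<alpha>) * ennreal (inv_gamma_density \<alpha> \<gamma> s)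
      + ennreal (D * k shape) * ennreal (inv_gamma_density shape \<gamma> s)) \<partial>pos_reals \<partial>lborel)"
  proof (intro nn_integral_mono)
    fix b :: "real ^ 'p" and s assume "s \<in> space pos_reals"
    then have s: "0 < s" by (simp add: space_pos_reals)
    have i: "0 \<le> inv_gamma_density \<alpha> \<gamma> s" "0 \<le> inv_gamma_density shape \<gamma> s"
      using inv_gamma_density_pos[OF \<alpha>_pos \<gamma>_pos s] inv_gamma_density_pos[OF sh \<gamma>_pos s] by auto
    have p: "0 \<le> prior_b b" "0 \<le> D * k \<alpha>" "0 \<le> D * k shape"
      using D k(1)[OF \<alpha>_pos] k(1)[OF sh] by (auto simp: prior_b_def)
    have "ennreal (marginal_kernel (b, s)) \<le> ennreal (prior_b b * (D * k \<alpha> * inv_gamma_density \<alpha> \<gamma> s + D * k shape * inv_gamma_density shape \<gamma> s))"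
      by (rule ennreal_leI[OF bound[OF s]])
    also have "\<dots> = ennreal (prior_b b) * (ennreal (D * k \<alpha>) * ennreal (inv_gamma_density \<alpha> \<gamma> s)
      + ennreal (D * k shape) * ennreal (inv_gamma_density shape \<gamma> s))"
      using i p by (simp only: ennreal_mult ennreal_plus mult_nonneg_nonneg add_nonneg_nonneg)
    finally show "ennreal (marginal_kernel (b, s)) \<le> ennreal (prior_b b) * (ennreal (D * k \<alpha>) * ennreal (inv_gamma_density \<alpha> \<gamma> s)
      + ennreal (D * k shape) * ennreal (inv_gamma_density shape \<gamma> s))" .
  qed
  also have "\<dots> = (\<integral>\<^sup>+b. ennreal (prior_b b) * (ennreal (D * k \<alpha>) + ennreal (D * k shape)) \<partial>lborel)"
    by (simp add: nn_integral_cmult nn_integral_add nn_integral_inv_gamma_density \<alpha>_pos \<gamma>_pos sh)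
  also have "\<dots> = (\<integral>\<^sup>+b. ennreal (prior_b b) \<partial>lborel) * (ennreal (D * k \<alpha>) + ennreal (D * k shape))"
    unfolding prior_b_def by (rule nn_integral_multc) measurable
  also have "(\<integral>\<^sup>+b. ennreal (prior_b b) \<partial>lborel) = ennreal (sqrt ((2 * pi) ^ CARD('p) / det \<Sigma>inv))"
    unfolding prior_b_def by (rule nn_integral_gaussian[OF \<Sigma>inv_pos_def])
  also have "\<dots> * (ennreal (D * k \<alpha>) + ennreal (D * k shape)) < \<infinity>"
    by (simp add: ennreal_mult_less_top)
  finally show ?thesis .
qed

definition posterior :: "(real ^ 'p) \<times> real \<Rightarrow> ennreal" where
  "posterior x = ennreal (marginal_kernel x) / marginal_mass"

lemma posterior_measurable[measurable]: "posterior \<in> borel_measurable (lborel \<Otimes>\<^sub>M pos_reals)"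
  unfolding posterior_def by measurable

lemma joint_eq_marginal:
  assumes "s \<in> space pos_reals" "z \<in> space pos_vectors"
  shows "ennreal (joint ((b, s), z)) = ennreal (marginal_kernel (b, s)) * ennreal (zdens b s z)"
proof -
  have s: "0 < s" and z: "\<And>i. 0 < z $ i" using assms by (auto simp: space_pos_reals space_pos_vectors)
  show ?thesis unfolding joint_z[OF s] using marginal_kernel_pos[OF s, of b] z_density_nonneg[OF s z]
    by (intro ennreal_mult) auto
qed

lemma posterior_zdens:
  assumes "s \<in> space pos_reals" "z \<in> space pos_vectors"
  shows "posterior (b, s) * ennreal (zdens b s z) = ennreal (joint ((b, s), z)) / marginal_mass"
  unfolding joint_eq_marginal[OF assms] posterior_def by (simp add: divide_ennreal_def mult_ac)

lemma posterior_s_conditional: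
  assumes "z \<in> space pos_vectors"
  shows "\<exists>c. \<forall>s\<in>space pos_reals. posterior (b, s) * ennreal (zdens b s z) = c * ennreal (sdens b z s)"
proof -
  have z: "\<And>i. 0 < z $ i" using assms by (auto simp: space_pos_vectors)
  obtain c where c: "0 \<le> c" "\<And>s. 0 < s \<Longrightarrow> joint ((b, s), z) = c * sdens b z s" using joint_s[OF z] by blast
  have "posterior (b, s) * ennreal (zdens b s z) = ennreal c / marginal_mass * ennreal (sdens b z s)" if "s \<in> space pos_reals" for s
  proof -
    have s: "0 < s" using that by (simp add: space_pos_reals)
    show ?thesis unfolding posterior_zdens[OF that assms] c(2)[OF s]
      using c(1) sdens_pos[OF s z, of b] by (simp add: divide_ennreal_def ennreal_mult mult_ac)
  qed
  then show ?thesis by blast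
qed

lemma posterior_b_conditional:
  assumes "s \<in> space pos_reals" "z \<in> space pos_vectors"
  shows "\<exists>d. \<forall>b\<in>space lborel. posterior (b, s) * ennreal (zdens b s z) = d * ennreal (bdens s z b)"
proof -
  have s: "0 < s" and z: "\<And>i. 0 < z $ i" using assms by (auto simp: space_pos_reals space_pos_vectors)
  obtain d where d: "0 \<le> d" "\<And>b. joint ((b, s), z) = d * bdens s z b" using joint_b[OF s z] by blast
  have "posterior (b, s) * ennreal (zdens b s z) = ennreal d / marginal_mass * ennreal (bdens s z b)" for b
    unfolding posterior_zdens[OF assms] d(2)
    using d(1) beta_density_misfit(3)[OF s z, of b] by (simp add: divide_ennreal_def ennreal_mult mult_ac)
  then show ?thesis by blast
qed

lemma marginal_posterior_density:
  "marginal_posterior y X h \<alpha> \<gamma> \<mu> \<Sigma> = density (lborel \<Otimes>\<^sub>M pos_reals) posterior"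
proof (rule measure_eqI)
  let ?BS = "(lborel :: (real ^ 'p) measure) \<Otimes>\<^sub>M pos_reals"
  let ?V = "pos_vectors :: (real ^ 'm) measure"
  have [measurable]: "(\<lambda>w. ennreal (zdens (fst (fst w)) (snd (fst w)) (snd w))) \<in> borel_measurable (?BS \<Otimes>\<^sub>M ?V)"
    by (rule gibbs.pz_measurable) measurable
  have eq: "ennreal (joint w) = ennreal (marginal_kernel (fst w)) * ennreal (zdens (fst (fst w)) (snd (fst w)) (snd w))"
    if "w \<in> space (?BS \<Otimes>\<^sub>M ?V)" for w
    using joint_eq_marginal[of "snd (fst w)" "snd w" "fst (fst w)"] that by (auto simp: space_pair_measure)
  have jm[measurable]: "(\<lambda>w. ennreal (joint w)) \<in> borel_measurable (?BS \<Otimes>\<^sub>M ?V)"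
  proof (rule measurable_cong[THEN iffD2, OF eq])
    show "(\<lambda>w. ennreal (marginal_kernel (fst w)) * ennreal (zdens (fst (fst w)) (snd (fst w)) (snd w))) \<in> borel_measurable (?BS \<Otimes>\<^sub>M ?V)"
      by measurable
  qed
  have int: "(\<integral>\<^sup>+w. ennreal (joint w) * f (fst w) \<partial>(?BS \<Otimes>\<^sub>M ?V)) = (\<integral>\<^sup>+x. ennreal (marginal_kernel x) * f x \<partial>?BS)"
    if f[measurable]: "f \<in> borel_measurable ?BS" for f
  proof -
    have "(\<integral>\<^sup>+w. ennreal (joint w) * f (fst w) \<partial>(?BS \<Otimes>\<^sub>M ?V)) = (\<integral>\<^sup>+x. \<integral>\<^sup>+z. ennreal (joint (x, z)) * f x \<partial>?V \<partial>?BS)"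
      by (subst gibbs.MZ.nn_integral_fst[symmetric]) auto
    also have "\<dots> = (\<integral>\<^sup>+x. ennreal (marginal_kernel x) * f x \<partial>?BS)"
    proof (rule nn_integral_cong)
      fix x assume x: "x \<in> space ?BS"
      then have s: "snd x \<in> space pos_reals" by (auto simp: space_pair_measure)
      have "(\<integral>\<^sup>+z. ennreal (joint (x, z)) * f x \<partial>?V)
          = (\<integral>\<^sup>+z. ennreal (marginal_kernel x) * f x * ennreal (zdens (fst x) (snd x) z) \<partial>?V)"
        using joint_eq_marginal[OF s, of _ "fst x"] by (intro nn_integral_cong) (simp add: mult_ac)
      also have "\<dots> = ennreal (marginal_kernel x) * f x"
        using gibbs.pz_measurable[of "\<lambda>_. fst x" ?V "\<lambda>_. snd x" "\<lambda>z. z"] s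
        by (subst nn_integral_cmult) (auto simp: nn_integral_z_density space_pos_reals)
      finally show "(\<integral>\<^sup>+z. ennreal (joint (x, z)) * f x \<partial>?V) = ennreal (marginal_kernel x) * f x" .
    qed
    finally show ?thesis .
  qed
  have tot: "(\<integral>\<^sup>+w. ennreal (joint w) \<partial>(?BS \<Otimes>\<^sub>M ?V)) = marginal_mass"
    using int[of "\<lambda>_. 1"] by (simp add: marginal_mass_def)
  show "sets (marginal_posterior y X h \<alpha> \<gamma> \<mu> \<Sigma>) = sets (density ?BS posterior)"
    by (simp add: marginal_posterior_def state_space_pair)
  fix E assume "E \<in> sets (marginal_posterior y X h \<alpha> \<gamma> \<mu> \<Sigma>)"
  then have E[measurable]: "E \<in> sets ?BS" by (simp add: marginal_posterior_def state_space_pair)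
  have E': "fst -` E \<inter> space (?BS \<Otimes>\<^sub>M ?V) \<in> sets (?BS \<Otimes>\<^sub>M ?V)"
    using measurable_sets[OF measurable_fst E] .
  have "emeasure (marginal_posterior y X h \<alpha> \<gamma> \<mu> \<Sigma>) E
      = emeasure (density (?BS \<Otimes>\<^sub>M ?V) (\<lambda>w. ennreal (joint w) / marginal_mass)) (fst -` E \<inter> space (?BS \<Otimes>\<^sub>M ?V))"
    unfolding marginal_posterior_def joint_posterior_def normalized_measure_def state_space_pair tot
    by (subst emeasure_distr[OF _ E]) simp_all
  also have "\<dots> = (\<integral>\<^sup>+w. ennreal (joint w) / marginal_mass * indicator (fst -` E \<inter> space (?BS \<Otimes>\<^sub>M ?V)) w \<partial>(?BS \<Otimes>\<^sub>M ?V))"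
    using E' by (intro emeasure_density) measurable
  also have "\<dots> = (\<integral>\<^sup>+w. ennreal (joint w) * (indicator E (fst w) / marginal_mass) \<partial>(?BS \<Otimes>\<^sub>M ?V))"
    by (intro nn_integral_cong) (auto simp: divide_ennreal_def mult_ac split: split_indicator)
  also have "\<dots> = (\<integral>\<^sup>+x. ennreal (marginal_kernel x) * (indicator E x / marginal_mass) \<partial>?BS)"
    by (rule int) measurable
  also have "\<dots> = (\<integral>\<^sup>+x. posterior x * indicator E x \<partial>?BS)"
    by (simp add: posterior_def divide_ennreal_def mult_ac)
  also have "\<dots> = emeasure (density ?BS posterior) E" by (rule emeasure_density[OF posterior_measurable E, symmetric])
  finally show "emeasure (marginal_posterior y X h \<alpha> \<gamma> \<mu> \<Sigma>) E = emeasure (density ?BS posterior) E" .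
qed

lemma prob_space_posterior: "prob_space (marginal_posterior y X h \<alpha> \<gamma> \<mu> \<Sigma>)"
proof (rule prob_spaceI)
  let ?BS = "(lborel :: (real ^ 'p) measure) \<Otimes>\<^sub>M pos_reals"
  have "emeasure (density ?BS posterior) (space ?BS) = (\<integral>\<^sup>+x. posterior x \<partial>?BS)"
    by (subst emeasure_density[OF posterior_measurable sets.top]) (auto intro!: nn_integral_cong)
  also have "\<dots> = marginal_mass / marginal_mass" unfolding posterior_def marginal_mass_def by (rule nn_integral_divide) measurable
  also have "\<dots> = 1" using marginal_mass_nonzero marginal_mass_finite by (intro ennreal_divide_self) auto
  finally show "emeasure (marginal_posterior y X h \<alpha> \<gamma> \<mu> \<Sigma>) (space (marginal_posterior y X h \<alpha> \<gamma> \<mu> \<Sigma>)) = 1"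
    by (simp add: marginal_posterior_density)
qed

lemma state_nonempty: "space ((lborel :: (real ^ 'p) measure) \<Otimes>\<^sub>M pos_reals) \<noteq> {}"
proof -
  have "(1::real) \<in> {0<..}" by simp
  then show ?thesis by (auto simp: space_pair_measure space_pos_reals)
qed

text \<open>Outside the state space the two sides may differ, since there the densities need not be nonnegative
  and the product of the real densities need not be the product of the \<open>ennreal\<close> ones.\<close>

lemma systematic_scan_gibbs:
  "x \<in> space state_space \<Longrightarrow> systematic_scan_kernel y X h \<alpha> \<gamma> \<mu> \<Sigma> x = gibbs.systematic x"
proof -
  assume "x \<in> space (state_space :: ((real ^ 'p) \<times> real) measure)"
  then have s': "0 < snd x" by (auto simp: space_restrict_space)
  have "(\<integral>\<^sup>+z. ennreal (bdens s z b * sdens (fst x) z s * zdens (fst x) (snd x) z) \<partial>pos_vectors)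
      = (\<integral>\<^sup>+z. ennreal (bdens s z b) * ennreal (sdens (fst x) z s) * ennreal (zdens (fst x) (snd x) z) \<partial>pos_vectors)"
    if s: "0 < s" for b s
  proof (rule nn_integral_cong)
    fix z assume "z \<in> space (pos_vectors :: (real ^ 'm) measure)"
    then have z: "\<And>i. 0 < z $ i" by (simp add: space_pos_vectors)
    show "ennreal (bdens s z b * sdens (fst x) z s * zdens (fst x) (snd x) z)
        = ennreal (bdens s z b) * ennreal (sdens (fst x) z s) * ennreal (zdens (fst x) (snd x) z)"
      using beta_density_misfit(3)[OF s z, of b] sdens_pos[OF s z, of "fst x"] z_density_nonneg[OF s' z, of "fst x"]
      by (simp add: ennreal_mult)
  qed
  then show ?thesis
    unfolding systematic_scan_kernel_def systematic_density_def gibbs.systematic_def state_space_pair case_prod_beta'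
    by (intro density_cong_space) (auto simp: space_pair_measure space_pos_reals)
qed

lemma hybrid_scan_gibbs: "hybrid_scan_kernel y X h \<alpha> \<gamma> \<mu> \<Sigma> r = gibbs.hybrid r"
  unfolding hybrid_scan_kernel_def gibbs.hybrid_def state_space_pair ..

end

section \<open>Moments of the updates\<close>

context scale_mixture_regression
begin

text \<open>The quadratic function of \<open>\<beta>\<close> in the drift hypotheses, called \<open>E\<close> in comments.\<close>

definition energy :: "real ^ 'p \<Rightarrow> real" where
  "energy b = (\<Sum>i\<in>UNIV. (resid i b)\<^sup>2) + b \<bullet> (\<Sigma>inv *v b)"

lemma energy_nonneg: "0 \<le> energy b" and resid_le_energy: "(resid i b)\<^sup>2 \<le> energy b"
proof -
  have "(resid i b)\<^sup>2 \<le> (\<Sum>i\<in>UNIV. (resid i b)\<^sup>2)" by (rule member_le_sum) auto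
  then show "(resid i b)\<^sup>2 \<le> energy b" using \<Sigma>inv_nonneg[of b] by (simp add: energy_def)
  show "0 \<le> energy b" unfolding energy_def by (intro add_nonneg_nonneg sum_nonneg \<Sigma>inv_nonneg) auto
qed

lemma continuous_matrix_vector: "continuous_on S (\<lambda>v. (M :: real ^ 'n ^ 'k) *v v)"
  by (intro linear_continuous_on) (simp add: linear_conv_bounded_linear[symmetric] matrix_vector_mul_linear)

lemma energy_continuous: "continuous_on S energy"
  unfolding energy_def
  by (intro continuous_on_add continuous_on_sum continuous_on_power continuous_on_diff continuous_on_const
      continuous_on_inner continuous_on_id continuous_matrix_vector)

lemma energy_measurable[measurable]: "energy \<in> borel_measurable borel"
  by (intro borel_measurable_continuous_onI energy_continuous)

text \<open>The quadratic form attains a positive minimum on the unit sphere.\<close>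

lemma \<Sigma>inv_coercive: "\<exists>l>0. \<forall>v. l * (norm v)\<^sup>2 \<le> v \<bullet> (\<Sigma>inv *v v)"
proof -
  let ?g = "\<lambda>v. v \<bullet> (\<Sigma>inv *v v)"
  have "continuous_on (sphere 0 1) (\<lambda>v. v \<bullet> (\<Sigma>inv *v v))"
    by (rule continuous_on_inner[OF continuous_on_id continuous_matrix_vector])
  moreover have "axis undefined 1 \<in> sphere (0 :: real ^ 'p) 1" by simp
  ultimately obtain w where w: "w \<in> sphere 0 1" "\<And>v. v \<in> sphere 0 1 \<Longrightarrow> ?g w \<le> ?g v"
    using continuous_attains_inf[OF compact_sphere, of 0 1 ?g] by blast
  have "?g w * (norm v)\<^sup>2 \<le> ?g v" for v
  proof (cases "v = 0")
    case False
    define u where "u = v /\<^sub>R norm v"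
    have v: "v = norm v *\<^sub>R u" using False by (simp add: u_def)
    have "u \<in> sphere 0 1" using False by (simp add: u_def)
    then have "?g w \<le> ?g u" by (rule w(2))
    then have "?g w * (norm v)\<^sup>2 \<le> ?g u * (norm v)\<^sup>2" by (intro mult_right_mono) auto
    also have "\<dots> = ?g v" by (subst (2 3) v) (simp add: matrix_vector_mult_scaleR power2_eq_square mult_ac)
    finally show ?thesis .
  qed simp
  moreover have "0 < ?g w"
  proof -
    have "w \<noteq> 0" using w(1) by auto
    then show ?thesis using \<Sigma>inv_pos_def by (simp add: pos_def_matrix_def)
  qed
  ultimately show ?thesis by blast
qed

text \<open>The weights \<open>z\<close> and \<open>s\<close> range over a noncompact set, so continuity does not help. Suppose that the
  means are unbounded, and let \<open>l\<close> be a limit of their directions. Test the normal equations with \<open>l\<close>: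
  along the sequence each residual \<open>y\<^sub>i - x\<^sub>i\<^sup>T b\<close> eventually has sign opposite to \<open>x\<^sub>i\<^sup>T l\<close>, or
  \<open>x\<^sub>i\<^sup>T l = 0\<close>, so the left-hand side is not positive whatever the positive weights are. On the right,
  \<open>l \<bullet> \<Sigma>\<^sup>-\<^sup>1 (b - \<mu>)\<close> is eventually positive. This is the argument by which weighted least squares
  estimators are bounded uniformly in the weights.\<close>

lemma conditional_mean_bounded: "\<exists>C. \<forall>s z. 0 < s \<longrightarrow> (\<forall>i. 0 < z $ i) \<longrightarrow> norm (bmean s z) \<le> C"
proof (rule ccontr)
  assume "\<not> ?thesis"
  then have "\<forall>n::nat. \<exists>s z. 0 < s \<and> (\<forall>i. 0 < z $ i) \<and> real n + 1 < norm (bmean s z)"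
    by (metis not_le)
  then obtain S ZZ where SZ: "\<And>n. 0 < S n" "\<And>n i. 0 < ZZ n $ i" "\<And>n. real n + 1 < norm (bmean (S n) (ZZ n))"
    by metis
  define b where "b n = bmean (S n) (ZZ n)" for n
  define u where "u n = b n /\<^sub>R norm (b n)" for n
  have nb: "real n + 1 < norm (b n)" for n using SZ(3) by (simp add: b_def)
  then have nb0: "0 < norm (b n)" for n by (smt (verit) of_nat_0_le_iff)
  have "u n \<in> sphere 0 1" for n using nb0[of n] by (simp add: u_def)
  then obtain l \<sigma> where l: "l \<in> sphere 0 1" and \<sigma>: "strict_mono \<sigma>" and lim: "(u \<circ> \<sigma>) \<longlonglongrightarrow> l"
    using compact_sphere[of "0 :: real ^ 'p" 1] unfolding compact_def by metis
  have inv: "(\<lambda>n. 1 / norm (b (\<sigma> n))) \<longlonglongrightarrow> 0"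
  proof (rule tendsto_sandwich[OF _ _ tendsto_const LIMSEQ_inverse_real_of_nat])
    show "\<forall>\<^sub>F n in sequentially. 0 \<le> 1 / norm (b (\<sigma> n))" by simp
    show "\<forall>\<^sub>F n in sequentially. 1 / norm (b (\<sigma> n)) \<le> inverse (real (Suc n))"
    proof (rule always_eventually, rule allI)
      fix n
      have "real (Suc n) \<le> real (\<sigma> n) + 1" using seq_suble[OF \<sigma>, of n] by simp
      also have "\<dots> \<le> norm (b (\<sigma> n))" using nb[of "\<sigma> n"] by simp
      finally show "1 / norm (b (\<sigma> n)) \<le> inverse (real (Suc n))"
        by (simp add: inverse_eq_divide frac_le)
    qed
  qed
  have limu: "(\<lambda>n. u (\<sigma> n)) \<longlonglongrightarrow> l" using lim by (simp add: o_def)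
  have bu: "b n = norm (b n) *\<^sub>R u n" for n using nb0[of n] by (simp add: u_def)
  have ev1: "\<forall>\<^sub>F n in sequentially. resid i (b (\<sigma> n)) * (X $ i \<bullet> l) \<le> 0" for i
  proof (cases "X $ i \<bullet> l = 0")
    case False
    have "(\<lambda>n. (y $ i * (1 / norm (b (\<sigma> n))) - X $ i \<bullet> u (\<sigma> n)) * (X $ i \<bullet> l)) \<longlonglongrightarrow> (y $ i * 0 - X $ i \<bullet> l) * (X $ i \<bullet> l)"
      by (intro tendsto_intros inv limu)
    moreover have "(y $ i * 0 - X $ i \<bullet> l) * (X $ i \<bullet> l) < 0" using False by (simp add: not_sum_squares_lt_zero flip: power2_eq_square)
    ultimately have "\<forall>\<^sub>F n in sequentially. (y $ i * (1 / norm (b (\<sigma> n))) - X $ i \<bullet> u (\<sigma> n)) * (X $ i \<bullet> l) < 0"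
      by (rule order_tendstoD)
    then show ?thesis
    proof (rule eventually_mono)
      fix n assume neg: "(y $ i * (1 / norm (b (\<sigma> n))) - X $ i \<bullet> u (\<sigma> n)) * (X $ i \<bullet> l) < 0"
      have "resid i (b (\<sigma> n)) = norm (b (\<sigma> n)) * (y $ i * (1 / norm (b (\<sigma> n))) - X $ i \<bullet> u (\<sigma> n))"
        using nb0[of "\<sigma> n"] by (subst bu) (simp add: right_diff_distrib)
      then have "resid i (b (\<sigma> n)) * (X $ i \<bullet> l)
          = norm (b (\<sigma> n)) * ((y $ i * (1 / norm (b (\<sigma> n))) - X $ i \<bullet> u (\<sigma> n)) * (X $ i \<bullet> l))" by simp
      also have "\<dots> \<le> 0" by (rule mult_nonneg_nonpos[OF less_imp_le[OF nb0] less_imp_le[OF neg]])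
      finally show "resid i (b (\<sigma> n)) * (X $ i \<bullet> l) \<le> 0" .
    qed
  qed simp
  have ev2: "\<forall>\<^sub>F n in sequentially. 0 < l \<bullet> (\<Sigma>inv *v (b (\<sigma> n) - \<mu>))"
  proof -
    have "(\<lambda>n. l \<bullet> (\<Sigma>inv *v u (\<sigma> n)) - (1 / norm (b (\<sigma> n))) * (l \<bullet> (\<Sigma>inv *v \<mu>))) \<longlonglongrightarrow> l \<bullet> (\<Sigma>inv *v l) - 0 * (l \<bullet> (\<Sigma>inv *v \<mu>))"
      by (intro tendsto_intros inv bounded_linear.tendsto[OF _ limu])
         (simp add: linear_conv_bounded_linear[symmetric] matrix_vector_mul_linear)
    moreover have "0 < l \<bullet> (\<Sigma>inv *v l) - 0 * (l \<bullet> (\<Sigma>inv *v \<mu>))"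
    proof -
      have "l \<noteq> 0" using l by auto
      then show ?thesis using \<Sigma>inv_pos_def by (simp add: pos_def_matrix_def)
    qed
    ultimately have "\<forall>\<^sub>F n in sequentially. 0 < l \<bullet> (\<Sigma>inv *v u (\<sigma> n)) - (1 / norm (b (\<sigma> n))) * (l \<bullet> (\<Sigma>inv *v \<mu>))"
      by (rule order_tendstoD)
    then show ?thesis
    proof (rule eventually_mono)
      fix n assume pos: "0 < l \<bullet> (\<Sigma>inv *v u (\<sigma> n)) - (1 / norm (b (\<sigma> n))) * (l \<bullet> (\<Sigma>inv *v \<mu>))"
      have "l \<bullet> (\<Sigma>inv *v (b (\<sigma> n) - \<mu>)) = norm (b (\<sigma> n)) * (l \<bullet> (\<Sigma>inv *v u (\<sigma> n)) - (1 / norm (b (\<sigma> n))) * (l \<bullet> (\<Sigma>inv *v \<mu>)))"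
        using nb0[of "\<sigma> n"]
        by (subst bu) (simp add: matrix_vector_mult_diff_distrib matrix_vector_mult_scaleR inner_diff_right right_diff_distrib)
      also have "0 < \<dots>" using pos nb0 by (intro mult_pos_pos)
      finally show "0 < l \<bullet> (\<Sigma>inv *v (b (\<sigma> n) - \<mu>))" .
    qed
  qed
  have "\<forall>\<^sub>F n in sequentially. (\<forall>i. resid i (b (\<sigma> n)) * (X $ i \<bullet> l) \<le> 0) \<and> 0 < l \<bullet> (\<Sigma>inv *v (b (\<sigma> n) - \<mu>))"
    using ev1 ev2 by (intro eventually_conj) (auto simp: eventually_all_finite)
  then obtain n where n: "\<And>i. resid i (b (\<sigma> n)) * (X $ i \<bullet> l) \<le> 0" "0 < l \<bullet> (\<Sigma>inv *v (b (\<sigma> n) - \<mu>))"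
    using eventually_happens'[OF sequentially_bot] by blast
  have "(\<Sum>i\<in>UNIV. ZZ (\<sigma> n) $ i * resid i (b (\<sigma> n)) * (X $ i \<bullet> l)) \<le> 0"
    using n(1) SZ(2) by (intro sum_nonpos) (simp add: mult.assoc mult_nonneg_nonpos less_imp_le)
  moreover have "0 < S (\<sigma> n) * (l \<bullet> (\<Sigma>inv *v (b (\<sigma> n) - \<mu>)))" using n(2) SZ(1) by simp
  ultimately show False
    using normal_equations[OF SZ(1) SZ(2), of "\<sigma> n" "\<sigma> n" l] by (simp add: b_def)
qed

lemma residual_sum_le: "(\<Sum>i\<in>UNIV. (X $ i \<bullet> v)\<^sup>2) \<le> (\<Sum>i\<in>UNIV. (norm (X $ i))\<^sup>2) * (norm v)\<^sup>2"
  unfolding sum_distrib_right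
proof (rule sum_mono)
  fix i
  have "\<bar>X $ i \<bullet> v\<bar> \<le> norm (X $ i) * norm v" by (rule Cauchy_Schwarz_ineq2)
  then have "\<bar>X $ i \<bullet> v\<bar>\<^sup>2 \<le> (norm (X $ i) * norm v)\<^sup>2" by (rule power_mono) simp
  then show "(X $ i \<bullet> v)\<^sup>2 \<le> (norm (X $ i))\<^sup>2 * (norm v)\<^sup>2" by (simp add: power_mult_distrib)
qed

text \<open>Both parts of \<open>E\<close> are quadratic; \<open>\<Sigma>inv_coercive\<close> bounds the residual part of the increment by the
  prior part.\<close>

lemma energy_increment_le: "\<exists>k\<ge>0. \<forall>m v. energy (m + v) \<le> 2 * energy m + k * (v \<bullet> (\<Sigma>inv *v v))"
proof -
  obtain l where l: "0 < l" "\<And>v. l * (norm v)\<^sup>2 \<le> v \<bullet> (\<Sigma>inv *v v)" using \<Sigma>inv_coercive by blast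
  define c where "c = (\<Sum>i\<in>UNIV. (norm (X $ i))\<^sup>2)"
  have c: "0 \<le> c" unfolding c_def by (intro sum_nonneg) simp
  have "energy (m + v) \<le> 2 * energy m + (2 * (c / l) + 2) * (v \<bullet> (\<Sigma>inv *v v))" for m v
  proof -
    let ?Q = "\<lambda>v. v \<bullet> (\<Sigma>inv *v v)"
    have r: "(resid i (m + v))\<^sup>2 \<le> 2 * (resid i m)\<^sup>2 + 2 * (X $ i \<bullet> v)\<^sup>2" for i
      using zero_le_power2[of "resid i m + X $ i \<bullet> v"] by (simp add: inner_add_right power2_eq_square algebra_simps)
    have "(\<Sum>i\<in>UNIV. (resid i (m + v))\<^sup>2) \<le> 2 * (\<Sum>i\<in>UNIV. (resid i m)\<^sup>2) + 2 * (\<Sum>i\<in>UNIV. (X $ i \<bullet> v)\<^sup>2)"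
      using sum_mono[of UNIV, OF r] by (simp add: sum.distrib sum_distrib_left)
    moreover have "(\<Sum>i\<in>UNIV. (X $ i \<bullet> v)\<^sup>2) \<le> c / l * ?Q v"
    proof -
      have "c / l * (l * (norm v)\<^sup>2) \<le> c / l * ?Q v" using l c by (intro mult_left_mono) auto
      moreover have "c / l * (l * (norm v)\<^sup>2) = c * (norm v)\<^sup>2" using l by simp
      ultimately show ?thesis using residual_sum_le[of v] by (simp add: c_def)
    qed
    moreover have "?Q (m + v) \<le> 2 * ?Q m + 2 * ?Q v"
    proof -
      have "?Q (m + v) + ?Q (m - v) = 2 * ?Q m + 2 * ?Q v"
        by (simp add: matrix_vector_right_distrib matrix_vector_mult_diff_distrib inner_add_left inner_add_right
            inner_diff_left inner_diff_right)
      then show ?thesis using \<Sigma>inv_nonneg[of "m - v"] by linarith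
    qed
    moreover have "(2 * (c / l) + 2) * ?Q v = 2 * (c / l * ?Q v) + 2 * ?Q v" by (simp add: algebra_simps)
    moreover have "A + B \<le> 2 * (A1 + B1) + P"
      if "A \<le> 2 * A1 + 2 * A2" "A2 \<le> k" "B \<le> 2 * B1 + 2 * V" "P = 2 * k + 2 * V"
      for A A1 A2 B B1 P V k :: real using that by simp
    ultimately show ?thesis unfolding energy_def by blast
  qed
  then show ?thesis using l c by (intro exI[of _ "2 * (c / l) + 2"]) auto
qed

text \<open>Write \<open>b\<close> as its conditional mean plus a deviation. The mean lies in a fixed ball. The deviation
  enters through \<open>\<Sigma>\<^sup>-\<^sup>1\<close>, which is dominated by the conditional precision matrix.\<close>

lemma beta_update_bound:
  "\<exists>C\<ge>0. \<forall>s z. 0 < s \<longrightarrow> (\<forall>i. 0 < z $ i) \<longrightarrow>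
    (\<integral>\<^sup>+b. ennreal (bdens s z b) * ennreal (energy b) \<partial>lborel) \<le> ennreal C"
proof -
  obtain k where k: "0 \<le> k" "\<And>m v. energy (m + v) \<le> 2 * energy m + k * (v \<bullet> (\<Sigma>inv *v v))" using energy_increment_le by blast
  obtain B where B: "\<And>s z. 0 < s \<Longrightarrow> (\<And>i. 0 < z $ i) \<Longrightarrow> norm (bmean s z) \<le> B"
    using conditional_mean_bounded by blast
  have "\<exists>Cq. \<forall>m\<in>cball 0 B. energy m \<le> Cq"
  proof (cases "cball (0 :: real ^ 'p) B = {}")
    case False
    then show ?thesis
      using continuous_attains_sup[OF compact_cball False energy_continuous] by blast
  qed simp
  then obtain Cq where Cq': "\<forall>m\<in>cball 0 B. energy m \<le> Cq" by blast
  have Cq: "energy m \<le> Cq" if "norm m \<le> B" for m using Cq' that by simp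
  define G where "G = 4 * sqrt (2 ^ CARD('p))"
  have "(\<integral>\<^sup>+b. ennreal (bdens s z b) * ennreal (energy b) \<partial>lborel) \<le> ennreal (2 * \<bar>Cq\<bar> + k * G)"
    if s: "0 < s" and z: "\<And>i. 0 < z $ i" for s z
  proof -
    define m where "m = bmean s z"
    define d where "d b = mvn_density m (matrix_inv (H_matrix s z)) b" for b
    have bd: "bdens s z b = d b" for b using beta_density_misfit(4)[OF s z] by (simp add: d_def m_def)
    have d0: "0 \<le> d b" for b using beta_density_misfit(3)[OF s z, of b] by (simp add: bd)
    have dm[measurable]: "d \<in> borel_measurable borel"
      unfolding d_def[abs_def] mvn_density_def by measurable
    let ?Q = "\<lambda>b. (b - m) \<bullet> (H_matrix s z *v (b - m))"
    have Q0: "0 \<le> ?Q b" for b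
      using H_matrix_pos_def[OF s z] by (cases "b = m") (auto simp: pos_def_matrix_def less_imp_le)
    have qb: "energy b \<le> 2 * \<bar>Cq\<bar> + k * ?Q b" for b
    proof -
      have "energy b \<le> 2 * energy m + k * ((b - m) \<bullet> (\<Sigma>inv *v (b - m)))" using k(2)[of m "b - m"] by simp
      moreover have "energy m \<le> \<bar>Cq\<bar>" using Cq[of m] B[OF s z] by (simp add: m_def)
      moreover have "(b - m) \<bullet> (\<Sigma>inv *v (b - m)) \<le> ?Q b"
      proof -
        have "0 \<le> (\<Sum>i\<in>UNIV. z $ i * (X $ i \<bullet> (b - m)) * (X $ i \<bullet> (b - m))) / s"
          using z s by (intro divide_nonneg_pos sum_nonneg) (auto simp: mult.assoc less_imp_le)
        then show ?thesis unfolding inner_H_matrix[OF s z] by simp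
      qed
      then have "k * ((b - m) \<bullet> (\<Sigma>inv *v (b - m))) \<le> k * ?Q b" using k(1) by (rule mult_left_mono)
      ultimately show ?thesis by linarith
    qed
    have "(\<integral>\<^sup>+b. ennreal (bdens s z b) * ennreal (energy b) \<partial>lborel)
        \<le> (\<integral>\<^sup>+b. ennreal (2 * \<bar>Cq\<bar>) * ennreal (d b) + ennreal k * (ennreal (?Q b) * ennreal (d b)) \<partial>lborel)"
    proof (rule nn_integral_mono)
      fix b
      have "ennreal (bdens s z b) * ennreal (energy b) \<le> ennreal (d b) * ennreal (2 * \<bar>Cq\<bar> + k * ?Q b)"
        unfolding bd using qb by (intro mult_left_mono ennreal_leI) auto
      also have "\<dots> = ennreal (2 * \<bar>Cq\<bar>) * ennreal (d b) + ennreal k * (ennreal (?Q b) * ennreal (d b))"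
        using k(1) Q0[of b] by (simp add: ennreal_mult distrib_left mult_ac)
      finally show "ennreal (bdens s z b) * ennreal (energy b) \<le> \<dots>" .
    qed
    also have "\<dots> = ennreal (2 * \<bar>Cq\<bar>) * (\<integral>\<^sup>+b. ennreal (d b) \<partial>lborel) + ennreal k * (\<integral>\<^sup>+b. ennreal (?Q b) * ennreal (d b) \<partial>lborel)"
      by (subst nn_integral_add) (auto simp: nn_integral_cmult)
    also have "\<dots> \<le> ennreal (2 * \<bar>Cq\<bar>) * 1 + ennreal k * ennreal G"
      using mvn_mean_quadratic_form_le[OF H_matrix_pos_def[OF s z], of m] nn_integral_mvn_density[OF H_matrix_pos_def[OF s z], of m]
      unfolding d_def G_def by (intro add_mono mult_left_mono) auto
    also have "\<dots> = ennreal (2 * \<bar>Cq\<bar> + k * G)"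
      using k(1) by (simp add: ennreal_mult G_def)
    finally show ?thesis .
  qed
  moreover have "0 \<le> 2 * \<bar>Cq\<bar> + k * G" using k(1) by (simp add: G_def)
  ultimately show ?thesis by blast
qed

definition residual_ratio :: "real ^ 'p \<Rightarrow> real \<Rightarrow> real" where
  "residual_ratio b s = (\<Sum>i\<in>UNIV. z_mean y X h i b s * (resid i b)\<^sup>2) / (real CARD('m) + 2 * \<alpha> - 2)"

definition sigma2_const :: real where
  "sigma2_const = \<gamma> / (shape - 1) + shape / \<gamma>"

lemma denominator: "real CARD('m) + 2 * \<alpha> - 2 = 2 * (shape - 1)" "0 < real CARD('m) + 2 * \<alpha> - 2"
  using shape_gt_1 by (auto simp: shape_def)

lemma sigma2_const_nonneg: "0 \<le> sigma2_const"
  using shape_gt_1 \<gamma>_pos by (simp add: sigma2_const_def)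

lemma pos_reals_id[measurable]: "(\<lambda>v. v) \<in> borel_measurable pos_reals"
  by (rule measurable_pos_reals_id) simp

lemma pos_vectors_pos: "z \<in> space (pos_vectors :: (real ^ 'm) measure) \<Longrightarrow> 0 < z $ i"
  by (simp add: space_pos_vectors)

text \<open>The mean of \<open>1 / \<sigma>\<^sup>2\<close> is bounded because the scale parameter is at least \<open>\<gamma>\<close>, and the mean of \<open>\<sigma>\<^sup>2\<close>
  is finite because \<open>m \<ge> 2\<close> makes the shape parameter exceed one.\<close>

lemma sigma2_conditional_moment:
  assumes z: "\<And>i. 0 < z $ i"
  shows "(\<integral>\<^sup>+v. ennreal (sdens b z v) * ennreal (v + 1 / v) \<partial>pos_reals)
    \<le> ennreal ((\<Sum>i\<in>UNIV. z $ i * (resid i b)\<^sup>2) / (real CARD('m) + 2 * \<alpha> - 2) + sigma2_const)"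
proof -
  let ?a = shape and ?r = "rate b z"
  have sh: "1 < ?a" "0 < ?a" using shape_gt_1 by auto
  have r: "0 < ?r" "\<gamma> \<le> ?r" using rate_pos[OF z] rate_ge[OF z] by auto
  have [measurable]: "inv_gamma_density ?a ?r \<in> borel_measurable pos_reals"
    by (rule measurable_pos_reals_id) measurable
  have "(\<integral>\<^sup>+v. ennreal (sdens b z v) * ennreal (v + 1 / v) \<partial>pos_reals)
      = (\<integral>\<^sup>+v. ennreal (inv_gamma_density ?a ?r v) * ennreal v + ennreal (inv_gamma_density ?a ?r v) * ennreal (1 / v) \<partial>pos_reals)"
    by (intro nn_integral_cong) (simp add: space_pos_reals sigma2_density_eq[OF z] distrib_left)
  also have "\<dots> = ennreal (?r / (?a - 1)) + ennreal (?a / ?r)"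
    by (simp add: nn_integral_add inv_gamma_mean[OF sh(1) r(1)] inv_gamma_mean_inverse[OF sh(2) r(1)])
  also have "\<dots> = ennreal (?r / (?a - 1) + ?a / ?r)" using sh r by simp
  also have "\<dots> \<le> ennreal ((\<Sum>i\<in>UNIV. z $ i * (resid i b)\<^sup>2) / (real CARD('m) + 2 * \<alpha> - 2) + sigma2_const)"
  proof (rule ennreal_leI)
    have "?r / (?a - 1) = (\<Sum>i\<in>UNIV. z $ i * (resid i b)\<^sup>2) / (real CARD('m) + 2 * \<alpha> - 2) + \<gamma> / (?a - 1)"
      unfolding denominator rate_def using sh by (simp add: add_divide_distrib)
    moreover have "?a / ?r \<le> ?a / \<gamma>" using r sh \<gamma>_pos by (intro divide_left_mono) auto
    ultimately show "?r / (?a - 1) + ?a / ?r \<le> (\<Sum>i\<in>UNIV. z $ i * (resid i b)\<^sup>2) / (real CARD('m) + 2 * \<alpha> - 2) + sigma2_const"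
      by (simp add: sigma2_const_def)
  qed
  finally show ?thesis .
qed

lemma zdens_measurable_at[measurable]: "0 < s \<Longrightarrow> (\<lambda>z. ennreal (zdens b s z)) \<in> borel_measurable pos_vectors"
  using gibbs.pz_measurable[of "\<lambda>_. b" pos_vectors "\<lambda>_. s" "\<lambda>z. z"] by (simp add: space_pos_reals)

text \<open>Stated for any \<open>F\<close> that exceeds the conditional moment by a constant at most: in the systematic scan
  the constant comes from the subsequent \<open>\<beta>\<close> update, in the hybrid scan from the unchanged \<open>\<beta>\<close>.\<close>

lemma sigma2_update_bound:
  assumes s: "0 < s" and k: "0 \<le> k"
    and F: "\<And>z. (\<And>i. 0 < z $ i) \<Longrightarrow> F z \<le> (\<integral>\<^sup>+v. ennreal (sdens b z v) * ennreal (v + 1 / v) \<partial>pos_reals) + ennreal k"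
  shows "(\<integral>\<^sup>+z. ennreal (zdens b s z) * F z \<partial>pos_vectors) \<le> ennreal (residual_ratio b s + sigma2_const + k)"
proof -
  let ?D = "real CARD('m) + 2 * \<alpha> - 2"
  let ?W = "\<lambda>z. \<Sum>i\<in>UNIV. z $ i * (resid i b)\<^sup>2"
  have W0: "0 \<le> ?W z" if "\<And>i. 0 < z $ i" for z using that by (intro sum_nonneg) (simp add: less_imp_le)
  have zmean0: "0 \<le> (\<Sum>i\<in>UNIV. z_mean y X h i b s * (resid i b)\<^sup>2)"
    unfolding z_mean_def using zdens_nonneg[OF s]
    by (intro sum_nonneg mult_nonneg_nonneg integral_nonneg_AE AE_I2) (auto simp: space_pos_reals)
  have [measurable]: "(\<lambda>z. z $ i) \<in> borel_measurable (pos_vectors :: (real ^ 'm) measure)" for i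
    by (rule pos_reals_borel[OF pos_vectors_coordinate])
  have "(\<integral>\<^sup>+z. ennreal (zdens b s z) * F z \<partial>pos_vectors)
      \<le> (\<integral>\<^sup>+z. ennreal (1 / ?D) * (ennreal (zdens b s z) * ennreal (?W z)) + ennreal (sigma2_const + k) * ennreal (zdens b s z) \<partial>pos_vectors)"
  proof (rule nn_integral_mono)
    fix z assume "z \<in> space (pos_vectors :: (real ^ 'm) measure)"
    then have z: "\<And>i. 0 < z $ i" by (rule pos_vectors_pos)
    have "F z \<le> ennreal (?W z / ?D + sigma2_const) + ennreal k"
      using F[OF z] sigma2_conditional_moment[OF z, of b] by (meson add_right_mono order_trans)
    also have "\<dots> = ennreal (1 / ?D) * ennreal (?W z) + ennreal (sigma2_const + k)"
      using W0[OF z] denominator(2) sigma2_const_nonneg k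
      by (simp add: ennreal_mult[symmetric] ennreal_plus[symmetric] del: ennreal_plus)
    finally have "ennreal (zdens b s z) * F z \<le> ennreal (zdens b s z) * (ennreal (1 / ?D) * ennreal (?W z) + ennreal (sigma2_const + k))"
      by (rule mult_left_mono) simp
    then show "ennreal (zdens b s z) * F z
        \<le> ennreal (1 / ?D) * (ennreal (zdens b s z) * ennreal (?W z)) + ennreal (sigma2_const + k) * ennreal (zdens b s z)"
      by (simp add: distrib_left mult_ac)
  qed
  also have "\<dots> = ennreal (1 / ?D) * (\<integral>\<^sup>+z. ennreal (zdens b s z) * ennreal (?W z) \<partial>pos_vectors)
      + ennreal (sigma2_const + k) * (\<integral>\<^sup>+z. ennreal (zdens b s z) \<partial>pos_vectors)"
    using s by (subst nn_integral_add) (auto simp: nn_integral_cmult)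
  also have "\<dots> = ennreal (residual_ratio b s + sigma2_const + k)"
    unfolding nn_integral_weighted_residuals[OF s] nn_integral_z_density[OF s] residual_ratio_def
    using zmean0 denominator(2) sigma2_const_nonneg k
    by (simp add: ennreal_mult[symmetric] ennreal_plus[symmetric] add.assoc del: ennreal_plus)
  finally show ?thesis .
qed

end

section \<open>Drift conditions\<close>

context scale_mixture_regression
begin

text \<open>The weight \<open>c\<close> is one for the systematic scan and large for the hybrid scan.\<close>

definition lyapunov :: "real \<Rightarrow> (real ^ 'p) \<times> real \<Rightarrow> real" where
  "lyapunov c = (\<lambda>(b, s). c * energy b + (s + 1 / s))"

lemma lyapunov_measurable[measurable]: "lyapunov c \<in> borel_measurable (lborel \<Otimes>\<^sub>M pos_reals)"
proof -
  let ?N = "(lborel :: (real ^ 'p) measure) \<Otimes>\<^sub>M pos_reals"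
  have [measurable]: "fst \<in> borel_measurable ?N" using measurable_fst[of "lborel :: (real ^ 'p) measure"] by simp
  have [measurable]: "snd \<in> borel_measurable ?N" by (rule pos_reals_borel) measurable
  show ?thesis unfolding lyapunov_def case_prod_beta' by measurable
qed

lemma lyapunov_nonneg: "0 \<le> c \<Longrightarrow> 0 < s \<Longrightarrow> 0 \<le> lyapunov c (b, s)"
  by (simp add: lyapunov_def energy_nonneg)

lemma beta_update_lyapunov:
  assumes s: "0 < s" and z: "\<And>i. 0 < z $ i" and c: "0 \<le> c" and C: "0 \<le> C"
    and bound: "(\<integral>\<^sup>+b. ennreal (bdens s z b) * ennreal (energy b) \<partial>lborel) \<le> ennreal C"
  shows "(\<integral>\<^sup>+b. ennreal (bdens s z b) * ennreal (lyapunov c (b, s)) \<partial>lborel) \<le> ennreal (c * C) + ennreal (s + 1 / s)"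
proof -
  have [measurable]: "(\<lambda>b. ennreal (bdens s z b)) \<in> borel_measurable lborel"
    using gibbs.pb_measurable[of "\<lambda>_. s" lborel "\<lambda>_. z" "\<lambda>b. b"] s z by (simp add: space_pos_reals space_pos_vectors)
  have "(\<integral>\<^sup>+b. ennreal (bdens s z b) * ennreal (lyapunov c (b, s)) \<partial>lborel)
      = (\<integral>\<^sup>+b. ennreal c * (ennreal (bdens s z b) * ennreal (energy b)) + ennreal (s + 1 / s) * ennreal (bdens s z b) \<partial>lborel)"
    using c s energy_nonneg by (intro nn_integral_cong) (simp add: lyapunov_def ennreal_mult distrib_left distrib_right mult_ac)
  also have "\<dots> = ennreal c * (\<integral>\<^sup>+b. ennreal (bdens s z b) * ennreal (energy b) \<partial>lborel) + ennreal (s + 1 / s)"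
    by (subst nn_integral_add) (auto simp: nn_integral_cmult nn_integral_beta_density[OF s z])
  also have "\<dots> \<le> ennreal c * ennreal C + ennreal (s + 1 / s)"
    using bound by (intro add_mono mult_left_mono) auto
  finally show ?thesis using c C by (simp add: ennreal_mult)
qed

lemma systematic_drift:
  assumes w: "\<And>b s. 0 < s \<Longrightarrow> residual_ratio b s \<le> \<psi> * (energy b + s + 1 / s) + L"
  shows "\<exists>L'\<ge>0. \<forall>b s. 0 < s \<longrightarrow>
    (\<integral>\<^sup>+x. ennreal (lyapunov 1 x) \<partial>gibbs.systematic (b, s)) \<le> ennreal (\<psi> * lyapunov 1 (b, s) + L')"
proof -
  obtain C where C: "0 \<le> C" "\<And>s z. 0 < s \<Longrightarrow> (\<And>i. 0 < z $ i) \<Longrightarrow>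
      (\<integral>\<^sup>+b. ennreal (bdens s z b) * ennreal (energy b) \<partial>lborel) \<le> ennreal C"
    using beta_update_bound by blast
  have "(\<integral>\<^sup>+x. ennreal (lyapunov 1 x) \<partial>gibbs.systematic (b, s)) \<le> ennreal (\<psi> * lyapunov 1 (b, s) + (\<bar>L\<bar> + sigma2_const + C))"
    if s: "0 < s" for b s
  proof -
    have "(\<integral>\<^sup>+x. ennreal (lyapunov 1 x) \<partial>gibbs.systematic (b, s))
        = (\<integral>\<^sup>+z. ennreal (zdens b s z) * (\<integral>\<^sup>+v. ennreal (sdens b z v) *
            (\<integral>\<^sup>+b'. ennreal (bdens v z b') * ennreal (lyapunov 1 (b', v)) \<partial>lborel) \<partial>pos_reals) \<partial>pos_vectors)"
      using s by (subst gibbs.nn_integral_systematic) (auto simp: space_pos_reals)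
    also have "\<dots> \<le> ennreal (residual_ratio b s + sigma2_const + C)"
    proof (rule sigma2_update_bound[OF s C(1)])
      fix z :: "real ^ 'm" assume z: "\<And>i. 0 < z $ i"
      have [measurable]: "(\<lambda>v. ennreal (sdens b z v)) \<in> borel_measurable pos_reals"
        using gibbs.ps_measurable[of "\<lambda>_. b" pos_reals "\<lambda>_. z" "\<lambda>v. v"] z by (simp add: space_pos_vectors)
      have "(\<integral>\<^sup>+v. ennreal (sdens b z v) * (\<integral>\<^sup>+b'. ennreal (bdens v z b') * ennreal (lyapunov 1 (b', v)) \<partial>lborel) \<partial>pos_reals)
          \<le> (\<integral>\<^sup>+v. ennreal (sdens b z v) * (ennreal C + ennreal (v + 1 / v)) \<partial>pos_reals)"
        using beta_update_lyapunov[OF _ z, of _ 1 C] C z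
        by (intro nn_integral_mono mult_left_mono) (auto simp: space_pos_reals)
      also have "\<dots> = (\<integral>\<^sup>+v. ennreal (sdens b z v) * ennreal (v + 1 / v) + ennreal C * ennreal (sdens b z v) \<partial>pos_reals)"
        by (intro nn_integral_cong) (simp add: distrib_left mult_ac add.commute)
      also have "\<dots> = (\<integral>\<^sup>+v. ennreal (sdens b z v) * ennreal (v + 1 / v) \<partial>pos_reals) + ennreal C"
        by (subst nn_integral_add) (auto simp: nn_integral_cmult nn_integral_sdens[OF z])
      finally show "(\<integral>\<^sup>+v. ennreal (sdens b z v) * (\<integral>\<^sup>+b'. ennreal (bdens v z b') * ennreal (lyapunov 1 (b', v)) \<partial>lborel) \<partial>pos_reals)
          \<le> (\<integral>\<^sup>+v. ennreal (sdens b z v) * ennreal (v + 1 / v) \<partial>pos_reals) + ennreal C" .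
    qed
    also have "\<dots> \<le> ennreal (\<psi> * lyapunov 1 (b, s) + (\<bar>L\<bar> + sigma2_const + C))"
      using w[OF s, of b] by (intro ennreal_leI) (simp add: lyapunov_def add.assoc)
    finally show ?thesis .
  qed
  moreover have "0 \<le> \<bar>L\<bar> + sigma2_const + C" using C sigma2_const_nonneg by simp
  ultimately show ?thesis by blast
qed

text \<open>A step multiplies \<open>c E\<close> by at most \<open>r + r \<psi>2 / c\<close> and \<open>s + 1 / s\<close> by at most \<open>r \<psi>3 + 1 - r\<close>, up to
  constants.\<close>

lemma hybrid_drift:
  assumes \<psi>: "0 < \<psi>2" "0 \<le> \<psi>3" "\<psi>3 < 1" and r: "0 < r" "r < 1"
    and w: "\<And>b s. 0 < s \<Longrightarrow> residual_ratio b s \<le> \<psi>2 * energy b + \<psi>3 * (s + 1 / s) + L"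
  shows "\<exists>c>0. \<exists>g L'. 0 \<le> g \<and> g < 1 \<and> 0 \<le> L' \<and> (\<forall>b s. 0 < s \<longrightarrow>
    (\<integral>\<^sup>+x. ennreal (lyapunov c x) \<partial>gibbs.hybrid r (b, s)) \<le> ennreal (g * lyapunov c (b, s) + L'))"
proof -
  obtain C where C: "0 \<le> C" "\<And>s z. 0 < s \<Longrightarrow> (\<And>i. 0 < z $ i) \<Longrightarrow>
      (\<integral>\<^sup>+b. ennreal (bdens s z b) * ennreal (energy b) \<partial>lborel) \<le> ennreal C"
    using beta_update_bound by blast
  (* r + r \<psi>2 / c < 1 means c > r \<psi>2 / (1 - r) *)
  define c where "c = r * \<psi>2 / (1 - r) + 1"
  have c: "0 < c" using \<psi> r by (simp add: c_def add_nonneg_pos)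
  have c2: "r * c + r * \<psi>2 < c"
  proof -
    have "c * (1 - r) = r * \<psi>2 + (1 - r)" using r by (simp add: c_def field_simps)
    then show ?thesis using r by (simp add: algebra_simps)
  qed
  define g where "g = max ((r * c + r * \<psi>2) / c) (r * \<psi>3 + (1 - r))"
  have "r * \<psi>3 < r * 1" using \<psi> r by (intro mult_strict_left_mono) auto
  then have g: "0 \<le> g" "g < 1" "(r * c + r * \<psi>2) / c \<le> g" "r * \<psi>3 + (1 - r) \<le> g"
    using c c2 r \<psi> by (auto simp: g_def le_max_iff_disj)
  define L' where "L' = r * (\<bar>L\<bar> + sigma2_const) + (1 - r) * (c * C)"
  have L': "0 \<le> L'" using r c C sigma2_const_nonneg by (simp add: L'_def)
  have "(\<integral>\<^sup>+x. ennreal (lyapunov c x) \<partial>gibbs.hybrid r (b, s)) \<le> ennreal (g * lyapunov c (b, s) + L')"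
    if s: "0 < s" for b s
  proof -
    have W0: "0 \<le> residual_ratio b s"
      unfolding residual_ratio_def z_mean_def using zdens_nonneg[OF s] denominator(2)
      by (intro divide_nonneg_pos sum_nonneg mult_nonneg_nonneg integral_nonneg_AE AE_I2) (auto simp: space_pos_reals)
    have sb: "(\<integral>\<^sup>+z. ennreal (zdens b s z) * (\<integral>\<^sup>+v. ennreal (sdens b z v) * ennreal (lyapunov c (b, v)) \<partial>pos_reals) \<partial>pos_vectors)
        \<le> ennreal (residual_ratio b s + sigma2_const + c * energy b)"
    proof (rule sigma2_update_bound[OF s])
      show "0 \<le> c * energy b" using c energy_nonneg by simp
      fix z :: "real ^ 'm" assume z: "\<And>i. 0 < z $ i"
      have [measurable]: "(\<lambda>v. ennreal (sdens b z v)) \<in> borel_measurable pos_reals"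
        using gibbs.ps_measurable[of "\<lambda>_. b" pos_reals "\<lambda>_. z" "\<lambda>v. v"] z by (simp add: space_pos_vectors)
      have "(\<integral>\<^sup>+v. ennreal (sdens b z v) * ennreal (lyapunov c (b, v)) \<partial>pos_reals)
          = (\<integral>\<^sup>+v. ennreal (sdens b z v) * ennreal (v + 1 / v) + ennreal (c * energy b) * ennreal (sdens b z v) \<partial>pos_reals)"
        using c energy_nonneg by (intro nn_integral_cong) (simp add: lyapunov_def space_pos_reals distrib_left mult_ac add.commute)
      also have "\<dots> = (\<integral>\<^sup>+v. ennreal (sdens b z v) * ennreal (v + 1 / v) \<partial>pos_reals) + ennreal (c * energy b)"
        by (subst nn_integral_add) (auto simp: nn_integral_cmult nn_integral_sdens[OF z])
      finally show "(\<integral>\<^sup>+v. ennreal (sdens b z v) * ennreal (lyapunov c (b, v)) \<partial>pos_reals)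
          \<le> (\<integral>\<^sup>+v. ennreal (sdens b z v) * ennreal (v + 1 / v) \<partial>pos_reals) + ennreal (c * energy b)" by simp
    qed
    have bb: "(\<integral>\<^sup>+z. ennreal (zdens b s z) * (\<integral>\<^sup>+b'. ennreal (bdens s z b') * ennreal (lyapunov c (b', s)) \<partial>lborel) \<partial>pos_vectors)
        \<le> ennreal (c * C + (s + 1 / s))"
    proof -
      have "(\<integral>\<^sup>+z. ennreal (zdens b s z) * (\<integral>\<^sup>+b'. ennreal (bdens s z b') * ennreal (lyapunov c (b', s)) \<partial>lborel) \<partial>pos_vectors)
          \<le> (\<integral>\<^sup>+z. ennreal (zdens b s z) * ennreal (c * C + (s + 1 / s)) \<partial>pos_vectors)"
        using beta_update_lyapunov[OF s, of _ c C] C(1) C(2)[OF s] c s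
        by (intro nn_integral_mono mult_left_mono) (auto simp: space_pos_vectors)
      also have "\<dots> = ennreal (c * C + (s + 1 / s))"
        using s by (subst nn_integral_multc) (auto simp: nn_integral_z_density)
      finally show ?thesis .
    qed
    have "(\<integral>\<^sup>+x. ennreal (lyapunov c x) \<partial>gibbs.hybrid r (b, s))
        \<le> ennreal r * ennreal (residual_ratio b s + sigma2_const + c * energy b) + ennreal (1 - r) * ennreal (c * C + (s + 1 / s))"
      using s r sb bb by (subst gibbs.nn_integral_hybrid) (auto simp: space_pos_reals intro!: add_mono mult_left_mono)
    also have "\<dots> = ennreal (r * (residual_ratio b s + sigma2_const + c * energy b) + (1 - r) * (c * C + (s + 1 / s)))"
      using r W0 sigma2_const_nonneg c C energy_nonneg s
      by (subst ennreal_plus) (auto simp: ennreal_mult intro!: mult_nonneg_nonneg add_nonneg_nonneg)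
    also have "\<dots> \<le> ennreal (g * lyapunov c (b, s) + L')"
    proof (rule ennreal_leI)
      define T where "T = s + 1 / s"
      have T: "0 \<le> T" "lyapunov c (b, s) = c * energy b + T" using s by (simp_all add: T_def lyapunov_def)
      have "r * residual_ratio b s \<le> r * (\<psi>2 * energy b + \<psi>3 * T + \<bar>L\<bar>)"
        using w[OF s, of b] r by (intro mult_left_mono) (auto simp: T_def)
      moreover have "(r * c + r * \<psi>2) * energy b \<le> g * (c * energy b)"
      proof -
        have "(r * c + r * \<psi>2) / c * (c * energy b) \<le> g * (c * energy b)"
          using g(3) c energy_nonneg by (intro mult_right_mono) auto
        then show ?thesis using c by simp
      qed
      moreover have "(r * \<psi>3 + (1 - r)) * T \<le> g * T"
        using g(4) T by (intro mult_right_mono) auto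
      ultimately show "r * (residual_ratio b s + sigma2_const + c * energy b) + (1 - r) * (c * C + (s + 1 / s)) \<le> g * lyapunov c (b, s) + L'"
        unfolding T(2) T_def[symmetric] by (simp add: L'_def algebra_simps)
    qed
    finally show ?thesis .
  qed
  then show ?thesis using c g L' by blast
qed

end

section \<open>Minorization\<close>

context scale_mixture_regression
begin

text \<open>A lower bound for the density of \<open>z\<close> at every state with \<open>r\<^sub>i\<^sup>2 / s \<le> t\<close> for all residuals \<open>r\<^sub>i\<close> and
  \<open>s \<le> R\<close>: the kernel takes its smallest and the normalizing constant its largest value.\<close>

definition z_minorant :: "real \<Rightarrow> real \<Rightarrow> real ^ 'm \<Rightarrow> real" where
  "z_minorant t R z = (\<Prod>i\<in>UNIV. sqrt (z $ i) * exp (- (z $ i / 2) * t) * h (z $ i) / z_norm i (best_fit i) R)"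

text \<open>A lower bound for the density of \<open>\<sigma>\<^sup>2\<close> at every \<open>\<beta>\<close> with squared residuals at most \<open>R\<close>: the scale
  parameter is replaced by \<open>\<gamma>\<close> in the power, and by its largest value in the exponential.\<close>

definition sigma2_minorant :: "real \<Rightarrow> real ^ 'm \<Rightarrow> real \<Rightarrow> real" where
  "sigma2_minorant R z v = \<gamma> powr shape / Gamma shape * v powr (- shape - 1) * exp (- ((R * (\<Sum>i\<in>UNIV. z $ i) + 2 * \<gamma>) / 2) / v)"

lemma z_minorant_le:
  assumes s: "0 < s" "s \<le> R" and z: "\<And>i. 0 < z $ i" and t: "\<And>i. (resid i b)\<^sup>2 / s \<le> t"
  shows "z_minorant t R z \<le> zdens b s z"
  unfolding z_minorant_def z_density_def
proof (rule prod_mono, intro conjI)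
  fix i
  let ?n = "sqrt (z $ i) * exp (- (z $ i / 2) * t) * h (z $ i)"
  have R: "0 < R" using s by simp
  have n0: "0 \<le> ?n" using z[of i] h_nonneg[OF z] by simp
  then show "0 \<le> ?n / z_norm i (best_fit i) R" using z_norm_pos[OF R, of i "best_fit i"] by (intro divide_nonneg_pos)
  have "(z $ i / 2) * ((resid i b)\<^sup>2 / s) \<le> (z $ i / 2) * t"
    using t[of i] z[of i] by (intro mult_left_mono) auto
  then have "?n \<le> zk i b s (z $ i)"
    unfolding z_kernel_def using z[of i] h_nonneg[OF z] by (intro mult_right_mono mult_left_mono) auto
  then show "?n / z_norm i (best_fit i) R \<le> z_component_density y X h i b s (z $ i)"
    unfolding zdens_eq using z_norm_pos[OF s(1), of i b] z_norm_le[OF s, of i b] z_kernel_nonneg[OF z[of i], of i b s]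
    by (intro frac_le) auto
qed

lemma sigma2_minorant_pos: "0 < v \<Longrightarrow> 0 < sigma2_minorant R z v"
  using Gamma_real_pos[of shape] shape_gt_1 \<gamma>_pos by (simp add: sigma2_minorant_def)

lemma sigma2_minorant_le:
  assumes v: "0 < v" and z: "\<And>i. 0 < z $ i" and b: "energy b \<le> R"
  shows "sigma2_minorant R z v \<le> sdens b z v"
proof -
  have "(\<Sum>i\<in>UNIV. z $ i * (resid i b)\<^sup>2) \<le> (\<Sum>i\<in>UNIV. z $ i * R)"
    using z resid_le_energy[of _ b] b by (intro sum_mono mult_left_mono) (auto intro: order_trans less_imp_le)
  also have "(\<Sum>i\<in>UNIV. z $ i * R) = R * (\<Sum>i\<in>UNIV. z $ i)"
    unfolding sum_distrib_left by (intro sum.cong) auto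
  finally have "rate b z \<le> (R * (\<Sum>i\<in>UNIV. z $ i) + 2 * \<gamma>) / 2" by (simp add: rate_def)
  then have "rate b z / v \<le> (R * (\<Sum>i\<in>UNIV. z $ i) + 2 * \<gamma>) / 2 / v" using v by (intro divide_right_mono) auto
  then have e: "exp (- ((R * (\<Sum>i\<in>UNIV. z $ i) + 2 * \<gamma>) / 2) / v) \<le> exp (- rate b z / v)" by simp
  have p: "\<gamma> powr shape \<le> rate b z powr shape"
    using rate_ge[OF z] \<gamma>_pos shape_gt_1 by (intro powr_mono2) auto
  have G: "0 < Gamma shape" using Gamma_real_pos[of shape] shape_gt_1 by simp
  show ?thesis
    unfolding sigma2_minorant_def sigma2_density_eq[OF z] inv_gamma_density_def
    using e p G by (intro mult_mono divide_right_mono) auto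
qed

lemma z_minorant_measurable:
  assumes [measurable]: "f \<in> borel_measurable N" "g \<in> borel_measurable N" and k: "k \<in> N \<rightarrow>\<^sub>M pos_vectors"
  shows "(\<lambda>x. z_minorant (f x) (g x) (k x)) \<in> borel_measurable N"
proof -
  have k': "(\<lambda>x. k x $ i) \<in> N \<rightarrow>\<^sub>M pos_reals" for i by (rule measurable_compose[OF k pos_vectors_coordinate])
  have [measurable]: "(\<lambda>x. k x $ i) \<in> borel_measurable N" for i by (rule pos_reals_borel[OF k'])
  have [measurable]: "(\<lambda>x. h (k x $ i)) \<in> borel_measurable N" for i by (rule measurable_compose[OF k' h_measurable])
  have [measurable]: "(\<lambda>x. z_norm i (best_fit i) (g x)) \<in> borel_measurable N" for i by (rule z_norm_measurable) measurable
  show ?thesis unfolding z_minorant_def by measurable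
qed

lemma sigma2_minorant_measurable: "(\<lambda>(z, v). ennreal (sigma2_minorant R z v)) \<in> borel_measurable (pos_vectors \<Otimes>\<^sub>M pos_reals)"
proof -
  let ?N = "(pos_vectors :: (real ^ 'm) measure) \<Otimes>\<^sub>M pos_reals"
  have [measurable]: "(\<lambda>x. fst x $ i) \<in> borel_measurable ?N" for i
    by (rule pos_reals_borel[OF measurable_compose[OF _ pos_vectors_coordinate]]) measurable
  have [measurable]: "snd \<in> borel_measurable ?N" by (rule pos_reals_borel) measurable
  show ?thesis unfolding sigma2_minorant_def case_prod_beta' by measurable
qed

lemma z_minorant_integral_nonzero:
  assumes R: "0 < R" and g[measurable]: "g \<in> borel_measurable pos_vectors" and pos: "\<And>z. (\<And>i. 0 < z $ i) \<Longrightarrow> g z \<noteq> 0"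
  shows "(\<integral>\<^sup>+z. ennreal (z_minorant t R z) * g z \<partial>pos_vectors) \<noteq> 0"
proof
  have [measurable]: "(\<lambda>z. z_minorant t R z) \<in> borel_measurable pos_vectors" by (rule z_minorant_measurable) auto
  assume "(\<integral>\<^sup>+z. ennreal (z_minorant t R z) * g z \<partial>pos_vectors) = 0"
  then have "AE z in pos_vectors. ennreal (z_minorant t R z) * g z = 0"
    by (subst (asm) nn_integral_0_iff_AE) measurable
  then have "AE z in pos_vectors. ennreal (z_minorant t R z) = 0"
    by (rule AE_mp) (auto intro!: AE_I2 simp: space_pos_vectors pos)
  then have "(\<integral>\<^sup>+z. ennreal (z_minorant t R z) \<partial>pos_vectors) = (\<integral>\<^sup>+z. 0 \<partial>(pos_vectors :: (real ^ 'm) measure))"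
    by (rule nn_integral_cong_AE)
  moreover
  let ?w = "\<lambda>i u. sqrt u * exp (- (u / 2) * t) / z_norm i (best_fit i) R"
  have w: "?w i \<in> borel_measurable pos_reals" for i by (rule measurable_pos_reals_id) measurable
  have "(\<integral>\<^sup>+z. ennreal (z_minorant t R z) \<partial>pos_vectors)
      = (\<integral>\<^sup>+z. (\<Prod>i\<in>UNIV. ennreal (?w i (z $ i) * h (z $ i))) \<partial>pos_vectors)"
  proof (rule nn_integral_cong)
    fix z :: "real ^ 'm" assume "z \<in> space pos_vectors"
    then have z: "\<And>i. 0 < z $ i" by (rule pos_vectors_pos)
    have "0 \<le> ?w i (z $ i) * h (z $ i)" for i
      using z[of i] h_nonneg[OF z] z_norm_pos[OF R, of i "best_fit i"] by (intro mult_nonneg_nonneg divide_nonneg_pos) auto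
    then have "(\<Prod>i\<in>UNIV. ennreal (?w i (z $ i) * h (z $ i))) = ennreal (\<Prod>i\<in>UNIV. ?w i (z $ i) * h (z $ i))"
      by (rule prod_ennreal)
    also have "(\<Prod>i\<in>UNIV. ?w i (z $ i) * h (z $ i)) = z_minorant t R z"
      unfolding z_minorant_def by (intro prod.cong) auto
    finally show "ennreal (z_minorant t R z) = (\<Prod>i\<in>UNIV. ennreal (?w i (z $ i) * h (z $ i)))" by simp
  qed
  also have "\<dots> = (\<Prod>i\<in>UNIV. \<integral>\<^sup>+u. ennreal (?w i u * h u) \<partial>pos_reals)"
    using w by (intro nn_integral_pos_vectors_prod) measurable
  also have "\<dots> \<noteq> 0"
  proof -
    have "(\<integral>\<^sup>+u. ennreal (?w i u * h u) \<partial>pos_reals) \<noteq> 0" for i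
      using z_norm_pos[OF R, of i "best_fit i"] by (intro nn_integral_mixing_pos[OF mixing w]) auto
    then show ?thesis by simp
  qed
  ultimately show False by simp
qed

text \<open>Each term of the drift function is nonnegative, hence bounded on a sublevel set.\<close>

lemma lyapunov_sublevel:
  assumes c: "0 < c" and s: "0 < s" and le: "lyapunov c (b, s) \<le> R" and M: "R \<le> M" "R / c \<le> M"
  shows "energy b \<le> M" and "s \<le> M" and "1 / s \<le> M" and "(resid i b)\<^sup>2 / s \<le> M * M"
proof -
  have cq: "0 \<le> c * energy b" using c energy_nonneg by simp
  have s0: "0 < 1 / s" using s by simp
  have "c * energy b + s + 1 / s \<le> R" using le by (simp add: lyapunov_def)
  then have *: "c * energy b \<le> R" "s \<le> R" "1 / s \<le> R" using cq s s0 by linarith+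
  have "energy b \<le> R / c" using *(1) c by (simp add: field_simps)
  then show qM: "energy b \<le> M" using M by simp
  show "s \<le> M" "1 / s \<le> M" using * M by auto
  have "(resid i b)\<^sup>2 * (1 / s) \<le> M * M"
    using resid_le_energy[of i b] qM * M s by (intro mult_mono) auto
  then show "(resid i b)\<^sup>2 / s \<le> M * M" by simp
qed

lemma systematic_minorization:
  "\<exists>\<nu>. sets \<nu> = sets (lborel \<Otimes>\<^sub>M pos_reals) \<and> emeasure \<nu> (space (lborel \<Otimes>\<^sub>M pos_reals)) \<noteq> 0 \<and>
    (\<forall>b s. 0 < s \<longrightarrow> lyapunov 1 (b, s) \<le> R \<longrightarrow> (\<forall>f\<in>borel_measurable (lborel \<Otimes>\<^sub>M pos_reals).
      (\<integral>\<^sup>+x. f x \<partial>\<nu>) \<le> (\<integral>\<^sup>+x. f x \<partial>gibbs.systematic (b, s))))"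
proof -
  let ?BS = "(lborel :: (real ^ 'p) measure) \<Otimes>\<^sub>M pos_reals"
  define M where "M = max R 1"
  have M: "0 < M" "R \<le> M" by (auto simp: M_def)
  let ?z1 = "\<lambda>z. ennreal (z_minorant (M * M) M z)" and ?s1 = "\<lambda>z v. ennreal (sigma2_minorant M z v)"
  have z1: "?z1 \<in> borel_measurable pos_vectors"
    using z_minorant_measurable[of "\<lambda>_. M * M" pos_vectors "\<lambda>_. M" "\<lambda>z. z"] by simp
  note s1 = sigma2_minorant_measurable[of M]
  define k where "k = (\<lambda>(b', v). \<integral>\<^sup>+z. ennreal (bdens v z b') * ?s1 z v * ?z1 z \<partial>pos_vectors)"
  let ?\<nu> = "density ?BS k"
  have s1': "(\<lambda>x. ?s1 (snd x) (snd (fst x))) \<in> borel_measurable (?BS \<Otimes>\<^sub>M pos_vectors)"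
    using measurable_compose[OF _ s1, of "\<lambda>x. (snd x, snd (fst x))" "?BS \<Otimes>\<^sub>M pos_vectors"] by simp
  have kmeas: "k \<in> borel_measurable ?BS"
  proof -
    note [measurable] = s1' z1
    show ?thesis unfolding k_def case_prod_beta' by measurable
  qed
  have knz: "k (b', v) \<noteq> 0" if v: "0 < v" for b' v
  proof -
    have [measurable]: "(\<lambda>z. ennreal (bdens v z b')) \<in> borel_measurable pos_vectors"
      using gibbs.pb_measurable[of "\<lambda>_. v" pos_vectors "\<lambda>z. z" "\<lambda>_. b'"] v by (simp add: space_pos_reals)
    have [measurable]: "(\<lambda>z. ?s1 z v) \<in> borel_measurable pos_vectors"
      using measurable_compose[OF _ s1, of "\<lambda>z. (z, v)" pos_vectors] v by (simp add: space_pos_reals)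
    have "(\<integral>\<^sup>+z. ?z1 z * (ennreal (bdens v z b') * ?s1 z v) \<partial>pos_vectors) \<noteq> 0"
      using M beta_density_misfit(3)[OF v, of _ b'] sigma2_minorant_pos[OF v]
      by (intro z_minorant_integral_nonzero) (auto simp: ennreal_eq_0_iff not_le)
    then show ?thesis by (simp add: k_def mult_ac)
  qed
  have "emeasure ?\<nu> (space ?BS) = (\<integral>\<^sup>+x. k x \<partial>?BS)"
    by (subst emeasure_density[OF kmeas sets.top]) (auto intro!: nn_integral_cong)
  then have "emeasure ?\<nu> (space ?BS) \<noteq> 0" using nn_integral_state_nonzero[OF kmeas knz] by simp
  moreover have "(\<integral>\<^sup>+x. f x \<partial>?\<nu>) \<le> (\<integral>\<^sup>+x. f x \<partial>gibbs.systematic (b, s))"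
    if s: "0 < s" and le: "lyapunov 1 (b, s) \<le> R" and f: "f \<in> borel_measurable ?BS" for b s f
  proof -
    note sub = lyapunov_sublevel[OF _ s le, of M]
    show ?thesis unfolding k_def
    proof (rule gibbs.systematic_mono_density[OF f _ _ z1 s1])
      show "?z1 z \<le> ennreal (zdens b s z)" if "z \<in> space pos_vectors" for z
        using sub M s pos_vectors_pos[OF that] by (intro ennreal_leI z_minorant_le) auto
      show "?s1 z v \<le> ennreal (sdens b z v)" if "z \<in> space pos_vectors" "v \<in> space pos_reals" for z v
        using sub M that(2) pos_vectors_pos[OF that(1)] by (intro ennreal_leI sigma2_minorant_le) (auto simp: space_pos_reals)
    qed (use s in \<open>auto simp: space_pos_reals\<close>)
  qed
  ultimately show ?thesis by (intro exI[of _ ?\<nu>]) auto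
qed

text \<open>After the \<open>\<sigma>\<^sup>2\<close> update the new variance \<open>v\<close> ranges over all positive numbers. The bound for the
  second latent draw may therefore depend on \<open>v\<close>; it must only be independent of \<open>\<beta>\<close>, whose residuals
  are still bounded because \<open>\<beta>\<close> has not moved.\<close>

lemma hybrid_minorization:
  assumes r: "0 < r" "r < 1" and c: "0 < c"
  shows "\<exists>\<nu>. sets \<nu> = sets (lborel \<Otimes>\<^sub>M pos_reals) \<and> emeasure \<nu> (space (lborel \<Otimes>\<^sub>M pos_reals)) \<noteq> 0 \<and>
    (\<forall>b s. 0 < s \<longrightarrow> lyapunov c (b, s) \<le> R \<longrightarrow> (\<forall>f\<in>borel_measurable (lborel \<Otimes>\<^sub>M pos_reals).
      (\<integral>\<^sup>+x. f x \<partial>\<nu>) \<le> (\<integral>\<^sup>+w. \<integral>\<^sup>+x. f x \<partial>gibbs.hybrid r w \<partial>gibbs.hybrid r (b, s))))"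
proof -
  let ?BS = "(lborel :: (real ^ 'p) measure) \<Otimes>\<^sub>M pos_reals"
  define M where "M = Max {R, R / c, 1}"
  have M: "0 < M" "R \<le> M" "R / c \<le> M" by (auto simp: M_def less_max_iff_disj)
  let ?z1 = "\<lambda>z. ennreal (z_minorant (M * M) M z)" and ?s1 = "\<lambda>z v. ennreal (sigma2_minorant M z v)"
  let ?z2 = "\<lambda>v z. ennreal (z_minorant (M / v) v z)"
  have z1: "?z1 \<in> borel_measurable pos_vectors"
    using z_minorant_measurable[of "\<lambda>_. M * M" pos_vectors "\<lambda>_. M" "\<lambda>z. z"] by simp
  note s1 = sigma2_minorant_measurable[of M]
  have z2: "(\<lambda>(v, z). ?z2 v z) \<in> borel_measurable (pos_reals \<Otimes>\<^sub>M pos_vectors)"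
  proof -
    have [measurable]: "fst \<in> borel_measurable (pos_reals \<Otimes>\<^sub>M (pos_vectors :: (real ^ 'm) measure))"
      by (rule pos_reals_borel) measurable
    have "(\<lambda>x. z_minorant (M / fst x) (fst x) (snd x)) \<in> borel_measurable (pos_reals \<Otimes>\<^sub>M pos_vectors)"
      by (rule z_minorant_measurable) measurable
    then show ?thesis by (simp add: case_prod_beta')
  qed
  define k where "k = (\<lambda>(b', v). ennreal r * ennreal (1 - r) *
      ((\<integral>\<^sup>+z. ?z1 z * ?s1 z v \<partial>pos_vectors) * (\<integral>\<^sup>+z. ?z2 v z * ennreal (bdens v z b') \<partial>pos_vectors)))"
  let ?\<nu> = "density ?BS k"
  have s1': "(\<lambda>x. ?s1 (snd x) (snd (fst x))) \<in> borel_measurable (?BS \<Otimes>\<^sub>M pos_vectors)"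
    using measurable_compose[OF _ s1, of "\<lambda>x. (snd x, snd (fst x))" "?BS \<Otimes>\<^sub>M pos_vectors"] by simp
  have z2': "(\<lambda>x. ?z2 (snd (fst x)) (snd x)) \<in> borel_measurable (?BS \<Otimes>\<^sub>M pos_vectors)"
    using measurable_compose[OF _ z2, of "\<lambda>x. (snd (fst x), snd x)" "?BS \<Otimes>\<^sub>M pos_vectors"] by simp
  have kmeas: "k \<in> borel_measurable ?BS"
  proof -
    note [measurable] = s1' z1 z2'
    show ?thesis unfolding k_def case_prod_beta' by measurable
  qed
  have knz: "k (b', v) \<noteq> 0" if v: "0 < v" for b' v
  proof -
    have [measurable]: "(\<lambda>z. ennreal (bdens v z b')) \<in> borel_measurable pos_vectors"
      using gibbs.pb_measurable[of "\<lambda>_. v" pos_vectors "\<lambda>z. z" "\<lambda>_. b'"] v by (simp add: space_pos_reals)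
    have [measurable]: "(\<lambda>z. ?s1 z v) \<in> borel_measurable pos_vectors"
      using measurable_compose[OF _ s1, of "\<lambda>z. (z, v)" pos_vectors] v by (simp add: space_pos_reals)
    have "(\<integral>\<^sup>+z. ?z1 z * ?s1 z v \<partial>pos_vectors) \<noteq> 0"
      using M sigma2_minorant_pos[OF v] by (intro z_minorant_integral_nonzero) (auto simp: ennreal_eq_0_iff not_le)
    moreover have "(\<integral>\<^sup>+z. ?z2 v z * ennreal (bdens v z b') \<partial>pos_vectors) \<noteq> 0"
      using v beta_density_misfit(3)[OF v, of _ b']
      by (intro z_minorant_integral_nonzero) (auto simp: ennreal_eq_0_iff not_le)
    ultimately show ?thesis using r by (simp add: k_def ennreal_eq_0_iff)
  qed
  have "emeasure ?\<nu> (space ?BS) = (\<integral>\<^sup>+x. k x \<partial>?BS)"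
    by (subst emeasure_density[OF kmeas sets.top]) (auto intro!: nn_integral_cong)
  then have "emeasure ?\<nu> (space ?BS) \<noteq> 0" using nn_integral_state_nonzero[OF kmeas knz] by simp
  moreover have "(\<integral>\<^sup>+x. f x \<partial>?\<nu>) \<le> (\<integral>\<^sup>+w. \<integral>\<^sup>+x. f x \<partial>gibbs.hybrid r w \<partial>gibbs.hybrid r (b, s))"
    if s: "0 < s" and le: "lyapunov c (b, s) \<le> R" and f: "f \<in> borel_measurable ?BS" for b s f
  proof -
    note sub = lyapunov_sublevel[OF c s le M(2,3)]
    show ?thesis unfolding k_def
    proof (rule gibbs.hybrid_two_step_lower_bound[OF f _ _ r z1 s1 z2])
      show "?z1 z \<le> ennreal (zdens b s z)" if "z \<in> space pos_vectors" for z
        using sub s pos_vectors_pos[OF that] by (intro ennreal_leI z_minorant_le) auto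
      show "?s1 z v \<le> ennreal (sdens b z v)" if "z \<in> space pos_vectors" "v \<in> space pos_reals" for z v
        using sub that(2) pos_vectors_pos[OF that(1)] by (intro ennreal_leI sigma2_minorant_le) (auto simp: space_pos_reals)
      show "?z2 v z \<le> ennreal (zdens b v z)" if "v \<in> space pos_reals" "z \<in> space pos_vectors" for v z
      proof (rule ennreal_leI, rule z_minorant_le)
        show v: "0 < v" "v \<le> v" using that(1) by (auto simp: space_pos_reals)
        show "(resid i b)\<^sup>2 / v \<le> M / v" for i
          using v resid_le_energy[of i b] sub(1) by (intro divide_right_mono) auto
      qed (rule pos_vectors_pos[OF that(2)])
    qed (use s in \<open>auto simp: space_pos_reals\<close>)
  qed
  ultimately show ?thesis by (intro exI[of _ ?\<nu>]) auto
qed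

end

section \<open>Geometric ergodicity\<close>

context scale_mixture_regression
begin

lemma state_cases:
  assumes "x \<in> space ((lborel :: (real ^ 'p) measure) \<Otimes>\<^sub>M pos_reals)"
  obtains b s where "x = (b, s)" "0 < s"
  using assms by (cases x) (auto simp: space_pair_measure space_pos_reals)

text \<open>The kernel agrees with the abstract Gibbs sampler on the state space only, so its properties are
  transferred before Harris' theorem is applied.\<close>

theorem systematic_scan_geometrically_ergodic:
  assumes \<psi>: "0 \<le> \<psi>" "\<psi> < 1"
    and w: "\<And>b s. 0 < s \<Longrightarrow> residual_ratio b s \<le> \<psi> * (energy b + s + 1 / s) + L"
  shows "geometrically_ergodic state_space (systematic_scan_kernel y X h \<alpha> \<gamma> \<mu> \<Sigma>) (marginal_posterior y X h \<alpha> \<gamma> \<mu> \<Sigma>)"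
proof -
  let ?BS = "(lborel :: (real ^ 'p) measure) \<Otimes>\<^sub>M pos_reals"
  let ?K = "systematic_scan_kernel y X h \<alpha> \<gamma> \<mu> \<Sigma>" and ?P = "marginal_posterior y X h \<alpha> \<gamma> \<mu> \<Sigma>"
  have eq: "?K x = gibbs.systematic x" if "x \<in> space ?BS" for x
    using systematic_scan_gibbs[of x] that by (simp add: state_space_pair)
  have K: "?K \<in> ?BS \<rightarrow>\<^sub>M prob_algebra ?BS"
    using gibbs.systematic_kernel by (rule measurable_cong[THEN iffD2, rotated]) (rule eq)
  have P: "sets ?P = sets ?BS" "?P \<bind> ?K = ?P"
  proof -
    show "sets ?P = sets ?BS" by (simp add: marginal_posterior_density)
    have "?P \<bind> ?K = density ?BS posterior \<bind> gibbs.systematic"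
      unfolding marginal_posterior_density by (rule bind_cong[OF refl]) (simp add: eq)
    also have "\<dots> = ?P"
      unfolding marginal_posterior_density using posterior_s_conditional posterior_b_conditional state_nonempty
      by (intro gibbs.systematic_invariant) auto
    finally show "?P \<bind> ?K = ?P" .
  qed
  obtain L' where L': "0 \<le> L'" "\<And>b s. 0 < s \<Longrightarrow>
    (\<integral>\<^sup>+x. ennreal (lyapunov 1 x) \<partial>gibbs.systematic (b, s)) \<le> ennreal (\<psi> * lyapunov 1 (b, s) + L')"
    using systematic_drift[OF w] by blast
  show ?thesis unfolding state_space_pair
  proof (rule harris_geometric_ergodicity[OF K prob_space_posterior P lyapunov_measurable[of 1] _ \<psi> L'(1)])
    fix x assume x: "x \<in> space ?BS"
    then obtain b s where bs: "x = (b, s)" "0 < s" by (rule state_cases)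
    show "0 \<le> lyapunov 1 x" unfolding bs(1) using bs(2) by (simp add: lyapunov_nonneg)
    show "(\<integral>\<^sup>+z. ennreal (lyapunov 1 z) \<partial>?K x) \<le> ennreal (\<psi> * lyapunov 1 x + L')"
      unfolding eq[OF x] unfolding bs(1) by (rule L'(2)[OF bs(2)])
  next
    fix R
    obtain \<nu> where \<nu>: "sets \<nu> = sets ?BS" "emeasure \<nu> (space ?BS) \<noteq> 0"
      "\<And>b s f. 0 < s \<Longrightarrow> lyapunov 1 (b, s) \<le> R \<Longrightarrow> f \<in> borel_measurable ?BS \<Longrightarrow>
        (\<integral>\<^sup>+x. f x \<partial>\<nu>) \<le> (\<integral>\<^sup>+x. f x \<partial>gibbs.systematic (b, s))"
      using systematic_minorization[of R] by blast
    show "\<exists>\<nu>. sets \<nu> = sets ?BS \<and> emeasure \<nu> (space ?BS) \<noteq> 0 \<and> (\<forall>x\<in>space ?BS. lyapunov 1 x \<le> R \<longrightarrow>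
      (\<forall>f\<in>borel_measurable ?BS. (\<integral>\<^sup>+z. f z \<partial>\<nu>) \<le> (\<integral>\<^sup>+w. \<integral>\<^sup>+z. f z \<partial>?K w \<partial>?K x)))"
    proof (rule minorization_two_step[OF K \<nu>(1,2)])
      fix x and f :: "(real ^ 'p) \<times> real \<Rightarrow> ennreal"
      assume x: "x \<in> space ?BS" and le: "lyapunov 1 x \<le> R" and f: "f \<in> borel_measurable ?BS"
      obtain b s where bs: "x = (b, s)" "0 < s" using x by (rule state_cases)
      show "(\<integral>\<^sup>+z. f z \<partial>\<nu>) \<le> (\<integral>\<^sup>+z. f z \<partial>?K x)"
        unfolding eq[OF x] using \<nu>(3)[OF bs(2) _ f] le unfolding bs(1) by blast
    qed
  qed
qed

theorem hybrid_scan_geometrically_ergodic: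
  assumes \<psi>: "0 < \<psi>2" "0 \<le> \<psi>3" "\<psi>3 < 1" and r: "0 < r" "r < 1"
    and w: "\<And>b s. 0 < s \<Longrightarrow> residual_ratio b s \<le> \<psi>2 * energy b + \<psi>3 * (s + 1 / s) + L"
  shows "geometrically_ergodic state_space (hybrid_scan_kernel y X h \<alpha> \<gamma> \<mu> \<Sigma> r) (marginal_posterior y X h \<alpha> \<gamma> \<mu> \<Sigma>)"
proof -
  let ?BS = "(lborel :: (real ^ 'p) measure) \<Otimes>\<^sub>M pos_reals"
  let ?P = "marginal_posterior y X h \<alpha> \<gamma> \<mu> \<Sigma>"
  have P: "sets ?P = sets ?BS" "?P \<bind> gibbs.hybrid r = ?P"
  proof -
    show "sets ?P = sets ?BS" by (simp add: marginal_posterior_density)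
    show "?P \<bind> gibbs.hybrid r = ?P"
      unfolding marginal_posterior_density using posterior_s_conditional posterior_b_conditional state_nonempty r
      by (intro gibbs.hybrid_invariant) auto
  qed
  obtain c g L' where c: "0 < c" and g: "0 \<le> g" "g < 1" and L': "0 \<le> L'" "\<And>b s. 0 < s \<Longrightarrow>
    (\<integral>\<^sup>+x. ennreal (lyapunov c x) \<partial>gibbs.hybrid r (b, s)) \<le> ennreal (g * lyapunov c (b, s) + L')"
    using hybrid_drift[OF \<psi> r w] by blast
  show ?thesis unfolding state_space_pair hybrid_scan_gibbs
  proof (rule harris_geometric_ergodicity[OF gibbs.hybrid_kernel[OF r] prob_space_posterior P lyapunov_measurable[of c] _ g L'(1)])
    fix x assume x: "x \<in> space ?BS"
    then obtain b s where bs: "x = (b, s)" "0 < s" by (rule state_cases)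
    show "0 \<le> lyapunov c x" unfolding bs(1) using bs(2) c by (simp add: lyapunov_nonneg)
    show "(\<integral>\<^sup>+z. ennreal (lyapunov c z) \<partial>gibbs.hybrid r x) \<le> ennreal (g * lyapunov c x + L')"
      unfolding bs(1) by (rule L'(2)[OF bs(2)])
  next
    fix R
    obtain \<nu> where \<nu>: "sets \<nu> = sets ?BS" "emeasure \<nu> (space ?BS) \<noteq> 0"
      "\<And>b s f. 0 < s \<Longrightarrow> lyapunov c (b, s) \<le> R \<Longrightarrow> f \<in> borel_measurable ?BS \<Longrightarrow>
        (\<integral>\<^sup>+x. f x \<partial>\<nu>) \<le> (\<integral>\<^sup>+w. \<integral>\<^sup>+x. f x \<partial>gibbs.hybrid r w \<partial>gibbs.hybrid r (b, s))"
      using hybrid_minorization[OF r c, of R] by blast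
    show "\<exists>\<nu>. sets \<nu> = sets ?BS \<and> emeasure \<nu> (space ?BS) \<noteq> 0 \<and> (\<forall>x\<in>space ?BS. lyapunov c x \<le> R \<longrightarrow>
      (\<forall>f\<in>borel_measurable ?BS. (\<integral>\<^sup>+z. f z \<partial>\<nu>) \<le> (\<integral>\<^sup>+w. \<integral>\<^sup>+z. f z \<partial>gibbs.hybrid r w \<partial>gibbs.hybrid r x)))"
    proof (intro exI[of _ \<nu>] conjI ballI impI \<nu>(1,2))
      fix x and f :: "(real ^ 'p) \<times> real \<Rightarrow> ennreal"
      assume x: "x \<in> space ?BS" and le: "lyapunov c x \<le> R" and f: "f \<in> borel_measurable ?BS"
      obtain b s where bs: "x = (b, s)" "0 < s" using x by (rule state_cases)
      show "(\<integral>\<^sup>+z. f z \<partial>\<nu>) \<le> (\<integral>\<^sup>+w. \<integral>\<^sup>+z. f z \<partial>gibbs.hybrid r w \<partial>gibbs.hybrid r x)"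
        using \<nu>(3)[OF bs(2) _ f] le unfolding bs(1) by blast
    qed
  qed
qed

end

theorem theorem2:
  fixes y :: "real ^ 'm" and X :: "real ^ 'p ^ 'm"
    and \<mu> :: "real ^ 'p" and \<Sigma> :: "real ^ 'p ^ 'p"
    and \<alpha> \<gamma> :: real and h :: "real \<Rightarrow> real"
  assumes "CARD('m) \<ge> max 2 CARD('p)"
    and "pos_def_matrix \<Sigma>" and "\<alpha> > 0" and "\<gamma> > 0"
    and "mixing_density h"
    and "z_conditionals_exist y X h"
  shows
    "((\<exists>(\<psi>\<^sub>1::real) (L\<^sub>1::real). 0 \<le> \<psi>\<^sub>1 \<and> \<psi>\<^sub>1 < 1 \<and>
        (\<forall>\<beta> s. 0 < s \<longrightarrow>
           (\<Sum>i\<in>UNIV. z_mean y X h i \<beta> s * (y $ i - X $ i \<bullet> \<beta>)\<^sup>2) / (real CARD('m) + 2 * \<alpha> - 2)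
           \<le> \<psi>\<^sub>1 * ((\<Sum>i\<in>UNIV. (y $ i - X $ i \<bullet> \<beta>)\<^sup>2) + \<beta> \<bullet> (matrix_inv \<Sigma> *v \<beta>) + s + 1 / s) + L\<^sub>1))
      \<longrightarrow> geometrically_ergodic state_space
            (systematic_scan_kernel y X h \<alpha> \<gamma> \<mu> \<Sigma>) (marginal_posterior y X h \<alpha> \<gamma> \<mu> \<Sigma>))
   \<and> ((\<exists>(\<psi>\<^sub>2::real) (\<psi>\<^sub>3::real) (L\<^sub>2::real). 0 < \<psi>\<^sub>2 \<and> 0 \<le> \<psi>\<^sub>3 \<and> \<psi>\<^sub>3 < 1 \<and>
        (\<forall>\<beta> s. 0 < s \<longrightarrow>
           (\<Sum>i\<in>UNIV. z_mean y X h i \<beta> s * (y $ i - X $ i \<bullet> \<beta>)\<^sup>2) / (real CARD('m) + 2 * \<alpha> - 2)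
           \<le> \<psi>\<^sub>2 * ((\<Sum>i\<in>UNIV. (y $ i - X $ i \<bullet> \<beta>)\<^sup>2) + \<beta> \<bullet> (matrix_inv \<Sigma> *v \<beta>))
              + \<psi>\<^sub>3 * (s + 1 / s) + L\<^sub>2))
      \<longrightarrow> (\<forall>r. 0 < r \<and> r < 1 \<longrightarrow> geometrically_ergodic state_space
            (hybrid_scan_kernel y X h \<alpha> \<gamma> \<mu> \<Sigma> r) (marginal_posterior y X h \<alpha> \<gamma> \<mu> \<Sigma>)))"
proof -
  interpret scale_mixture_regression y X h \<alpha> \<gamma> \<mu> \<Sigma>
    using assms by unfold_locales auto
  show ?thesis
    unfolding energy_def[symmetric] residual_ratio_def[symmetric]
    using systematic_scan_geometrically_ergodic hybrid_scan_geometrically_ergodic by blast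
qed

end
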